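(* Let $M$ be a connected complete Riemannian manifold without boundary. If the dimension of $M$ is at least $4$, then the $L^2$-Liouville property holds on $M\setminus\{p\}$ for any $p\in M$.
   Context: The Laplacian is $\Delta u=-\operatorname{div}\nabla u$ and $\mu$ is the Riemannian measure. The $L^2$-Liouville property holds on a Riemannian manifold $N$ without boundary (here $N=M\setminus\{p\}$) if every harmonic function on $N$ (i.e. $\Delta u=0$ on $N$) belonging to $L^2(N,\mu)$ is constant; this is equivalent to every element of the kernel of the adjoint of $\Delta|_{C_c^\infty(N)}$ being constant. *)

theory Defs
  imports "HOL-Analysis.Analysis"
begin

section \<open>Smooth functions on open subsets of Euclidean space\<close>

text \<open>
  These notions are meant for open \<open>S\<close>. On an open set, \<open>f\<close> is \<open>C\<^sup>k\<^sup>+\<^sup>1\<close> iff it is differentiable and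
  all its directional derivatives are \<open>C\<^sup>k\<close>.
\<close>

fun Ck_on :: "nat \<Rightarrow> 'a::real_normed_vector set \<Rightarrow> ('a \<Rightarrow> 'b::real_normed_vector) \<Rightarrow> bool" where
  "Ck_on 0 S f \<longleftrightarrow> continuous_on S f"
| "Ck_on (Suc k) S f \<longleftrightarrow> (\<forall>x\<in>S. f differentiable (at x)) \<and>
     (\<forall>v. Ck_on k S (\<lambda>x. frechet_derivative f (at x) v))"

definition smooth_on :: "'a::real_normed_vector set \<Rightarrow> ('a \<Rightarrow> 'b::real_normed_vector) \<Rightarrow> bool" where
  "smooth_on S f \<longleftrightarrow> (\<forall>k. Ck_on k S f)"

definition partial :: "'n \<Rightarrow> (real^'n \<Rightarrow> real) \<Rightarrow> real^'n \<Rightarrow> real" where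
  "partial i f x = frechet_derivative f (at x) (axis i 1)"


section \<open>Smooth manifolds\<close>

text \<open>
  A chart is a pair of its domain \<open>U\<close> and a map \<open>\<phi>\<close>, of which only the values on \<open>U\<close> matter.
  The manifold is the union of the chart domains, an open subset of the ambient type, with the
  subspace topology. Its dimension is \<open>CARD('n)\<close>.
\<close>

type_synonym ('a, 'n) chart = "'a set \<times> ('a \<Rightarrow> real^'n)"

abbreviation chart_dom :: "('a, 'n) chart \<Rightarrow> 'a set" where
  "chart_dom c \<equiv> fst c"

abbreviation chart_map :: "('a, 'n) chart \<Rightarrow> 'a \<Rightarrow> real^'n" where
  "chart_map c \<equiv> snd c"

definition chart_inv :: "('a, 'n) chart \<Rightarrow> real^'n \<Rightarrow> 'a" where
  "chart_inv c = inv_into (chart_dom c) (chart_map c)"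

definition chart_img :: "('a, 'n) chart \<Rightarrow> (real^'n) set" where
  "chart_img c = chart_map c ` chart_dom c"

definition is_chart :: "('a::topological_space, 'n::finite) chart \<Rightarrow> bool" where
  "is_chart c \<longleftrightarrow> open (chart_dom c) \<and> open (chart_img c) \<and>
     homeomorphism (chart_dom c) (chart_img c) (chart_map c) (chart_inv c)"

definition transition :: "('a, 'n) chart \<Rightarrow> ('a, 'n) chart \<Rightarrow> real^'n \<Rightarrow> real^'n" where
  "transition c d = chart_map d \<circ> chart_inv c"

definition smooth_atlas :: "('a::topological_space, 'n::finite) chart set \<Rightarrow> bool" where
  "smooth_atlas A \<longleftrightarrow> (\<forall>c\<in>A. is_chart c) \<and>
     (\<forall>c\<in>A. \<forall>d\<in>A. smooth_on (chart_map c ` (chart_dom c \<inter> chart_dom d)) (transition c d))"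

definition carrier :: "('a, 'n) chart set \<Rightarrow> 'a set" where
  "carrier A = (\<Union>c\<in>A. chart_dom c)"


section \<open>Riemannian metrics\<close>

text \<open>
  A metric is given by its coefficient matrices \<open>g\<^sub>i\<^sub>j\<close> in each chart, as functions of the coordinates.
\<close>

type_synonym ('a, 'n) metric_coeffs = "('a, 'n) chart \<Rightarrow> real^'n \<Rightarrow> real^'n^'n"

definition riemannian_metric ::
  "('a::topological_space, 'n::finite) chart set \<Rightarrow> ('a, 'n) metric_coeffs \<Rightarrow> bool" where
  "riemannian_metric A g \<longleftrightarrow>
     (\<forall>c\<in>A. smooth_on (chart_img c) (g c) \<and>
        (\<forall>x\<in>chart_img c. transpose (g c x) = g c x \<and> (\<forall>v. v \<noteq> 0 \<longrightarrow> v \<bullet> (g c x *v v) > 0))) \<and>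
     (\<forall>c\<in>A. \<forall>d\<in>A. \<forall>x\<in>chart_map c ` (chart_dom c \<inter> chart_dom d).
        let J = matrix (frechet_derivative (transition c d) (at x))
        in g c x = transpose J ** g d (transition c d x) ** J)"

definition riemannian_manifold ::
  "('a::topological_space, 'n::finite) chart set \<Rightarrow> ('a, 'n) metric_coeffs \<Rightarrow> bool" where
  "riemannian_manifold A g \<longleftrightarrow> smooth_atlas A \<and> riemannian_metric A g"


section \<open>Riemannian distance and completeness\<close>

text \<open>
  \<open>curve_length A g q r L\<close>: some piecewise \<open>C\<^sup>1\<close> curve from \<open>q\<close> to \<open>r\<close> has length \<open>L\<close>. By compactness,
  every piecewise \<open>C\<^sup>1\<close> curve is a finite concatenation of \<open>C\<^sup>1\<close> pieces each lying in a single chart;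
  \<open>\<sigma>\<close> is the coordinate expression of such a piece.
\<close>

definition coord_length :: "(real^'n \<Rightarrow> real^'n^'n) \<Rightarrow> (real \<Rightarrow> real^'n::finite) \<Rightarrow> real" where
  "coord_length G \<sigma> = integral {0..1}
     (\<lambda>t. sqrt (vector_derivative \<sigma> (at t) \<bullet> (G (\<sigma> t) *v vector_derivative \<sigma> (at t))))"

inductive curve_length ::
  "('a, 'n::finite) chart set \<Rightarrow> ('a, 'n) metric_coeffs \<Rightarrow> 'a \<Rightarrow> 'a \<Rightarrow> real \<Rightarrow> bool"
  for A g where
  trivial: "q \<in> carrier A \<Longrightarrow> curve_length A g q q 0"
| append: "\<lbrakk>curve_length A g q (chart_inv c (\<sigma> 0)) L; c \<in> A; \<sigma> C1_differentiable_on {0..1};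
            \<sigma> ` {0..1} \<subseteq> chart_img c\<rbrakk>
           \<Longrightarrow> curve_length A g q (chart_inv c (\<sigma> 1)) (L + coord_length (g c) \<sigma>)"

text \<open>The value \<open>0\<close> outside the manifold is what the locale \<^locale>\<open>Metric_space\<close> needs.\<close>

definition riemannian_dist ::
  "('a, 'n::finite) chart set \<Rightarrow> ('a, 'n) metric_coeffs \<Rightarrow> 'a \<Rightarrow> 'a \<Rightarrow> real" where
  "riemannian_dist A g q r =
     (if q \<in> carrier A \<and> r \<in> carrier A then Inf {L. curve_length A g q r L} else 0)"

definition complete_riemannian ::
  "('a, 'n::finite) chart set \<Rightarrow> ('a, 'n) metric_coeffs \<Rightarrow> bool" where
  "complete_riemannian A g \<longleftrightarrow> Metric_space.mcomplete (carrier A) (riemannian_dist A g)"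


section \<open>Riemannian measure\<close>

text \<open>
  The unique Borel measure on the manifold that is \<open>sqrt (det g) dx\<close> in every chart.
\<close>

definition riemannian_measure ::
  "('a::topological_space, 'n::finite) chart set \<Rightarrow> ('a, 'n) metric_coeffs \<Rightarrow> 'a measure \<Rightarrow> bool" where
  "riemannian_measure A g \<mu> \<longleftrightarrow>
     sets \<mu> = sets (restrict_space borel (carrier A)) \<and>
     (\<forall>c\<in>A. \<forall>B\<in>sets borel. B \<subseteq> chart_dom c \<longrightarrow>
        emeasure \<mu> B = (\<integral>\<^sup>+x\<in>chart_map c ` B. ennreal (sqrt (det (g c x))) \<partial>lborel))"


section \<open>Laplacian and harmonic functions\<close>

text \<open>
  In a chart with metric coefficients \<open>G\<close>, the gradient has components \<open>\<Sum>j. g\<^sup>i\<^sup>j \<partial>\<^sub>j f\<close>, and the divergence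
  of a vector field is \<open>(det G)\<^sup>-\<^sup>1\<^sup>/\<^sup>2 \<Sum>i. \<partial>\<^sub>i ((det G)\<^sup>1\<^sup>/\<^sup>2 X\<^sup>i)\<close>.
\<close>

definition grad :: "(real^'n \<Rightarrow> real^'n^'n) \<Rightarrow> (real^'n \<Rightarrow> real) \<Rightarrow> real^'n \<Rightarrow> real^'n::finite" where
  "grad G f x = matrix_inv (G x) *v (\<chi> j. partial j f x)"

definition divergence ::
  "(real^'n \<Rightarrow> real^'n^'n) \<Rightarrow> (real^'n \<Rightarrow> real^'n) \<Rightarrow> real^'n::finite \<Rightarrow> real" where
  "divergence G X x =
     (\<Sum>i\<in>UNIV. partial i (\<lambda>y. sqrt (det (G y)) * X y $ i) x) / sqrt (det (G x))"

text \<open>\<open>laplacian g c u q\<close> does not depend on the chart \<open>c\<close> around \<open>q\<close>.\<close>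

definition laplacian ::
  "('a, 'n::finite) metric_coeffs \<Rightarrow> ('a, 'n) chart \<Rightarrow> ('a \<Rightarrow> real) \<Rightarrow> 'a \<Rightarrow> real" where
  "laplacian g c u q = - divergence (g c) (grad (g c) (u \<circ> chart_inv c)) (chart_map c q)"

text \<open>
  For an open subset \<open>N\<close> of the manifold; \<open>N\<close> is itself a Riemannian manifold, with the restricted
  charts, metric and measure.
\<close>

definition harmonic_on_manifold ::
  "('a::topological_space, 'n::finite) chart set \<Rightarrow> ('a, 'n) metric_coeffs \<Rightarrow> 'a set \<Rightarrow>
   ('a \<Rightarrow> real) \<Rightarrow> bool" where
  "harmonic_on_manifold A g N u \<longleftrightarrow>
     (\<forall>c\<in>A. Ck_on 2 (chart_map c ` (chart_dom c \<inter> N)) (u \<circ> chart_inv c) \<and>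
        (\<forall>q\<in>chart_dom c \<inter> N. laplacian g c u q = 0))"

definition square_integrable_on :: "'a measure \<Rightarrow> 'a set \<Rightarrow> ('a \<Rightarrow> real) \<Rightarrow> bool" where
  "square_integrable_on \<mu> N u \<longleftrightarrow>
     set_borel_measurable \<mu> N u \<and> set_integrable \<mu> N (\<lambda>q. (u q)\<^sup>2)"

definition L2_Liouville ::
  "('a::topological_space, 'n::finite) chart set \<Rightarrow> ('a, 'n) metric_coeffs \<Rightarrow> 'a measure \<Rightarrow>
   'a set \<Rightarrow> bool" where
  "L2_Liouville A g \<mu> N \<longleftrightarrow>
     (\<forall>u. harmonic_on_manifold A g N u \<and> square_integrable_on \<mu> N u \<longrightarrow> u constant_on N)"

end

theory Submission
  imports Defs
begin

text \<open>
  Let \<open>u\<close> be harmonic and square integrable off \<open>p\<close>, and let \<open>\<Psi>\<close> be the primitive of \<open>arctan\<close> with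
  \<open>\<Psi>(0) = 0\<close>. Then \<open>div grad (\<Psi> \<circ> u) = |grad u|\<^sup>2 / (1 + u\<^sup>2) \<ge> 0\<close>. Since \<open>|\<Psi>(u)| \<le> 2|u|\<close>, a cutoff
  \<open>\<eta>\<^sub>\<epsilon>\<close> at the puncture costs at most \<open>C \<epsilon>\<^sup>-\<^sup>2 \<integral>|u|\<close> over the ball of radius \<open>2\<epsilon>\<close>, which tends to \<open>0\<close>
  in dimension at least \<open>4\<close> by the Cauchy-Schwarz inequality. So no regularity theory at \<open>p\<close> is needed.
  At infinity, completeness (Hopf-Rinow) gives compactly supported cutoffs \<open>\<zeta>\<^sub>R\<close> that are functions of the
  distance and \<open>1/R\<close>-Lipschitz, and Young's inequality with \<open>arctan(u)\<^sup>2 (1 + u\<^sup>2) \<le> 5u\<^sup>2\<close> yields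
  \<open>\<integral> \<zeta>\<^sub>R\<^sup>2 \<eta>\<^sub>\<epsilon> |grad u|\<^sup>2 / (1 + u\<^sup>2) \<le> o(1) + C R\<^sup>-\<^sup>2 \<integral> u\<^sup>2\<close>. Letting \<open>\<epsilon> \<rightarrow> 0\<close> and then \<open>R \<rightarrow> \<infinity>\<close>, the
  gradient of \<open>u\<close> vanishes.
\<close>

section \<open>Continuously differentiable functions\<close>

text \<open>Testing with the square of \<open>u\<close> would leave
  \<open>\<epsilon>\<^sup>-\<^sup>2 \<integral>u\<^sup>2\<close> at the puncture, which need not
  tend to 0; the linear growth of \<open>\<Psi>\<close> replaces it by an L1 norm. In dimension 4
  the volume factor from Cauchy-Schwarz only balances \<open>\<epsilon>\<^sup>-\<^sup>2\<close>, and
  the smallness is that of the L2 norm of \<open>u\<close> over shrinking balls. As grad u is not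
  controlled near \<open>p\<close>, both derivatives have to land on the puncture cutoff
  \<open>e\<close>. Hence the antisymmetric field \<open>e grad v - v grad e\<close> with
  \<open>v = \<Psi> \<circ> u\<close>: its divergence contains no product of the two gradients.
  Integration happens in charts, and the charts over a ball of radius \<open>2R\<close> change with
  \<open>R\<close>. The constants may therefore depend on the dimension only. So each chart piece is
  estimated in a frame that is nearly an Auerbach basis of the metric, not along the coordinate
  axes. The gradients of the localizing weights are never estimated: they stay on the left hand side
  as exact terms and cancel when the weights add up to 1.\<close>

abbreviation C1_on :: "'a::real_normed_vector set \<Rightarrow> ('a \<Rightarrow> 'b::real_normed_vector) \<Rightarrow> bool" where
  "C1_on \<equiv> Ck_on (Suc 0)"

lemma C1_onI:
  assumes "\<And>x. x \<in> S \<Longrightarrow> (f has_derivative f' x) (at x)"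
    and "\<And>v. continuous_on S (\<lambda>x. f' x v)"
  shows "C1_on S f"
proof -
  have "frechet_derivative f (at x) = f' x" if "x \<in> S" for x
    using frechet_derivative_at[OF assms(1)[OF that]] by simp
  then have "continuous_on S (\<lambda>x. frechet_derivative f (at x) v)" for v
    using assms(2)[of v] by (subst continuous_on_cong[OF refl, of _ _ "\<lambda>x. f' x v"]) auto
  then show ?thesis using assms(1) by (auto simp: differentiable_def)
qed

lemma C1_on_has_derivative:
  "C1_on S f \<Longrightarrow> x \<in> S \<Longrightarrow> (f has_derivative frechet_derivative f (at x)) (at x)"
  by (simp add: frechet_derivative_works)

lemma C1_on_differentiable: "C1_on S f \<Longrightarrow> x \<in> S \<Longrightarrow> f differentiable (at x)"
  by simp

lemma C1_on_continuous_derivative: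
  "C1_on S f \<Longrightarrow> continuous_on S (\<lambda>x. frechet_derivative f (at x) v)"
  by simp

lemma C1_on_continuous: "C1_on S f \<Longrightarrow> continuous_on S f"
  by (meson C1_on_differentiable continuous_at_imp_continuous_on differentiable_imp_continuous_within)

lemma C1_on_subset: "C1_on S f \<Longrightarrow> T \<subseteq> S \<Longrightarrow> C1_on T f"
  by (auto intro: continuous_on_subset)

text \<open>The predicates under the choice operator in \<open>frechet_derivative\<close> coincide,
  so the equation also covers points where no derivative exists.\<close>

lemma frechet_derivative_transform:
  assumes "open S" "x \<in> S" "\<And>y. y \<in> S \<Longrightarrow> f y = h y"
  shows "frechet_derivative f (at x) = frechet_derivative h (at x)"
proof -
  have "(f has_derivative F) (at x) \<longleftrightarrow> (h has_derivative F) (at x)" for F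
    using assms by (metis has_derivative_transform_within_open)
  then show ?thesis by (simp add: frechet_derivative_def)
qed

lemma differentiable_transform:
  assumes "open S" "x \<in> S" "\<And>y. y \<in> S \<Longrightarrow> f y = h y"
  shows "f differentiable (at x) \<longleftrightarrow> h differentiable (at x)"
  using assms unfolding differentiable_def by (metis has_derivative_transform_within_open)

lemma C1_on_cong:
  assumes "open S" "\<And>y. y \<in> S \<Longrightarrow> f y = h y"
  shows "C1_on S f \<longleftrightarrow> C1_on S h"
proof -
  have "continuous_on S (\<lambda>x. frechet_derivative f (at x) v) \<longleftrightarrow>
        continuous_on S (\<lambda>x. frechet_derivative h (at x) v)" for v
    by (rule continuous_on_cong[OF refl])
      (use frechet_derivative_transform[OF assms(1) _ assms(2)] in auto)
  then show ?thesis using differentiable_transform[OF assms(1) _ assms(2)] by auto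
qed

text \<open>\<open>Ck_on\<close> differentiates in the full space and not within the set, so
  pointwise neighbourhoods suffice, even those that leave \<open>S\<close>.\<close>

lemma C1_on_open_Union:
  assumes "\<And>x. x \<in> S \<Longrightarrow> \<exists>U. open U \<and> x \<in> U \<and> C1_on U f"
  shows "C1_on S f"
proof -
  have "continuous (at x) (\<lambda>x. frechet_derivative f (at x) v)" if x: "x \<in> S" for x v
  proof -
    obtain U where "open U" "x \<in> U" "C1_on U f" using assms[OF x] by blast
    then show ?thesis
      using continuous_on_eq_continuous_at[of U] C1_on_continuous_derivative by blast
  qed
  moreover have "f differentiable (at x)" if "x \<in> S" for x
    using assms[OF that] by auto
  ultimately show ?thesis by (simp add: continuous_at_imp_continuous_on)
qed

lemma C1_on_const [simp]: "C1_on S (\<lambda>x. c)"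
  by (rule C1_onI[where f'="\<lambda>_ _. 0"]) auto

lemma C1_on_add:
  assumes "C1_on S f" "C1_on S h" shows "C1_on S (\<lambda>x. f x + h x)"
  by (rule C1_onI[OF has_derivative_add[OF C1_on_has_derivative C1_on_has_derivative]])
    (use assms in \<open>auto intro!: continuous_intros\<close>)

lemma C1_on_diff:
  assumes "C1_on S f" "C1_on S h" shows "C1_on S (\<lambda>x. f x - h x)"
  by (rule C1_onI[OF has_derivative_diff[OF C1_on_has_derivative C1_on_has_derivative]])
    (use assms in \<open>auto intro!: continuous_intros\<close>)

lemma C1_on_mult:
  fixes f h :: "'a::real_normed_vector \<Rightarrow> real"
  assumes "C1_on S f" "C1_on S h" shows "C1_on S (\<lambda>x. f x * h x)"
  by (rule C1_onI[OF has_derivative_mult[OF C1_on_has_derivative C1_on_has_derivative]])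
    (use assms assms[THEN C1_on_continuous] in \<open>auto intro!: continuous_intros\<close>)

lemma C1_on_sum:
  assumes "\<And>i. i \<in> I \<Longrightarrow> C1_on S (f i)" shows "C1_on S (\<lambda>x. \<Sum>i\<in>I. f i x)"
  using assms by (induction I rule: infinite_finite_induct) (auto intro: C1_on_add simp del: Ck_on.simps)

lemma C1_on_prod:
  fixes f :: "'i \<Rightarrow> 'a::real_normed_vector \<Rightarrow> real"
  assumes "\<And>i. i \<in> I \<Longrightarrow> C1_on S (f i)" shows "C1_on S (\<lambda>x. \<Prod>i\<in>I. f i x)"
  using assms by (induction I rule: infinite_finite_induct) (auto intro: C1_on_mult simp del: Ck_on.simps)

lemma C1_on_real_compose:
  fixes f :: "'a::real_normed_vector \<Rightarrow> real" and h :: "real \<Rightarrow> real"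
  assumes "C1_on S f" "\<And>x. x \<in> S \<Longrightarrow> (h has_field_derivative h' (f x)) (at (f x))"
    and "continuous_on (f ` S) h'"
  shows "C1_on S (\<lambda>x. h (f x))"
proof (rule C1_onI)
  fix x assume "x \<in> S"
  then show "((\<lambda>x. h (f x)) has_derivative (\<lambda>v. frechet_derivative f (at x) v * h' (f x))) (at x)"
    using has_derivative_compose[OF C1_on_has_derivative[OF assms(1)],
      of x h "\<lambda>y. y * h' (f x)"] assms(2)
    by (simp add: has_field_derivative_def mult_commute_abs)
next
  fix v
  have "continuous_on S (\<lambda>x. h' (f x))"
    using continuous_on_compose[OF C1_on_continuous[OF assms(1)] assms(3)] by (simp add: o_def)
  then show "continuous_on S (\<lambda>x. frechet_derivative f (at x) v * h' (f x))"
    using assms(1) by (auto intro!: continuous_intros)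
qed

lemma C1_on_inverse:
  fixes f :: "'a::real_normed_vector \<Rightarrow> real"
  assumes "C1_on S f" "\<And>x. x \<in> S \<Longrightarrow> f x \<noteq> 0" shows "C1_on S (\<lambda>x. inverse (f x))"
  by (rule C1_on_real_compose[OF assms(1), where h'="\<lambda>y. - inverse (y\<^sup>2)"])
    (use assms(2) in \<open>auto intro!: continuous_intros derivative_eq_intros simp: power2_eq_square\<close>)

lemma C1_on_sqrt:
  fixes f :: "'a::real_normed_vector \<Rightarrow> real"
  assumes "C1_on S f" "\<And>x. x \<in> S \<Longrightarrow> f x > 0" shows "C1_on S (\<lambda>x. sqrt (f x))"
proof (rule C1_on_real_compose[OF assms(1), where h'="\<lambda>y. inverse (sqrt y) / 2"])
  show "continuous_on (f ` S) (\<lambda>y. inverse (sqrt y) / 2)"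
    using assms(2) by (intro continuous_intros ballI) (auto simp: less_imp_neq[THEN not_sym])
qed (use assms(2) in \<open>auto intro!: DERIV_real_sqrt\<close>)

lemma C1_on_bounded_linear:
  assumes "bounded_linear L" "C1_on S f" shows "C1_on S (\<lambda>x. L (f x))"
proof (rule C1_onI)
  show "((\<lambda>x. L (f x)) has_derivative (\<lambda>v. L (frechet_derivative f (at x) v))) (at x)" if "x \<in> S" for x
    using bounded_linear.has_derivative[OF assms(1) C1_on_has_derivative[OF assms(2) that]] .
  show "continuous_on S (\<lambda>x. L (frechet_derivative f (at x) v))" for v
    using bounded_linear.continuous_on[OF assms(1) C1_on_continuous_derivative[OF assms(2)]] .
qed

lemma C1_on_linear: "bounded_linear L \<Longrightarrow> C1_on S L"
  by (rule C1_onI[where f'="\<lambda>_. L"]) (auto intro: bounded_linear_imp_has_derivative)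

declare Ck_on.simps [simp del]

section \<open>Gradients of real functions on Euclidean space\<close>

definition gradient :: "(real^'n \<Rightarrow> real) \<Rightarrow> real^'n \<Rightarrow> real^'n::finite" where
  "gradient f x = (\<chi> j. partial j f x)"

lemma has_derivative_gradient:
  assumes "f differentiable (at x)"
  shows "(f has_derivative (\<lambda>v. gradient f x \<bullet> v)) (at x)"
proof -
  have d: "(f has_derivative frechet_derivative f (at x)) (at x)"
    using assms by (simp add: frechet_derivative_works)
  then have "linear (frechet_derivative f (at x))" by (rule has_derivative_linear)
  then have "frechet_derivative f (at x) v = gradient f x \<bullet> v" for v
    by (simp add: gradient_def partial_def inner_vec_def,
        subst (1) basis_expansion[symmetric, of v])
      (simp add: linear_sum scalar_mult_eq_scaleR linear_scale mult.commute)
  then have "frechet_derivative f (at x) = (\<lambda>v. gradient f x \<bullet> v)" by auto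
  with d show ?thesis by simp
qed

lemma gradient_unique:
  assumes "(f has_derivative (\<lambda>v. w \<bullet> v)) (at x)" shows "gradient f x = w"
  unfolding gradient_def partial_def frechet_derivative_at[OF assms, symmetric]
  by (simp add: vec_eq_iff inner_axis)

lemma gradient_transform:
  assumes "open S" "x \<in> S" "\<And>y. y \<in> S \<Longrightarrow> f y = h y"
  shows "gradient f x = gradient h x"
  by (simp add: gradient_def partial_def frechet_derivative_transform[OF assms])

lemma C1_on_continuous_gradient:
  "C1_on S f \<Longrightarrow> continuous_on S (gradient f)"
  unfolding gradient_def partial_def by (intro continuous_on_vec_lambda C1_on_continuous_derivative)

lemma C1_on_partial:
  "Ck_on 2 S f \<Longrightarrow> C1_on S (partial i f)"
  unfolding partial_def numeral_2_eq_2 by (simp add: Ck_on.simps(2)[of "Suc 0"])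

lemma Ck2_imp_C1: "Ck_on 2 S f \<Longrightarrow> C1_on S f"
  unfolding numeral_2_eq_2 Ck_on.simps(2)[of "Suc 0"] Ck_on.simps(2)[of 0 S f] Ck_on.simps(1)
  using C1_on_continuous by blast

lemma gradient_mult:
  assumes "f differentiable (at x)" "h differentiable (at x)"
  shows "gradient (\<lambda>x. f x * h x) x = f x *\<^sub>R gradient h x + h x *\<^sub>R gradient f x"
  using has_derivative_mult[OF assms[THEN has_derivative_gradient]]
  by (intro gradient_unique) (simp add: inner_add_left mult.commute)

lemma gradient_compose:
  assumes "f differentiable (at x)" "(h has_field_derivative h') (at (f x))"
  shows "gradient (\<lambda>x. h (f x)) x = h' *\<^sub>R gradient f x"
proof (rule gradient_unique)
  have "(h has_derivative (\<lambda>y. y * h')) (at (f x))" using assms(2)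
    by (simp add: has_field_derivative_def mult_commute_abs)
  from has_derivative_compose[OF has_derivative_gradient[OF assms(1)] this]
  show "((\<lambda>x. h (f x)) has_derivative (\<lambda>v. (h' *\<^sub>R gradient f x) \<bullet> v)) (at x)"
    by (simp add: mult.commute)
qed

lemma gradient_const: "gradient (\<lambda>x. c) x = 0"
  by (rule gradient_unique) auto

lemma gradient_sum:
  assumes "\<And>i. i \<in> I \<Longrightarrow> f i differentiable (at x)"
  shows "gradient (\<lambda>x. \<Sum>i\<in>I. f i x) x = (\<Sum>i\<in>I. gradient (f i) x)"
  by (intro gradient_unique has_derivative_eq_rhs[OF has_derivative_sum[OF has_derivative_gradient[OF assms]]])
    (auto simp: inner_sum_left)

text \<open>For a real outer function on \<open>real^'m\<close> the derivative is an inner product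
  with the gradient, so continuity of the composite derivative reduces to continuity of two
  vectors.\<close>

lemma C1_on_compose:
  fixes f :: "real^'m \<Rightarrow> real" and h :: "'b::real_normed_vector \<Rightarrow> real^'m"
  assumes "C1_on S h" "C1_on T f" "h ` S \<subseteq> T"
  shows "C1_on S (\<lambda>x. f (h x))"
proof (rule C1_onI)
  fix x assume x: "x \<in> S"
  show "((\<lambda>x. f (h x)) has_derivative (\<lambda>v. gradient f (h x) \<bullet> frechet_derivative h (at x) v)) (at x)"
    using has_derivative_compose[OF C1_on_has_derivative[OF assms(1) x] has_derivative_gradient]
      C1_on_differentiable[OF assms(2)] assms(3) x by blast
next
  fix v
  have "continuous_on S (\<lambda>x. gradient f (h x))"
    using continuous_on_compose2[OF C1_on_continuous_gradient[OF assms(2)] C1_on_continuous[OF assms(1)] assms(3)] .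
  then show "continuous_on S (\<lambda>x. gradient f (h x) \<bullet> frechet_derivative h (at x) v)"
    using C1_on_continuous_derivative[OF assms(1)] by (rule continuous_on_inner)
qed

text \<open>A step from \<open>0\<close> (for \<open>t \<le> 1\<close>) to \<open>1\<close> (for \<open>t \<ge> 2\<close>); the cubes make it twice continuously
  differentiable.\<close>

definition step :: "real \<Rightarrow> real" where
  "step t = 1 - (max 0 (1 - (max 0 (t - 1)) ^ 3)) ^ 3"

text \<open>The factor 9 collects the two exponents 3 from the chain rule.\<close>

definition step' :: "real \<Rightarrow> real" where
  "step' t = 9 * ((max 0 (1 - (max 0 (t - 1)) ^ 3))\<^sup>2 * (max 0 (t - 1))\<^sup>2)"

lemma DERIV_max0_power:
  assumes "n \<ge> 1"
  shows "((\<lambda>t::real. (max 0 t) ^ Suc n) has_field_derivative real (Suc n) * (max 0 t) ^ n) (at t)"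
proof -
  consider "t > 0" | "t < 0" | "t = 0" by linarith
  then show ?thesis
  proof cases
    case 1
    have "((\<lambda>t::real. t ^ Suc n) has_field_derivative real (Suc n) * (max 0 t) ^ n) (at t)"
      using 1 DERIV_pow[of "Suc n" t] by simp
    then show ?thesis
      by (rule has_field_derivative_transform_within_open[where S="{0<..}"]) (use 1 in auto)
  next
    case 2
    have "((\<lambda>t::real. 0) has_field_derivative real (Suc n) * (max 0 t) ^ n) (at t)"
      using 2 assms by (simp add: max_def power_0_left)
    then show ?thesis
      by (rule has_field_derivative_transform_within_open[where S="{..<0}"]) (use 2 in auto)
  next
    case 3
    \<comment> \<open>At the kink the difference quotient is at most
      \<open>\<bar>h\<bar> ^ n\<close>, which tends to 0 because \<open>n \<ge> 1\<close>.\<close>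
    have "((\<lambda>h. (max 0 h) ^ Suc n / h) \<longlongrightarrow> 0) (at (0::real))"
    proof (rule Lim_null_comparison)
      show "\<forall>\<^sub>F h in at (0::real). norm ((max 0 h) ^ Suc n / h) \<le> \<bar>h\<bar> ^ n"
        by (rule always_eventually) (auto simp: max_def)
      show "((\<lambda>h. \<bar>h\<bar> ^ n) \<longlongrightarrow> 0) (at (0::real))"
        using assms by (auto intro!: tendsto_eq_intros)
    qed
    then show ?thesis using 3 assms by (simp add: DERIV_def power_0_left)
  qed
qed

lemma DERIV_max0_cube: "((\<lambda>t::real. (max 0 t) ^ 3) has_field_derivative 3 * (max 0 t)\<^sup>2) (at t)"
  using DERIV_max0_power[of 2 t] by (simp add: numeral_3_eq_3 numeral_2_eq_2)

lemma DERIV_max0_square: "((\<lambda>t::real. (max 0 t)\<^sup>2) has_field_derivative 2 * max 0 t) (at t)"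
  using DERIV_max0_power[of 1 t] by (simp add: numeral_2_eq_2)

lemma DERIV_step_inner:
  "((\<lambda>t::real. 1 - (max 0 (t - 1)) ^ 3) has_field_derivative - (3 * (max 0 (t - 1))\<^sup>2)) (at t)"
proof -
  have "((\<lambda>t::real. t - 1) has_field_derivative 1) (at t)" by (auto intro!: derivative_eq_intros)
  from DERIV_diff[OF DERIV_const DERIV_chain2[where f="\<lambda>t. (max 0 t) ^ 3" and g="\<lambda>t. t - 1",
        OF DERIV_max0_cube this], of 1]
  show ?thesis by simp
qed

lemma DERIV_step: "(step has_field_derivative step' t) (at t)"
proof -
  have "((\<lambda>t. 1 - (max 0 (1 - (max 0 (t - 1)) ^ 3)) ^ 3) has_field_derivative step' t) (at t)"
    using DERIV_diff[OF DERIV_const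
        DERIV_chain2[where f="\<lambda>t. (max 0 t) ^ 3" and g="\<lambda>t. 1 - (max 0 (t - 1)) ^ 3",
          OF DERIV_max0_cube DERIV_step_inner, of t], of 1] unfolding step'_def
    by (simp add: mult_ac)
  then show ?thesis unfolding step_def[abs_def] .
qed

lemma step_eq_0: "t \<le> 1 \<Longrightarrow> step t = 0"
  by (simp add: step_def)

lemma max0_step_eq_0: "t \<ge> 2 \<Longrightarrow> max 0 (1 - (max 0 (t - 1)) ^ 3) = (0::real)"
proof -
  assume t: "t \<ge> 2"
  then have "max 0 (t - 1) = t - 1" by (intro max_absorb2) linarith
  moreover have "(t - 1) ^ 3 \<ge> 1" using t by (intro one_le_power) linarith
  ultimately show ?thesis by (metis max_absorb1 diff_le_0_iff_le)
qed

lemma step_eq_1: "t \<ge> 2 \<Longrightarrow> step t = 1"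
  unfolding step_def by (subst max0_step_eq_0) auto

lemma step'_eq_0: "t \<le> 1 \<Longrightarrow> step' t = 0" "t \<ge> 2 \<Longrightarrow> step' t = 0"
  unfolding step'_def by (simp, metis max0_step_eq_0 mult_zero_left mult_zero_right zero_power2)

lemma step_bounds: "0 \<le> step t" "step t \<le> 1"
proof -
  have "(max 0 (1 - (max 0 (t - 1)) ^ 3)) ^ 3 \<le> 1" by (rule power_le_one) auto
  then show "0 \<le> step t" by (simp add: step_def)
qed (simp add: step_def)

text \<open>The puncture cutoff is differentiated twice. The squares that remain in
  \<open>step'\<close> are still continuously differentiable, which is the reason for cubes in
  \<open>step\<close>.\<close>

lemma step'_C1:
  obtains h where "\<And>t. (step' has_field_derivative h t) (at t)" "continuous_on UNIV h"
proof -
  have d: "((\<lambda>t::real. (max 0 (t - 1))\<^sup>2) has_field_derivative (2 * (max 0 (t-1)))) (at t)" for t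
  proof -
    have "((\<lambda>t::real. t - 1) has_field_derivative 1) (at t)" by (auto intro!: derivative_eq_intros)
    from DERIV_chain2[where f="\<lambda>t. (max 0 t)\<^sup>2" and g="\<lambda>t. t - 1", OF DERIV_max0_square this]
    show ?thesis by simp
  qed
  have e: "((\<lambda>t::real. (max 0 (1 - (max 0 (t - 1)) ^ 3))\<^sup>2) has_field_derivative
      2 * max 0 (1 - (max 0 (t - 1)) ^ 3) * - (3 * (max 0 (t - 1))\<^sup>2)) (at t)" for t
    by (rule DERIV_chain2[where f="\<lambda>t. (max 0 t)\<^sup>2" and g="\<lambda>t. 1 - (max 0 (t - 1)) ^ 3",
        OF DERIV_max0_square DERIV_step_inner])
  define h :: "real \<Rightarrow> real" where
    "h t = 9 * (2 * max 0 (t - 1) * (max 0 (1 - (max 0 (t - 1)) ^ 3))\<^sup>2 +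
      (2 * max 0 (1 - (max 0 (t - 1)) ^ 3) * - (3 * (max 0 (t - 1))\<^sup>2)) * (max 0 (t - 1))\<^sup>2)" for t :: real
  have "(step' has_field_derivative h t) (at t)" for t
    using DERIV_cmult[OF DERIV_mult[OF e d, of t], of 9]
    unfolding step'_def[abs_def] h_def by (simp only: add.commute)
  moreover have "continuous_on UNIV h"
    unfolding h_def by (intro continuous_intros)
  ultimately show ?thesis using that by blast
qed

section \<open>Positive definite matrices\<close>

definition posdef :: "real^'n^'n \<Rightarrow> bool" where
  "posdef G \<longleftrightarrow> transpose G = G \<and> (\<forall>v. v \<noteq> 0 \<longrightarrow> v \<bullet> (G *v v) > 0)"

lemma posdef_nonneg: "posdef G \<Longrightarrow> v \<bullet> (G *v v) \<ge> 0"
  by (cases "v = 0") (auto simp: posdef_def less_imp_le)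

lemma pos_imp_det_nz:
  fixes G :: "real^'n::finite^'n"
  assumes "\<And>v. v \<noteq> 0 \<Longrightarrow> v \<bullet> (G *v v) > 0" shows "det G \<noteq> 0"
proof -
  have "G *v v = 0 \<Longrightarrow> v = 0" for v using assms[of v] by fastforce
  then have "invertible G"
    by (simp add: invertible_left_inverse matrix_left_invertible_ker)
  then show ?thesis by (simp add: invertible_det_nz)
qed

text \<open>The segment from the identity to \<open>G\<close> consists of positive matrices, whose
  determinants do not vanish. A sign change along it would contradict the intermediate value
  theorem.\<close>

lemma posdef_det_pos:
  fixes G :: "real^'n::finite^'n"
  assumes "posdef G" shows "det G > 0"
proof (rule ccontr)
  assume *: "\<not> det G > 0"
  define H :: "real \<Rightarrow> real^'n^'n" where "H t = (1 - t) *\<^sub>R mat 1 + t *\<^sub>R G" for t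
  have Hv: "H t *v v = (1 - t) *\<^sub>R v + t *\<^sub>R (G *v v)" for t v
    by (simp add: H_def matrix_vector_mult_add_rdistrib scaleR_matrix_vector_assoc[symmetric])
  have nz: "det (H t) \<noteq> 0" if "0 \<le> t" "t \<le> 1" for t
  proof (rule pos_imp_det_nz)
    fix v :: "real^'n" assume "v \<noteq> 0"
    then have "v \<bullet> v > 0" "v \<bullet> (G *v v) > 0" using assms by (auto simp: posdef_def)
    then have "(1 - t) * (v \<bullet> v) + t * (v \<bullet> (G *v v)) > 0"
      using that by (cases "t = 0") (auto intro: add_nonneg_pos)
    then show "v \<bullet> (H t *v v) > 0" by (simp add: Hv inner_add_right)
  qed
  have "continuous_on {0..1} (\<lambda>t. det (H t))"
    unfolding det_def H_def by (intro continuous_intros)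
  moreover have "H 0 = mat 1" "H 1 = G" by (simp_all add: H_def)
  ultimately have "\<exists>t\<ge>0. t \<le> 1 \<and> det (H t) = 0"
    using * by (intro IVT2') auto
  then show False using nz by blast
qed

lemma posdef_invertible: "posdef G \<Longrightarrow> invertible G"
  using posdef_det_pos[of G] by (simp add: invertible_det_nz)

lemma posdef_matrix_inv:
  fixes G :: "real^'n::finite^'n"
  assumes "posdef G"
  shows "G ** matrix_inv G = mat 1" "matrix_inv G ** G = mat 1"
    "G *v (matrix_inv G *v v) = v" "matrix_inv G *v (G *v v) = v"
  using someI_ex[OF posdef_invertible[OF assms, unfolded invertible_def]]
  by (simp_all add: matrix_inv_def matrix_vector_mul_assoc)

lemma posdef_symmetric: "posdef G \<Longrightarrow> v \<bullet> (G *v w) = w \<bullet> (G *v v)"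
  using dot_lmul_matrix[of v G w] by (metis inner_commute posdef_def transpose_matrix_vector)

lemma posdef_inv_symmetric:
  "posdef G \<Longrightarrow> v \<bullet> (matrix_inv G *v w) = w \<bullet> (matrix_inv G *v v)"
  using posdef_symmetric[of G "matrix_inv G *v v" "matrix_inv G *v w"]
  by (simp add: posdef_matrix_inv inner_commute)

lemma posdef_inv_nonneg: "posdef G \<Longrightarrow> v \<bullet> (matrix_inv G *v v) \<ge> 0"
  using posdef_nonneg[of G "matrix_inv G *v v"]
  by (simp add: posdef_matrix_inv inner_commute)

lemma posdef_inv_eq_0_iff: "posdef G \<Longrightarrow> v \<bullet> (matrix_inv G *v v) = 0 \<longleftrightarrow> v = 0"
proof
  assume G: "posdef G" and "v \<bullet> (matrix_inv G *v v) = 0"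
  then have "matrix_inv G *v v = 0"
    using posdef_def[of G] by (metis inner_commute less_irrefl posdef_matrix_inv(3))
  then show "v = 0" using posdef_matrix_inv(3)[OF G, of v] by simp
qed simp

text \<open>Cramer's rule writes the entries of the inverse as quotients of polynomials in the
  entries of \<open>G\<close>; this makes the inverse metric as regular as the metric.\<close>

lemma matrix_inv_component:
  fixes G :: "real^'n::finite^'n"
  assumes "posdef G"
  shows "matrix_inv G $ k $ l = det (\<chi> i j. if j = k then axis l 1 $ i else G $ i $ j) / det G"
proof -
  have "G *v (matrix_inv G *v axis l 1) = axis l 1" using posdef_matrix_inv[OF assms] by simp
  then have "matrix_inv G *v axis l 1 = (\<chi> k. det(\<chi> i j. if j=k then axis l 1 $i else G$i$j) / det G)"
    using cramer[of G] posdef_det_pos[OF assms] by simp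
  moreover have "(matrix_inv G *v axis l 1) $ k = matrix_inv G $ k $ l"
    by (simp add: matrix_vector_mul_component inner_axis)
  ultimately show ?thesis by simp
qed

text \<open>\<open>m\<close> is the minimum of the form on the compact Euclidean unit sphere, and
  both sides are homogeneous of degree 2.\<close>

lemma posdef_lower_bound:
  fixes G :: "real^'n::finite^'n"
  assumes "posdef G"
  obtains m where "m > 0" "\<And>v. m * (v \<bullet> v) \<le> v \<bullet> (G *v v)"
proof -
  have "compact (sphere (0::real^'n) 1)" "sphere (0::real^'n) 1 \<noteq> {}"
    by (auto intro!: exI[of _ "axis undefined 1"])
  moreover have "continuous_on (sphere 0 1) (\<lambda>v::real^'n. v \<bullet> (G *v v))"
    by (intro continuous_intros linear_continuous_on matrix_vector_mul_bounded_linear)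
  ultimately obtain a where a: "a \<in> sphere 0 1" "\<And>v. v \<in> sphere 0 1 \<Longrightarrow> a \<bullet> (G *v a) \<le> v \<bullet> (G *v v)"
    using continuous_attains_inf[of "sphere 0 1" "\<lambda>v. v \<bullet> (G *v v)"] by blast
  have "(a \<bullet> (G *v a)) * (v \<bullet> v) \<le> v \<bullet> (G *v v)" for v
  proof (cases "v = 0")
    case False
    have "a \<bullet> (G *v a) \<le> (v /\<^sub>R norm v) \<bullet> (G *v (v /\<^sub>R norm v))"
      using False by (intro a(2)) simp
    also have "\<dots> = (v \<bullet> (G *v v)) / (v \<bullet> v)"
      by (simp add: matrix_vector_mult_scaleR dot_square_norm power2_eq_square divide_simps)
    finally show ?thesis using False by (simp add: field_simps)
  qed simp
  moreover have "a \<noteq> 0" using a(1) by auto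
  then have "a \<bullet> (G *v a) > 0" using assms by (simp add: posdef_def)
  ultimately show ?thesis using that by blast
qed

text \<open>An Auerbach basis for the norm given by \<open>G\<close>: maximize the determinant over the matrices whose
  columns lie in the unit ball; then Cramer's rule bounds the coordinate functionals.\<close>

lemma posdef_frame:
  fixes G :: "real^'n::finite^'n"
  assumes "posdef G"
  obtains E D :: "real^'n^'n" where "E ** D = mat 1"
    "\<And>k. column k E \<bullet> (G *v column k E) \<le> 1"
    "\<And>Y k. \<bar>(D *v Y) $ k\<bar> \<le> sqrt (Y \<bullet> (G *v Y))"
proof -
  obtain m where m: "m > 0" "\<And>v. m * (v \<bullet> v) \<le> v \<bullet> (G *v v)"
    using posdef_lower_bound[OF assms] by blast
  define B where "B = {E :: real^'n^'n. \<forall>k. column k E \<bullet> (G *v column k E) \<le> 1}"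
  have cont: "continuous_on UNIV (\<lambda>E :: real^'n^'n. column k E \<bullet> (G *v column k E))" for k
    unfolding column_def
    by (intro continuous_intros continuous_on_vec_lambda
        linear_continuous_on_compose[OF _ matrix_vector_mul_linear])
  have "B = (\<Inter>k. {E. column k E \<bullet> (G *v column k E) \<le> 1})" by (auto simp: B_def)
  then have "closed B" using cont by (auto intro!: closed_INT closed_Collect_le)
  \<comment> \<open>The lower bound \<open>m\<close> turns the condition on the metric length of the
    columns into a bound on every entry.\<close>
  moreover have "bounded B"
  proof -
    have "norm E \<le> (\<Sum>i\<in>(UNIV::'n set). \<Sum>j\<in>(UNIV::'n set). sqrt (1 / m))" if "E \<in> B" for E
    proof -
      have c: "\<bar>E $ i $ j\<bar> \<le> sqrt (1 / m)" for i j
      proof -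
        have "m * (column j E \<bullet> column j E) \<le> 1" using m(2)[of "column j E"] that
          unfolding B_def by (smt (verit) mem_Collect_eq)
        then have "(norm (column j E))\<^sup>2 \<le> 1 / m" using m(1) by (simp add: dot_square_norm field_simps)
        then have "norm (column j E) \<le> sqrt (1 / m)" by (simp add: real_le_rsqrt)
        moreover have "\<bar>column j E $ i\<bar> \<le> norm (column j E)" by (rule component_le_norm_cart)
        ultimately show ?thesis by (simp add: column_def)
      qed
      have "norm E \<le> (\<Sum>i\<in>UNIV. norm (E $ i))" by (simp add: norm_vec_def L2_set_le_sum)
      also have "\<dots> \<le> (\<Sum>i\<in>UNIV. \<Sum>j\<in>UNIV. \<bar>E $ i $ j\<bar>)" by (intro sum_mono norm_le_l1_cart)
      also have "\<dots> \<le> (\<Sum>i\<in>(UNIV::'n set). \<Sum>j\<in>(UNIV::'n set). sqrt (1 / m))"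
        by (intro sum_mono c)
      finally show ?thesis .
    qed
    then show ?thesis by (auto simp: bounded_iff)
  qed
  ultimately have "compact B" by (simp add: compact_eq_bounded_closed)
  moreover have "mat 0 \<in> B" by (auto simp: B_def column_def mat_def vec_eq_iff inner_vec_def if_distrib cong: if_cong)
  moreover have "continuous_on B (\<lambda>E. \<bar>det E\<bar>)"
    unfolding det_def by (intro continuous_intros)
  ultimately obtain E where E: "E \<in> B" "\<And>F. F \<in> B \<Longrightarrow> \<bar>det F\<bar> \<le> \<bar>det E\<bar>"
    using continuous_attains_sup[of B "\<lambda>E. \<bar>det E\<bar>"] by blast
  \<comment> \<open>A small multiple of the identity shows that \<open>B\<close> contains an
    invertible matrix, so the maximal determinant is not 0. Dividing by 1 plus the trace of
    \<open>G\<close> makes the columns short enough.\<close>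
  define s where "s = 1 / (1 + (\<Sum>k\<in>UNIV. axis k 1 \<bullet> (G *v axis k (1::real))))"
  have tr: "0 \<le> axis k 1 \<bullet> (G *v axis k (1::real))" for k
    using posdef_nonneg[OF assms] by blast
  have S0: "0 \<le> (\<Sum>k\<in>UNIV. axis k 1 \<bullet> (G *v axis k (1::real)))"
    by (intro sum_nonneg tr)
  then have s: "0 < s" "s \<le> 1" by (auto simp: s_def)
  have col: "column k (mat s :: real^'n^'n) = s *\<^sub>R axis k 1" for k
    by (auto simp: column_def mat_def axis_def vec_eq_iff)
  have "mat s \<in> B"
  proof -
    have "s * (s * (axis k 1 \<bullet> (G *v axis k 1))) \<le> 1" for k
    proof -
      have "axis k 1 \<bullet> (G *v axis k (1::real)) \<le> (\<Sum>k\<in>UNIV. axis k 1 \<bullet> (G *v axis k (1::real)))"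
        by (rule member_le_sum) (use tr in auto)
      then have "s * (axis k 1 \<bullet> (G *v axis k 1)) \<le> 1"
        using S0 unfolding s_def by (simp add: field_simps)
      then show ?thesis using s tr[of k] by (simp add: mult_le_one)
    qed
    then show ?thesis unfolding B_def by (simp add: col matrix_vector_mult_scaleR)
  qed
  moreover have "\<bar>det (mat s :: real^'n^'n)\<bar> > 0"
  proof -
    have "det (mat s :: real^'n^'n) = (\<Prod>i\<in>(UNIV::'n set). s)"
      by (subst det_diagonal) (auto simp: mat_def)
    then show ?thesis using s by simp
  qed
  ultimately have detE: "det E \<noteq> 0" using E(2)[of "mat s"] by fastforce
  then obtain D where D: "E ** D = mat 1" unfolding invertible_det_nz[symmetric] invertible_def by blast
  have unit: "\<bar>(D *v Y) $ k\<bar> \<le> 1" if "Y \<bullet> (G *v Y) \<le> 1" for Y k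
  proof -
    \<comment> \<open>Replacing a column of \<open>E\<close> by an admissible \<open>Y\<close>
      cannot increase the determinant, and the ratio of the two determinants is the
      \<open>k\<close>-th coordinate of \<open>Y\<close>.\<close>
    define F where "F = (\<chi> i j. if j = k then Y $ i else E $ i $ j)"
    have "column j F = (if j = k then Y else column j E)" for j
      by (auto simp: F_def column_def vec_eq_iff)
    then have "F \<in> B" using E(1) that by (auto simp: B_def)
    moreover have "E *v (D *v Y) = Y" by (simp add: matrix_vector_mul_assoc D)
    then have "det F = (D *v Y) $ k * det E"
      using cramer_lemma[of k E "D *v Y"] by (simp only: F_def)
    ultimately have "\<bar>(D *v Y) $ k\<bar> * \<bar>det E\<bar> \<le> \<bar>det E\<bar>" using E(2)[of F] by (simp add: abs_mult)
    then show ?thesis using detE by simp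
  qed
  have "\<bar>(D *v Y) $ k\<bar> \<le> sqrt (Y \<bullet> (G *v Y))" for Y k
  proof (cases "Y = 0")
    case False
    define c where "c = sqrt (Y \<bullet> (G *v Y))"
    have pos: "Y \<bullet> (G *v Y) > 0" using assms False by (simp add: posdef_def)
    then have c: "c > 0" "c * c = Y \<bullet> (G *v Y)" by (auto simp: c_def)
    have "(Y /\<^sub>R c) \<bullet> (G *v (Y /\<^sub>R c)) = 1"
      using c pos by (simp add: matrix_vector_mult_scaleR field_simps)
    then have "\<bar>(D *v (Y /\<^sub>R c)) $ k\<bar> \<le> 1" using unit by simp
    then have "\<bar>(D *v Y) $ k\<bar> \<le> c" using c(1)
      by (simp add: matrix_vector_mult_scaleR abs_mult field_simps)
    then show ?thesis by (simp add: c_def)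
  qed simp
  moreover have "\<And>k. column k E \<bullet> (G *v column k E) \<le> 1" using E(1) by (simp add: B_def)
  ultimately show ?thesis using that D by blast
qed

lemma quadratic_form_bound:
  fixes A :: "real^'n::finite^'n"
  shows "\<bar>v \<bullet> (A *v v)\<bar> \<le> real CARD('n) * norm A * (v \<bullet> v)"
proof -
  have "\<bar>(A *v v) $ i\<bar> \<le> norm A * norm v" for i
  proof -
    have "\<bar>(A *v v) $ i\<bar> = \<bar>A $ i \<bullet> v\<bar>" by (simp add: matrix_vector_mul_component)
    also have "\<dots> \<le> norm (A $ i) * norm v" by (rule Cauchy_Schwarz_ineq2)
    also have "\<dots> \<le> norm A * norm v" by (intro mult_right_mono Finite_Cartesian_Product.norm_nth_le) auto
    finally show ?thesis .
  qed
  then have "norm (A *v v) \<le> (\<Sum>i\<in>(UNIV::'n set). norm A * norm v)"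
    by (intro order_trans[OF norm_le_l1_cart] sum_mono)
  then have "norm (A *v v) \<le> real CARD('n) * norm A * norm v" by simp
  then have "norm v * norm (A *v v) \<le> norm v * (real CARD('n) * norm A * norm v)"
    by (intro mult_left_mono) auto
  with Cauchy_Schwarz_ineq2[of v "A *v v"] show ?thesis
    by (simp add: dot_square_norm power2_eq_square mult_ac)
qed

lemma posdef_locally_comparable:
  fixes G :: "'b::metric_space \<Rightarrow> real^'n::finite^'n"
  assumes "continuous_on U G" "open U" "x \<in> U" "posdef (G x)"
  obtains r where "r > 0" "cball x r \<subseteq> U"
    "\<And>y v. y \<in> cball x r \<Longrightarrow> v \<bullet> (G y *v v) \<le> 4 * (v \<bullet> (G x *v v))"
    "\<And>y v. y \<in> cball x r \<Longrightarrow> v \<bullet> (G x *v v) \<le> 4 * (v \<bullet> (G y *v v))"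
proof -
  obtain m where m: "m > 0" "\<And>v. m * (v \<bullet> v) \<le> v \<bullet> (G x *v v)"
    using posdef_lower_bound[OF assms(4)] by blast
  obtain r0 where r0: "r0 > 0" "ball x r0 \<subseteq> U" using assms(2,3) by (meson open_contains_ball)
  \<comment> \<open>This \<open>e\<close> keeps the two forms within half of the form at
    \<open>x\<close>. The rounder factor 4 in the conclusion is a square, so lengths change by a
    factor of at most 2.\<close>
  define e where "e = m / (2 * real CARD('n))"
  have e: "e > 0" "real CARD('n) * e = m / 2" using m(1) by (auto simp: e_def)
  obtain d where d: "d > 0" "\<And>y. y \<in> U \<Longrightarrow> dist y x < d \<Longrightarrow> dist (G y) (G x) < e"
    using assms(1,3) e(1) unfolding continuous_on_iff by blast
  define r where "r = min r0 d / 2"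
  have r: "r > 0" "r < r0" "r < d" using r0(1) d(1) by (auto simp: r_def)
  have key: "\<bar>v \<bullet> (G y *v v) - v \<bullet> (G x *v v)\<bar> \<le> (v \<bullet> (G x *v v)) / 2" if "y \<in> cball x r" for y v
  proof -
    have "y \<in> U" "dist y x < d" using that r r0 by (auto simp: dist_commute)
    then have "norm (G y - G x) < e" using d(2) by (simp add: dist_norm)
    then have "real CARD('n) * norm (G y - G x) * (v \<bullet> v) \<le> real CARD('n) * e * (v \<bullet> v)"
      by (intro mult_right_mono mult_left_mono) auto
    also have "\<dots> \<le> (v \<bullet> (G x *v v)) / 2" unfolding e(2) using m(2)[of v] by simp
    finally show ?thesis using quadratic_form_bound[of v "G y - G x"]
      by (simp add: matrix_vector_mult_diff_rdistrib inner_diff_right)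
  qed
  have nn: "v \<bullet> (G x *v v) \<ge> 0" for v by (rule posdef_nonneg[OF assms(4)])
  show ?thesis
  proof (rule that[OF r(1)])
    show "cball x r \<subseteq> U" using r r0 by auto
    show "v \<bullet> (G y *v v) \<le> 4 * (v \<bullet> (G x *v v))" if "y \<in> cball x r" for y v
      using abs_le_D1[OF key[OF that, of v]] abs_le_D2[OF key[OF that, of v]] nn[of v] by linarith
    show "v \<bullet> (G x *v v) \<le> 4 * (v \<bullet> (G y *v v))" if "y \<in> cball x r" for y v
      using abs_le_D1[OF key[OF that, of v]] abs_le_D2[OF key[OF that, of v]] nn[of v] by linarith
  qed
qed

section \<open>Regularity of determinants and inverse matrices\<close>

lemma C1_on_det:
  assumes "\<And>i j. C1_on S (\<lambda>x. G x $ i $ j :: real)" shows "C1_on S (\<lambda>x. det (G x))"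
  unfolding det_def by (intro C1_on_sum C1_on_mult C1_on_prod C1_on_const assms)

lemma C1_on_matrix_inv:
  fixes G :: "'b::real_normed_vector \<Rightarrow> real^'n::finite^'n"
  assumes "open S" "\<And>i j. C1_on S (\<lambda>x. G x $ i $ j)" "\<And>x. x \<in> S \<Longrightarrow> posdef (G x)"
  shows "C1_on S (\<lambda>x. matrix_inv (G x) $ k $ l)"
proof -
  define Ck where "Ck x = (\<chi> i j. if j = k then axis l 1 $ i else G x $ i $ j)" for x
  have "C1_on S (\<lambda>x. Ck x $ i $ j)" for i j
    by (cases "j = k") (simp_all add: Ck_def assms(2))
  then have "C1_on S (\<lambda>x. det (Ck x) * inverse (det (G x)))"
    using posdef_det_pos[OF assms(3)]
    by (intro C1_on_mult C1_on_inverse C1_on_det assms(2)) (simp_all add: less_imp_neq[THEN not_sym])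
  then show ?thesis
    by (subst C1_on_cong[OF assms(1)])
      (simp_all add: matrix_inv_component[OF assms(3)] Ck_def divide_inverse)
qed

lemma C1_on_sqrt_det:
  assumes "\<And>i j. C1_on S (\<lambda>x. G x $ i $ j)" "\<And>x. x \<in> S \<Longrightarrow> posdef (G x)"
  shows "C1_on S (\<lambda>x. sqrt (det (G x)))"
  by (intro C1_on_sqrt C1_on_det assms posdef_det_pos)

section \<open>Calculus on Riemannian manifolds\<close>

locale riem =
  fixes A :: "('a::t2_space, 'n::finite) chart set" and g :: "('a, 'n) metric_coeffs"
  assumes riemannian: "riemannian_manifold A g"
begin

lemma chart_open: "c \<in> A \<Longrightarrow> open (chart_dom c)" "c \<in> A \<Longrightarrow> open (chart_img c)"
  and chart_homeomorphism:
    "c \<in> A \<Longrightarrow> homeomorphism (chart_dom c) (chart_img c) (chart_map c) (chart_inv c)"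
  using riemannian
  by (auto simp: riemannian_manifold_def smooth_atlas_def is_chart_def)

lemma chart_inv_map: "c \<in> A \<Longrightarrow> q \<in> chart_dom c \<Longrightarrow> chart_inv c (chart_map c q) = q"
  and chart_map_inv: "c \<in> A \<Longrightarrow> x \<in> chart_img c \<Longrightarrow> chart_map c (chart_inv c x) = x"
  and chart_inv_mem: "c \<in> A \<Longrightarrow> x \<in> chart_img c \<Longrightarrow> chart_inv c x \<in> chart_dom c"
  and chart_map_mem: "q \<in> chart_dom c \<Longrightarrow> chart_map c q \<in> chart_img c"
  and chart_map_continuous: "c \<in> A \<Longrightarrow> continuous_on (chart_dom c) (chart_map c)"
  and chart_inv_continuous: "c \<in> A \<Longrightarrow> continuous_on (chart_img c) (chart_inv c)"
  using chart_homeomorphism[of c] by (auto simp: homeomorphism_def chart_img_def)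

lemma open_carrier: "open (carrier A)"
  unfolding carrier_def by (intro open_UN ballI chart_open)

lemma chart_dom_subset: "c \<in> A \<Longrightarrow> chart_dom c \<subseteq> carrier A"
  by (auto simp: carrier_def)

lemma chart_inv_carrier: "c \<in> A \<Longrightarrow> x \<in> chart_img c \<Longrightarrow> chart_inv c x \<in> carrier A"
  using chart_inv_mem chart_dom_subset by blast

lemma chart_map_image:
  assumes "c \<in> A"
  shows "chart_map c ` (chart_dom c \<inter> U) = chart_img c \<inter> chart_inv c -` U"
  using chart_inv_map[OF assms] by (auto simp: chart_img_def)

lemma open_chart_map_image:
  assumes "c \<in> A" "open U" shows "open (chart_map c ` (chart_dom c \<inter> U))"
  unfolding chart_map_image[OF assms(1)]
  using continuous_open_preimage[OF chart_inv_continuous chart_open(2)] assms by blast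

lemma open_chart_inv_image:
  assumes "c \<in> A" "open V" "V \<subseteq> chart_img c" shows "open (chart_inv c ` V)"
proof -
  have "chart_inv c ` V = chart_dom c \<inter> chart_map c -` V"
  proof (intro subset_antisym subsetI)
    fix q assume "q \<in> chart_inv c ` V"
    then show "q \<in> chart_dom c \<inter> chart_map c -` V"
      using chart_map_inv[OF assms(1)] chart_inv_mem[OF assms(1)] assms(3) by auto
  next
    fix q assume "q \<in> chart_dom c \<inter> chart_map c -` V"
    then show "q \<in> chart_inv c ` V" using chart_inv_map[OF assms(1), of q] by (metis IntE image_eqI vimage_eq)
  qed
  then show ?thesis
    using continuous_open_preimage[OF chart_map_continuous chart_open(1)] assms by metis
qed

lemma compact_chart_inv_image:
  "c \<in> A \<Longrightarrow> compact K \<Longrightarrow> K \<subseteq> chart_img c \<Longrightarrow> compact (chart_inv c ` K)"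
  using chart_inv_continuous compact_continuous_image continuous_on_subset by blast

lemma metric_posdef: "c \<in> A \<Longrightarrow> x \<in> chart_img c \<Longrightarrow> posdef (g c x)"
  using riemannian by (simp add: riemannian_manifold_def riemannian_metric_def posdef_def)

lemma metric_C1: "c \<in> A \<Longrightarrow> C1_on (chart_img c) (g c)"
  using riemannian by (simp add: riemannian_manifold_def riemannian_metric_def smooth_on_def)

lemma metric_continuous: "c \<in> A \<Longrightarrow> continuous_on (chart_img c) (g c)"
  using metric_C1 C1_on_continuous by blast

lemma metric_component_C1: "c \<in> A \<Longrightarrow> C1_on (chart_img c) (\<lambda>x. g c x $ i $ j)"
  by (intro C1_on_bounded_linear[OF bounded_linear_vec_nth] metric_C1)

lemma volume_density_C1: "c \<in> A \<Longrightarrow> C1_on (chart_img c) (\<lambda>x. sqrt (det (g c x)))"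
  by (intro C1_on_sqrt_det metric_component_C1 metric_posdef)

lemma volume_density_pos: "c \<in> A \<Longrightarrow> x \<in> chart_img c \<Longrightarrow> sqrt (det (g c x)) > 0"
  using posdef_det_pos[OF metric_posdef] by simp

lemma inverse_metric_C1: "c \<in> A \<Longrightarrow> C1_on (chart_img c) (\<lambda>x. matrix_inv (g c x) $ i $ j)"
  by (intro C1_on_matrix_inv metric_component_C1 metric_posdef chart_open)

lemma transition_C1:
  "c \<in> A \<Longrightarrow> d \<in> A \<Longrightarrow> C1_on (chart_map c ` (chart_dom c \<inter> chart_dom d)) (transition c d)"
  using riemannian by (simp add: riemannian_manifold_def smooth_atlas_def smooth_on_def)

definition jacobian :: "('a, 'n) chart \<Rightarrow> ('a, 'n) chart \<Rightarrow> 'a \<Rightarrow> real^'n^'n" where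
  "jacobian c d q = matrix (frechet_derivative (transition c d) (at (chart_map c q)))"

lemma transition_has_derivative:
  assumes "c \<in> A" "d \<in> A" "q \<in> chart_dom c" "q \<in> chart_dom d"
  shows "(transition c d has_derivative (\<lambda>v. jacobian c d q *v v)) (at (chart_map c q))"
proof -
  have "(transition c d has_derivative frechet_derivative (transition c d) (at (chart_map c q)))
      (at (chart_map c q))"
    using assms by (intro C1_on_has_derivative[OF transition_C1[of c d]]) auto
  moreover from this have "linear (frechet_derivative (transition c d) (at (chart_map c q)))"
    by (rule has_derivative_linear)
  ultimately show ?thesis by (simp add: jacobian_def matrix_works)
qed

lemma transition_chart_map:
  "c \<in> A \<Longrightarrow> q \<in> chart_dom c \<Longrightarrow> transition c d (chart_map c q) = chart_map d q"
  by (simp add: transition_def chart_inv_map)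

lemma metric_transform:
  assumes "c \<in> A" "d \<in> A" "q \<in> chart_dom c" "q \<in> chart_dom d"
  shows "g c (chart_map c q) =
    transpose (jacobian c d q) ** g d (chart_map d q) ** jacobian c d q"
  using riemannian assms transition_chart_map[of c q d]
  unfolding riemannian_manifold_def riemannian_metric_def jacobian_def Let_def
  by (metis (no_types, lifting) IntI imageI)

lemma metric_norm_transform:
  assumes "c \<in> A" "d \<in> A" "q \<in> chart_dom c" "q \<in> chart_dom d"
  shows "v \<bullet> (g c (chart_map c q) *v v) =
    (jacobian c d q *v v) \<bullet> (g d (chart_map d q) *v (jacobian c d q *v v))"
  unfolding metric_transform[OF assms]
  by (metis dot_lmul_matrix inner_commute matrix_vector_mul_assoc transpose_matrix_vector)

lemma in_two_charts:
  assumes "c \<in> A" "d \<in> A" "q \<in> chart_dom c" "q \<in> chart_dom d"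
  shows "open (chart_map c ` (chart_dom c \<inter> chart_dom d))"
    "chart_map c q \<in> chart_map c ` (chart_dom c \<inter> chart_dom d)"
    "\<And>y. y \<in> chart_map c ` (chart_dom c \<inter> chart_dom d) \<Longrightarrow>
      (f \<circ> chart_inv c) y = (f \<circ> chart_inv d) (transition c d y)"
  using assms open_chart_map_image[OF assms(1) chart_open(1)[OF assms(2)]]
  by (auto simp: transition_def chart_inv_map)

text \<open>Coordinate gradients are covectors, so by the chain rule the transposed Jacobian of the
  transition from \<open>c\<close> to \<open>d\<close> carries them back from \<open>d\<close> to
  \<open>c\<close>.\<close>

lemma gradient_change_chart:
  assumes "c \<in> A" "d \<in> A" "q \<in> chart_dom c" "q \<in> chart_dom d"
    and "(f \<circ> chart_inv d) differentiable (at (chart_map d q))"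
  shows "(f \<circ> chart_inv c) differentiable (at (chart_map c q))"
    and "gradient (f \<circ> chart_inv c) (chart_map c q) =
      transpose (jacobian c d q) *v gradient (f \<circ> chart_inv d) (chart_map d q)"
proof -
  let ?G = "gradient (f \<circ> chart_inv d) (chart_map d q)"
  have "((\<lambda>y. (f \<circ> chart_inv d) (transition c d y)) has_derivative
      (\<lambda>v. ?G \<bullet> (jacobian c d q *v v))) (at (chart_map c q))"
    using has_derivative_compose[OF transition_has_derivative[OF assms(1-4)]
      has_derivative_gradient[of "f \<circ> chart_inv d"]] assms(5)
    by (simp add: transition_chart_map[OF assms(1,3)])
  then have "((f \<circ> chart_inv c) has_derivative (\<lambda>v. ?G \<bullet> (jacobian c d q *v v))) (at (chart_map c q))"
    by (rule has_derivative_transform_within_open[OF _ in_two_charts(1,2)[OF assms(1-4)]])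
      (simp only: in_two_charts(3)[OF assms(1-4)])
  moreover have "(\<lambda>v. ?G \<bullet> (jacobian c d q *v v)) = (\<lambda>v. (transpose (jacobian c d q) *v ?G) \<bullet> v)"
    by (simp add: dot_lmul_matrix)
  ultimately have *: "((f \<circ> chart_inv c) has_derivative
      (\<lambda>v. (transpose (jacobian c d q) *v ?G) \<bullet> v)) (at (chart_map c q))" by simp
  then show "(f \<circ> chart_inv c) differentiable (at (chart_map c q))"
    by (auto simp: differentiable_def)
  show "gradient (f \<circ> chart_inv c) (chart_map c q) = transpose (jacobian c d q) *v ?G"
    by (rule gradient_unique[OF *])
qed

text \<open>Coordinate gradients are covectors; the inverse metric pairs them, which amounts to the
  metric product of the two metric gradients.\<close>

definition chart_pairing ::
  "('a, 'n) chart \<Rightarrow> ('a \<Rightarrow> real) \<Rightarrow> ('a \<Rightarrow> real) \<Rightarrow> 'a \<Rightarrow> real" where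
  "chart_pairing c f h q = gradient (f \<circ> chart_inv c) (chart_map c q) \<bullet>
     (matrix_inv (g c (chart_map c q)) *v gradient (h \<circ> chart_inv c) (chart_map c q))"

text \<open>The transformation law of the inverse metric is not computed. Instead the vector that
  the metric assigns to one covector is transported through the Jacobian.\<close>

lemma chart_pairing_indep:
  assumes "c \<in> A" "d \<in> A" "q \<in> chart_dom c" "q \<in> chart_dom d"
    and "(f \<circ> chart_inv d) differentiable (at (chart_map d q))"
    and "(h \<circ> chart_inv d) differentiable (at (chart_map d q))"
  shows "chart_pairing c f h q = chart_pairing d f h q"
proof -
  define J where "J = jacobian c d q"
  define a where "a = gradient (f \<circ> chart_inv d) (chart_map d q)"
  define b where "b = gradient (h \<circ> chart_inv d) (chart_map d q)"
  define Gc where "Gc = g c (chart_map c q)"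
  define Gd where "Gd = g d (chart_map d q)"
  have pd: "posdef Gc" "posdef Gd" using metric_posdef chart_map_mem assms by (auto simp: Gc_def Gd_def)
  have G: "Gc = transpose J ** Gd ** J" unfolding Gc_def Gd_def J_def by (rule metric_transform[OF assms(1-4)])
  have "det Gc \<noteq> 0" using posdef_det_pos[OF pd(1)] by simp
  \<comment> \<open>The determinant of \<open>Gc\<close> is that of \<open>Gd\<close> times the
    square of \<open>det J\<close>, so invertibility of the metric forces that of the
    Jacobian.\<close>
  then have "det J \<noteq> 0" by (auto simp: G det_mul)
  then have "surj ((*v) J)"
    by (simp add: invertible_det_nz[symmetric] invertible_right_inverse matrix_right_invertible_surjective)
  \<comment> \<open>\<open>y\<close> are the components in chart \<open>c\<close> of the vector
    which the metric assigns to the covector \<open>b\<close>.\<close>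
  then obtain y where y: "matrix_inv Gd *v b = J *v y" by (metis surjD)
  have "Gc *v y = transpose J *v (Gd *v (J *v y))" unfolding G by (simp only: matrix_vector_mul_assoc matrix_mul_assoc)
  also have "\<dots> = transpose J *v b" by (simp only: y[symmetric] posdef_matrix_inv(3)[OF pd(2)])
  finally have "matrix_inv Gc *v (transpose J *v b) = y"
    using posdef_matrix_inv(4)[OF pd(1)] by metis
  then have "(transpose J *v a) \<bullet> (matrix_inv Gc *v (transpose J *v b)) = a \<bullet> (J *v y)"
    by (simp add: dot_lmul_matrix)
  also have "\<dots> = a \<bullet> (matrix_inv Gd *v b)" by (simp add: y)
  finally show ?thesis
    unfolding chart_pairing_def gradient_change_chart(2)[OF assms(1-4) assms(5)]
      gradient_change_chart(2)[OF assms(1-4) assms(6)]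
    by (simp only: J_def a_def b_def Gc_def Gd_def)
qed

text \<open>The set is a parameter because \<open>u\<close> is regular off the puncture only, while
  the weights are regular everywhere.\<close>

definition C1_manifold :: "'a set \<Rightarrow> ('a \<Rightarrow> real) \<Rightarrow> bool" where
  "C1_manifold U f \<longleftrightarrow> (\<forall>c\<in>A. C1_on (chart_map c ` (chart_dom c \<inter> U)) (f \<circ> chart_inv c))"

lemma C1_manifold_differentiable:
  "C1_manifold U f \<Longrightarrow> c \<in> A \<Longrightarrow> q \<in> chart_dom c \<Longrightarrow> q \<in> U \<Longrightarrow>
    (f \<circ> chart_inv c) differentiable (at (chart_map c q))"
  unfolding C1_manifold_def by (rule C1_on_differentiable) auto

text \<open>The inner product of the differentials; it depends on the chosen chart unless both functions are
  differentiable at \<open>q\<close>.\<close>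

definition pairing :: "('a \<Rightarrow> real) \<Rightarrow> ('a \<Rightarrow> real) \<Rightarrow> 'a \<Rightarrow> real" where
  "pairing f h q = chart_pairing (SOME c. c \<in> A \<and> q \<in> chart_dom c) f h q"

lemma some_chart:
  assumes "c \<in> A" "q \<in> chart_dom c"
  shows "(SOME c. c \<in> A \<and> q \<in> chart_dom c) \<in> A" "q \<in> chart_dom (SOME c. c \<in> A \<and> q \<in> chart_dom c)"
  using someI[of "\<lambda>c. c \<in> A \<and> q \<in> chart_dom c" c] assms by auto

lemma pairing_eq:
  assumes "c \<in> A" "q \<in> chart_dom c" "C1_manifold U f" "C1_manifold V h" "q \<in> U" "q \<in> V"
  shows "pairing f h q = chart_pairing c f h q"
  unfolding pairing_def
  using assms by (intro chart_pairing_indep some_chart C1_manifold_differentiable)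

text \<open>The Hausdorff property enters here: the image of \<open>K\<close> is closed, so a point
  outside the chart has a neighbourhood on which the extension vanishes.\<close>

lemma C1_manifold_lift:
  assumes "c \<in> A" "C1_on (chart_img c) b" "compact K" "K \<subseteq> chart_img c"
    and "\<And>x. x \<in> chart_img c \<Longrightarrow> x \<notin> K \<Longrightarrow> b x = 0"
  shows "C1_manifold UNIV (\<lambda>q. if q \<in> chart_dom c then b (chart_map c q) else 0)"
  unfolding C1_manifold_def
proof (intro ballI C1_on_open_Union)
  fix d y assume d: "d \<in> A" and "y \<in> chart_map d ` (chart_dom d \<inter> UNIV)"
  then obtain q where q: "q \<in> chart_dom d" "y = chart_map d q" by auto
  let ?f = "\<lambda>q. if q \<in> chart_dom c then b (chart_map c q) else 0"
  show "\<exists>U. open U \<and> y \<in> U \<and> C1_on U (?f \<circ> chart_inv d)"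
  proof (cases "q \<in> chart_dom c")
    case True
    let ?U = "chart_map d ` (chart_dom d \<inter> chart_dom c)"
    have "C1_on ?U (\<lambda>x. b (transition d c x))"
    proof (rule C1_on_compose[OF transition_C1[OF d assms(1)] assms(2)])
      show "transition d c ` ?U \<subseteq> chart_img c"
        using chart_map_mem[of _ c] by (auto simp: transition_def chart_inv_map[OF d])
    qed
    moreover have "open ?U" using open_chart_map_image d chart_open(1)[OF assms(1)] by blast
    moreover have "(?f \<circ> chart_inv d) x = b (transition d c x)" if "x \<in> ?U" for x
      using that by (auto simp: transition_def chart_inv_map[OF d])
    ultimately have "C1_on ?U (?f \<circ> chart_inv d)"
      using C1_on_cong[of ?U "?f \<circ> chart_inv d" "\<lambda>x. b (transition d c x)"] by simp
    then show ?thesis using \<open>open ?U\<close> q True by blast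
  next
    case False
    let ?U = "chart_map d ` (chart_dom d \<inter> - (chart_inv c ` K))"
    have "closed (chart_inv c ` K)"
      using compact_chart_inv_image[OF assms(1,3,4)] by (rule compact_imp_closed)
    then have "open ?U" using open_chart_map_image[OF d] by auto
    moreover have "y \<in> ?U" using q False chart_inv_mem[OF assms(1)] assms(4) by blast
    moreover have "(?f \<circ> chart_inv d) x = 0" if x: "x \<in> ?U" for x
    proof -
      obtain r where r: "r \<in> chart_dom d" "r \<notin> chart_inv c ` K" "x = chart_map d r" using x by blast
      then have "chart_map c r \<notin> K" if "r \<in> chart_dom c"
        using chart_inv_map[OF assms(1) that] by (metis image_eqI)
      then show ?thesis using r assms(5) chart_map_mem[of r c] by (simp add: chart_inv_map[OF d])
    qed
    ultimately have "C1_on ?U (?f \<circ> chart_inv d)"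
      using C1_on_cong[of ?U "?f \<circ> chart_inv d" "\<lambda>_. 0"] by simp
    then show ?thesis using \<open>open ?U\<close> \<open>y \<in> ?U\<close> by blast
  qed
qed

lemma C1_manifold_const: "C1_manifold U (\<lambda>_. k)"
  by (simp add: C1_manifold_def comp_def)

lemma C1_manifold_diff: "C1_manifold U f \<Longrightarrow> C1_manifold U h \<Longrightarrow> C1_manifold U (\<lambda>q. f q - h q)"
  and C1_manifold_mult: "C1_manifold U f \<Longrightarrow> C1_manifold U h \<Longrightarrow> C1_manifold U (\<lambda>q. f q * h q)"
  by (auto simp: C1_manifold_def comp_def intro: C1_on_diff C1_on_mult)

lemma continuous_in_charts:
  fixes f :: "'a \<Rightarrow> real"
  assumes "open U" "\<And>c. c \<in> A \<Longrightarrow> continuous_on (chart_map c ` (chart_dom c \<inter> U)) (f \<circ> chart_inv c)"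
  shows "continuous_on (carrier A \<inter> U) f"
proof (rule continuous_at_imp_continuous_on, rule ballI)
  fix q assume "q \<in> carrier A \<inter> U"
  then obtain c where c: "c \<in> A" "q \<in> chart_dom c" "q \<in> U" by (auto simp: carrier_def)
  let ?D = "chart_dom c \<inter> U"
  have "continuous_on ?D (chart_map c)"
    using chart_map_continuous[OF c(1)] by (rule continuous_on_subset) auto
  then have "continuous_on ?D (\<lambda>q. (f \<circ> chart_inv c) (chart_map c q))"
    using assms(2)[OF c(1)] by (intro continuous_on_compose2[of _ "f \<circ> chart_inv c" _ "chart_map c"]) auto
  moreover have "(f \<circ> chart_inv c) (chart_map c q) = f q" if "q \<in> ?D" for q
    using that by (simp add: chart_inv_map[OF c(1)])
  ultimately have "continuous_on ?D f" by (metis (mono_tags, lifting) continuous_on_cong)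
  then show "continuous (at q) f"
    using c chart_open(1)[OF c(1)] assms(1) by (simp add: continuous_on_eq_continuous_at open_Int)
qed

lemma C1_manifold_continuous:
  "C1_manifold U f \<Longrightarrow> open U \<Longrightarrow> continuous_on (carrier A \<inter> U) f"
  unfolding C1_manifold_def by (rule continuous_in_charts) (use C1_on_continuous in blast)+

section \<open>Bump functions and the Riemannian distance\<close>

text \<open>The squared radius keeps the profile differentiable at the centre. The step is complete
  at radius \<open>sqrt 2 * s\<close>; the rounder \<open>2 * s\<close> is used throughout.\<close>

definition bump :: "('a, 'n) chart \<Rightarrow> real^'n \<Rightarrow> real \<Rightarrow> 'a \<Rightarrow> real" where
  "bump c x0 s q = (if q \<in> chart_dom c
     then 1 - step ((chart_map c q - x0) \<bullet> (chart_map c q - x0) / s\<^sup>2) else 0)"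

lemma has_derivative_radial:
  "((\<lambda>x::real^'n. (x - x0) \<bullet> (x - x0) / s\<^sup>2) has_derivative (\<lambda>v. (2 / s\<^sup>2) *\<^sub>R (x - x0) \<bullet> v)) (at x)"
proof -
  have "((\<lambda>x::real^'n. (x - x0) \<bullet> (x - x0)) has_derivative (\<lambda>v. 2 * ((x - x0) \<bullet> v))) (at x)"
    by (auto intro!: derivative_eq_intros simp: inner_commute)
  from bounded_linear.has_derivative[OF bounded_linear_divide this, of "s\<^sup>2"]
  show ?thesis by simp
qed

lemma C1_on_radial_square: "C1_on S (\<lambda>x::real^'n. (x - x0) \<bullet> (x - x0) / s\<^sup>2)"
  by (rule C1_onI[OF has_derivative_radial]) (intro continuous_intros)

lemma step'_continuous: "continuous_on S step'"
proof -
  obtain h where "\<And>t. (step' has_field_derivative h t) (at t)" using step'_C1 by blast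
  then show ?thesis by (meson DERIV_isCont continuous_at_imp_continuous_on)
qed

lemma C1_on_radial_step: "C1_on S (\<lambda>x::real^'n. step ((x - x0) \<bullet> (x - x0) / s\<^sup>2))"
  by (rule C1_on_real_compose[OF C1_on_radial_square DERIV_step step'_continuous])

lemma radial_bounds:
  fixes x x0 :: "real^'n"
  assumes "s > 0"
  shows "x \<in> cball x0 s \<Longrightarrow> (x - x0) \<bullet> (x - x0) / s\<^sup>2 \<le> 1"
    and "x \<notin> cball x0 (2 * s) \<Longrightarrow> (x - x0) \<bullet> (x - x0) / s\<^sup>2 \<ge> 2"
proof -
  assume "x \<in> cball x0 s"
  then have "(norm (x - x0))\<^sup>2 \<le> s\<^sup>2" by (intro power_mono) (auto simp: dist_norm norm_minus_commute)
  then show "(x - x0) \<bullet> (x - x0) / s\<^sup>2 \<le> 1" using assms by (simp add: dot_square_norm)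
next
  assume "x \<notin> cball x0 (2 * s)"
  then have "(2 * s)\<^sup>2 \<le> (norm (x - x0))\<^sup>2"
    using assms by (intro power_mono) (auto simp: dist_norm norm_minus_commute)
  moreover have "2 * s\<^sup>2 \<le> (2 * s)\<^sup>2" by (simp add: power_mult_distrib)
  ultimately have "2 * s\<^sup>2 \<le> (norm (x - x0))\<^sup>2" by linarith
  then show "(x - x0) \<bullet> (x - x0) / s\<^sup>2 \<ge> 2"
    using assms by (simp add: dot_square_norm field_simps)
qed

lemma bump_C1:
  assumes "c \<in> A" "s > 0" "cball x0 (2 * s) \<subseteq> chart_img c"
  shows "C1_manifold UNIV (bump c x0 s)"
  unfolding bump_def[abs_def]
  by (rule C1_manifold_lift[OF assms(1) _ compact_cball assms(3)])
    (auto intro!: C1_on_diff C1_on_radial_step C1_on_const step_eq_1 radial_bounds(2)[OF assms(2)])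

lemma bump_bounds: "0 \<le> bump c x0 s q" "bump c x0 s q \<le> 1"
  using step_bounds by (auto simp: bump_def)

lemma bump_eq_1:
  "s > 0 \<Longrightarrow> q \<in> chart_dom c \<Longrightarrow> chart_map c q \<in> cball x0 s \<Longrightarrow> bump c x0 s q = 1"
  using radial_bounds(1) step_eq_0 by (simp add: bump_def)

lemma bump_nonzero:
  "s > 0 \<Longrightarrow> bump c x0 s q \<noteq> 0 \<Longrightarrow> q \<in> chart_dom c \<and> chart_map c q \<in> cball x0 (2 * s)"
  using radial_bounds(2)[of s "chart_map c q" x0] step_eq_1
  unfolding bump_def by (metis diff_self)

text \<open>\<open>K\<close> bounds the differential in the norm dual to the metric. This norm is
  intrinsic, so one constant serves all charts, as curves that change charts require.\<close>

definition grad_bound :: "('a \<Rightarrow> real) \<Rightarrow> real \<Rightarrow> bool" where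
  "grad_bound f K \<longleftrightarrow> K \<ge> 0 \<and> (\<forall>c\<in>A. \<forall>x\<in>chart_img c. \<forall>v.
     \<bar>gradient (f \<circ> chart_inv c) x \<bullet> v\<bar> \<le> K * sqrt (v \<bullet> (g c x *v v)))"

lemma bump_inv:
  assumes "c \<in> A" "x \<in> chart_img c"
  shows "bump c x0 s (chart_inv c x) = 1 - step ((x - x0) \<bullet> (x - x0) / s\<^sup>2)"
  by (simp add: bump_def chart_inv_mem[OF assms] chart_map_inv[OF assms])

text \<open>On the compact coordinate ball the Euclidean gradient is bounded and \<open>m\<close>
  compares Euclidean with metric length; outside it the bump is locally 0. Other charts inherit the
  constant because the transition preserves the metric.\<close>

lemma ex_grad_bound_bump:
  assumes c: "c \<in> A" and s: "s > 0" "cball x0 (2 * s) \<subseteq> chart_img c"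
    and m: "m > 0" "\<And>y v. y \<in> cball x0 (2 * s) \<Longrightarrow> m * (v \<bullet> v) \<le> v \<bullet> (g c y *v v)"
  shows "\<exists>K. grad_bound (bump c x0 s) K"
proof -
  let ?f = "bump c x0 s"
  have C1: "C1_manifold UNIV ?f" by (rule bump_C1[OF c s])
  then have "C1_on (chart_img c) (?f \<circ> chart_inv c)"
    using c by (auto simp: C1_manifold_def chart_img_def)
  then have "continuous_on (cball x0 (2 * s)) (gradient (?f \<circ> chart_inv c))"
    using C1_on_continuous_gradient continuous_on_subset s(2) by blast
  then have "bounded (gradient (?f \<circ> chart_inv c) ` cball x0 (2 * s))"
    using compact_continuous_image compact_imp_bounded compact_cball by blast
  then obtain B where B: "B > 0" "\<And>y. y \<in> cball x0 (2 * s) \<Longrightarrow> norm (gradient (?f \<circ> chart_inv c) y) \<le> B"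
    by (auto simp: bounded_pos)
  define K where "K = B / sqrt m"
  have K: "K \<ge> 0" using B(1) m(1) by (simp add: K_def)
  have zero: "gradient (?f \<circ> chart_inv d) (chart_map d q) = 0"
    if d: "d \<in> A" "q \<in> chart_dom d" and q: "q \<notin> chart_inv c ` cball x0 (2 * s)" for d q
  proof -
    let ?U = "chart_map d ` (chart_dom d \<inter> - (chart_inv c ` cball x0 (2 * s)))"
    have "closed (chart_inv c ` cball x0 (2 * s))"
      using compact_chart_inv_image[OF c compact_cball s(2)] by (rule compact_imp_closed)
    then have "open ?U" using open_chart_map_image[OF d(1)] by auto
    moreover have "chart_map d q \<in> ?U" using d q by blast
    moreover have "(?f \<circ> chart_inv d) x = 0" if "x \<in> ?U" for x
    proof (rule ccontr)
      obtain r where r: "r \<in> chart_dom d" "r \<notin> chart_inv c ` cball x0 (2 * s)" "x = chart_map d r"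
        using \<open>x \<in> ?U\<close> by blast
      assume "(?f \<circ> chart_inv d) x \<noteq> 0"
      then have "?f r \<noteq> 0" using r d(1) by (simp add: chart_inv_map)
      then have "r \<in> chart_dom c" "chart_map c r \<in> cball x0 (2 * s)" using bump_nonzero[OF s(1)] by auto
      then show False using r(2) chart_inv_map[OF c] by (metis image_eqI)
    qed
    ultimately show ?thesis
      using gradient_transform[of ?U "chart_map d q" "?f \<circ> chart_inv d" "\<lambda>_. 0"] gradient_const by simp
  qed
  have inside: "\<bar>gradient (?f \<circ> chart_inv c) x \<bullet> v\<bar> \<le> K * sqrt (v \<bullet> (g c x *v v))"
    if "x \<in> cball x0 (2 * s)" for x v
  proof -
    have "sqrt m * norm v = sqrt (m * (v \<bullet> v))" by (simp add: real_sqrt_mult norm_eq_sqrt_inner)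
    also have "\<dots> \<le> sqrt (v \<bullet> (g c x *v v))" using m(2)[OF that] by simp
    finally have v: "norm v \<le> sqrt (v \<bullet> (g c x *v v)) / sqrt m" using m(1) by (simp add: field_simps)
    have "\<bar>gradient (?f \<circ> chart_inv c) x \<bullet> v\<bar> \<le> norm (gradient (?f \<circ> chart_inv c) x) * norm v"
      by (rule Cauchy_Schwarz_ineq2)
    also have "\<dots> \<le> B * (sqrt (v \<bullet> (g c x *v v)) / sqrt m)"
      using B(2)[OF that] v B(1) by (intro mult_mono) auto
    finally show ?thesis by (simp add: K_def)
  qed
  have "\<bar>gradient (?f \<circ> chart_inv d) x \<bullet> v\<bar> \<le> K * sqrt (v \<bullet> (g d x *v v))"
    if d: "d \<in> A" "x \<in> chart_img d" for d x v
  proof -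
    define q where "q = chart_inv d x"
    have q: "q \<in> chart_dom d" "x = chart_map d q"
      using d by (auto simp: q_def chart_inv_mem chart_map_inv)
    show ?thesis
    proof (cases "q \<in> chart_inv c ` cball x0 (2 * s)")
      case True
      then have qc: "q \<in> chart_dom c" "chart_map c q \<in> cball x0 (2 * s)"
        using s(2) chart_inv_mem[OF c] chart_map_inv[OF c] by auto
      have "gradient (?f \<circ> chart_inv d) x \<bullet> v =
          gradient (?f \<circ> chart_inv c) (chart_map c q) \<bullet> (jacobian d c q *v v)"
        unfolding q(2) using gradient_change_chart(2)[OF d(1) c q(1) qc(1)]
          C1_manifold_differentiable[OF C1 c qc(1)] by (simp add: dot_lmul_matrix)
      then show ?thesis using inside[OF qc(2)] metric_norm_transform[OF d(1) c q(1) qc(1)] q(2) by simp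
    next
      case False
      then show ?thesis using zero[OF d(1) q(1) False] q(2) K
          posdef_nonneg[OF metric_posdef[OF d]] by simp
    qed
  qed
  then show ?thesis using K unfolding grad_bound_def by blast
qed

section \<open>Lengths of curves and their behaviour under Lipschitz functions\<close>

lemma coord_length_integrand_continuous:
  assumes "c \<in> A" "\<sigma> C1_differentiable_on {0..1}" "\<sigma> ` {0..1} \<subseteq> chart_img c"
  shows "continuous_on {0..1}
    (\<lambda>t. sqrt (vector_derivative \<sigma> (at t) \<bullet> (g c (\<sigma> t) *v vector_derivative \<sigma> (at t))))"
proof -
  have D: "continuous_on {0..1} (\<lambda>t. vector_derivative \<sigma> (at t))" and s: "continuous_on {0..1} \<sigma>"
    using assms(2) C1_differentiable_imp_continuous_on by (auto simp: C1_differentiable_on_eq)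
  have "continuous_on {0..1} (\<lambda>t. g c (\<sigma> t))"
    using continuous_on_compose2[OF metric_continuous[OF assms(1)] s] assms(3) by auto
  then have G: "continuous_on {0..1} (\<lambda>t. g c (\<sigma> t) $ i $ j)" for i j
    by (intro continuous_on_component)
  have S: "continuous_on {0..1} (\<lambda>t. vector_derivative \<sigma> (at t) $ i)" for i
    by (intro continuous_on_component D)
  show ?thesis
    unfolding inner_vec_def matrix_vector_mult_def vec_lambda_beta inner_real_def
    by (intro continuous_on_real_sqrt continuous_on_sum continuous_on_mult G S)
qed

lemma coord_length_nonneg:
  assumes "c \<in> A" "\<sigma> C1_differentiable_on {0..1}" "\<sigma> ` {0..1} \<subseteq> chart_img c"
  shows "coord_length (g c) \<sigma> \<ge> 0"
  unfolding coord_length_def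
  by (intro integral_nonneg integrable_continuous_interval coord_length_integrand_continuous[OF assms]
      real_sqrt_ge_zero posdef_nonneg metric_posdef[OF assms(1)]) (use assms(3) in blast)

lemma curve_length_nonneg: "curve_length A g q r L \<Longrightarrow> L \<ge> 0"
  by (induction rule: curve_length.induct) (auto intro: add_nonneg_nonneg coord_length_nonneg)

lemma curve_length_carrier: "curve_length A g q r L \<Longrightarrow> q \<in> carrier A \<and> r \<in> carrier A"
  by (induction rule: curve_length.induct) (auto intro!: chart_inv_carrier)

lemma coord_length_lipschitz:
  assumes "c \<in> A" "\<sigma> C1_differentiable_on {0..1}" "\<sigma> ` {0..1} \<subseteq> chart_img c"
    and "C1_manifold UNIV f" "grad_bound f K"
  shows "\<bar>f (chart_inv c (\<sigma> 1)) - f (chart_inv c (\<sigma> 0))\<bar> \<le> K * coord_length (g c) \<sigma>"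
proof -
  let ?h = "f \<circ> chart_inv c" and ?s = "\<lambda>t. vector_derivative \<sigma> (at t)"
  have C1: "C1_on (chart_img c) ?h" using assms(1,4) by (auto simp: C1_manifold_def chart_img_def)
  have D: "((\<lambda>t. ?h (\<sigma> t)) has_vector_derivative gradient ?h (\<sigma> t) \<bullet> ?s t) (at t within {0..1})"
    if "t \<in> {0..1}" for t
  proof -
    have "(\<sigma> has_vector_derivative ?s t) (at t)"
      using assms(2) that by (auto simp: C1_differentiable_on_eq vector_derivative_works)
    then have "(\<sigma> has_derivative (\<lambda>u. u *\<^sub>R ?s t)) (at t)" by (simp add: has_vector_derivative_def)
    moreover have "(?h has_derivative (\<lambda>v. gradient ?h (\<sigma> t) \<bullet> v)) (at (\<sigma> t))"
      using assms(3) that by (intro has_derivative_gradient C1_on_differentiable[OF C1]) auto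
    ultimately have "((\<lambda>t. ?h (\<sigma> t)) has_derivative (\<lambda>u. gradient ?h (\<sigma> t) \<bullet> (u *\<^sub>R ?s t))) (at t)"
      by (rule has_derivative_compose)
    then show ?thesis
      by (simp add: has_vector_derivative_def has_derivative_at_withinI)
  qed
  have int: "((\<lambda>t. gradient ?h (\<sigma> t) \<bullet> ?s t) has_integral ?h (\<sigma> 1) - ?h (\<sigma> 0)) {0..1}"
    using fundamental_theorem_of_calculus[OF _ D] by simp
  have "norm (integral {0..1} (\<lambda>t. gradient ?h (\<sigma> t) \<bullet> ?s t))
      \<le> integral {0..1} (\<lambda>t. K * sqrt (?s t \<bullet> (g c (\<sigma> t) *v ?s t)))"
  proof (rule integral_norm_bound_integral)
    show "(\<lambda>t. gradient ?h (\<sigma> t) \<bullet> ?s t) integrable_on {0..1}" using int by blast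
    show "(\<lambda>t. K * sqrt (?s t \<bullet> (g c (\<sigma> t) *v ?s t))) integrable_on {0..1}"
      by (intro integrable_continuous_interval continuous_intros coord_length_integrand_continuous assms)
    show "norm (gradient ?h (\<sigma> t) \<bullet> ?s t) \<le> K * sqrt (?s t \<bullet> (g c (\<sigma> t) *v ?s t))" if "t \<in> {0..1}" for t
    proof -
      have "\<sigma> t \<in> chart_img c" using assms(3) that by blast
      then show ?thesis using assms(1,5) by (simp add: grad_bound_def)
    qed
  qed
  then show ?thesis using integral_unique[OF int] by (simp add: coord_length_def)
qed

lemma curve_length_lipschitz:
  assumes "C1_manifold UNIV f" "grad_bound f K"
  shows "curve_length A g q r L \<Longrightarrow> \<bar>f r - f q\<bar> \<le> K * L"
proof (induction rule: curve_length.induct)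
  case (append q c \<sigma> L)
  then show ?case using coord_length_lipschitz[OF append.hyps(2-4) assms]
    by (simp add: distrib_left)
qed simp

text \<open>The induction runs over the second curve, since \<open>append\<close> extends a curve
  only at its end.\<close>

lemma curve_length_trans:
  "curve_length A g r t L' \<Longrightarrow> curve_length A g q r L \<Longrightarrow> curve_length A g q t (L + L')"
proof (induction r t L' rule: curve_length.induct)
  case (append r c \<sigma> L')
  then show ?case using curve_length.append[of A g q c \<sigma> "L + L'"] by (simp add: add.assoc)
qed simp

lemma coord_length_reverse:
  assumes "c \<in> A" "\<sigma> C1_differentiable_on {0..1}" "\<sigma> ` {0..1} \<subseteq> chart_img c"
  shows "(\<lambda>t. \<sigma> (1 - t)) C1_differentiable_on {0..1}"
    and "coord_length (g c) (\<lambda>t. \<sigma> (1 - t)) = coord_length (g c) \<sigma>"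
proof -
  let ?s = "\<lambda>t. vector_derivative \<sigma> (at t)"
  have D: "((\<lambda>t. \<sigma> (1 - t)) has_vector_derivative - ?s (1 - t)) (at t)" if "t \<in> {0..1}" for t
  proof -
    have "(\<sigma> has_vector_derivative ?s (1 - t)) (at (1 - t))"
      using assms(2) that by (auto simp: C1_differentiable_on_eq vector_derivative_works)
    then have "((\<sigma> \<circ> (\<lambda>t. 1 - t)) has_vector_derivative (-1) *\<^sub>R ?s (1 - t)) (at t)"
      by (intro vector_diff_chain_at) (auto intro!: derivative_eq_intros)
    then show ?thesis by (simp add: o_def)
  qed
  have cs: "continuous_on {0..1} ?s" using assms(2) by (simp add: C1_differentiable_on_eq)
  have "continuous_on {0..1} (\<lambda>t. - ?s (1 - t))"
    by (intro continuous_intros continuous_on_compose2[OF cs]) auto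
  then show "(\<lambda>t. \<sigma> (1 - t)) C1_differentiable_on {0..1}"
    using D unfolding C1_differentiable_on_def by (intro exI[of _ "\<lambda>t. - ?s (1 - t)"]) simp
  define F where "F t = sqrt (?s t \<bullet> (g c (\<sigma> t) *v ?s t))" for t
  have "(F has_integral coord_length (g c) \<sigma>) (cbox 0 1)"
    using integrable_integral[OF integrable_continuous_interval[OF coord_length_integrand_continuous[OF assms]]]
    by (simp add: F_def[abs_def] coord_length_def)
  from has_integral_affinity[OF this, of "-1" 1]
  have "((\<lambda>t. F (1 - t)) has_integral coord_length (g c) \<sigma>) ((\<lambda>x. 1 - x) ` {0..1})"
    by (simp add: add.commute)
  moreover have "(\<lambda>x::real. 1 - x) ` {0..1} = {0..1}"
    by (simp add: image_diff_atLeastAtMost)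
  ultimately have "integral {0..1} (\<lambda>t. F (1 - t)) = coord_length (g c) \<sigma>"
    by (simp add: integral_unique)
  moreover have "integral {0..1} (\<lambda>t. F (1 - t)) = coord_length (g c) (\<lambda>t. \<sigma> (1 - t))"
    unfolding coord_length_def
  proof (rule integral_cong)
    have "G *v (- w) = - (G *v w)" for G :: "real^'n^'n" and w
      by (simp add: vec_eq_iff matrix_vector_mult_def sum_negf)
    then show "F (1 - t) = sqrt (vector_derivative (\<lambda>t. \<sigma> (1 - t)) (at t) \<bullet>
        (g c (\<sigma> (1 - t)) *v vector_derivative (\<lambda>t. \<sigma> (1 - t)) (at t)))" if "t \<in> {0..1}" for t
      using vector_derivative_at[OF D[OF that]] by (simp add: F_def)
  qed
  ultimately show "coord_length (g c) (\<lambda>t. \<sigma> (1 - t)) = coord_length (g c) \<sigma>" by simp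
qed

lemma curve_length_piece:
  assumes "c \<in> A" "\<sigma> C1_differentiable_on {0..1}" "\<sigma> ` {0..1} \<subseteq> chart_img c"
  shows "curve_length A g (chart_inv c (\<sigma> 0)) (chart_inv c (\<sigma> 1)) (coord_length (g c) \<sigma>)"
proof -
  have "\<sigma> 0 \<in> chart_img c" using assms(3) by auto
  then have "curve_length A g (chart_inv c (\<sigma> 0)) (chart_inv c (\<sigma> 0)) 0"
    by (intro curve_length.trivial chart_inv_carrier assms)
  from curve_length.append[OF this assms] show ?thesis by simp
qed

lemma curve_length_sym: "curve_length A g q r L \<Longrightarrow> curve_length A g r q L"
proof (induction rule: curve_length.induct)
  case (trivial q)
  then show ?case by (rule curve_length.trivial)
next
  case (append q c \<sigma> L)
  have "(\<lambda>t. \<sigma> (1 - t)) ` {0..1} \<subseteq> chart_img c" using append.hyps(4) by auto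
  from curve_length_piece[OF append.hyps(2) coord_length_reverse(1)[OF append.hyps(2-4)] this]
  have "curve_length A g (chart_inv c (\<sigma> 1)) (chart_inv c (\<sigma> 0)) (coord_length (g c) \<sigma>)"
    by (simp add: coord_length_reverse(2)[OF append.hyps(2-4)])
  from curve_length_trans[OF append.IH this] show ?case by (simp add: add.commute)
qed

text \<open>The source of all upper bounds on the distance: coordinate segments along which the
  metric speed is at most \<open>B\<close>.\<close>

lemma curve_length_segment:
  assumes "c \<in> A" "closed_segment x y \<subseteq> chart_img c"
    and "\<And>z. z \<in> closed_segment x y \<Longrightarrow> sqrt ((y - x) \<bullet> (g c z *v (y - x))) \<le> B"
  obtains L where "L \<le> B" "curve_length A g (chart_inv c x) (chart_inv c y) L"
proof -
  define \<sigma> where "\<sigma> t = x + t *\<^sub>R (y - x)" for t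
  have D: "(\<sigma> has_vector_derivative (y - x)) (at t)" for t
    unfolding \<sigma>_def[abs_def] by (auto intro!: derivative_eq_intros)
  then have C1: "\<sigma> C1_differentiable_on {0..1}"
    unfolding C1_differentiable_on_def by (intro exI[of _ "\<lambda>_. y - x"]) simp
  have seg: "\<sigma> t \<in> closed_segment x y" if "t \<in> {0..1}" for t
    using that unfolding in_segment by (auto simp: \<sigma>_def algebra_simps intro!: exI[of _ t])
  then have img: "\<sigma> ` {0..1} \<subseteq> chart_img c" using assms(2) by blast
  have "coord_length (g c) \<sigma> \<le> integral {0..1::real} (\<lambda>t. B)"
    unfolding coord_length_def
    by (intro integral_le integrable_continuous_interval coord_length_integrand_continuous assms(1) C1 img)
      (auto simp: vector_derivative_at[OF D] intro!: assms(3) seg)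
  then show ?thesis
    using that[of "coord_length (g c) \<sigma>"] curve_length_piece[OF assms(1) C1 img] by (simp add: \<sigma>_def)
qed

text \<open>These are not geodesic normal coordinates. All that is asked is a coordinate ball on
  which the metric and the Euclidean inner product bound each other.\<close>

lemma ex_normal_chart:
  assumes "q \<in> carrier A" "open U" "q \<in> U"
  obtains c s m N where "c \<in> A" "q \<in> chart_dom c" "s > 0" "m > 0" "N > 0"
    "cball (chart_map c q) (2 * s) \<subseteq> chart_map c ` (chart_dom c \<inter> U)"
    "\<And>y v. y \<in> cball (chart_map c q) (2 * s) \<Longrightarrow> m * (v \<bullet> v) \<le> v \<bullet> (g c y *v v)"
    "\<And>y v. y \<in> cball (chart_map c q) (2 * s) \<Longrightarrow> v \<bullet> (g c y *v v) \<le> N * (v \<bullet> v)"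
proof -
  obtain c where c: "c \<in> A" "q \<in> chart_dom c" using assms(1) by (auto simp: carrier_def)
  let ?V = "chart_map c ` (chart_dom c \<inter> U)" and ?x = "chart_map c q"
  have V: "open ?V" "?x \<in> ?V" "?V \<subseteq> chart_img c"
    using open_chart_map_image[OF c(1) assms(2)] c assms(3) by (auto simp: chart_img_def)
  have pd: "posdef (g c ?x)" using metric_posdef c chart_map_mem by blast
  obtain r where r: "r > 0" "cball ?x r \<subseteq> ?V"
    "\<And>y v. y \<in> cball ?x r \<Longrightarrow> v \<bullet> (g c y *v v) \<le> 4 * (v \<bullet> (g c ?x *v v))"
    "\<And>y v. y \<in> cball ?x r \<Longrightarrow> v \<bullet> (g c ?x *v v) \<le> 4 * (v \<bullet> (g c y *v v))"
    using posdef_locally_comparable[OF continuous_on_subset[OF metric_continuous[OF c(1)] V(3)] V(1,2) pd]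
    by blast
  obtain m where m: "m > 0" "\<And>v. m * (v \<bullet> v) \<le> v \<bullet> (g c ?x *v v)"
    using posdef_lower_bound[OF pd] by blast
  \<comment> \<open>The summand 1 keeps \<open>N\<close> positive; the factor 4 is the local
    variation of the metric.\<close>
  define N where "N = 4 * (real CARD('n) * norm (g c ?x) + 1)"
  have N: "N > 0" unfolding N_def by (intro mult_pos_pos add_nonneg_pos) auto
  have up: "v \<bullet> (g c y *v v) \<le> N * (v \<bullet> v)" if "y \<in> cball ?x r" for y v
  proof -
    have "v \<bullet> (g c ?x *v v) \<le> real CARD('n) * norm (g c ?x) * (v \<bullet> v) + v \<bullet> v"
      using quadratic_form_bound[of v "g c ?x"] inner_ge_zero[of v] by linarith
    then show ?thesis using r(3)[OF that, of v] by (simp add: N_def algebra_simps)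
  qed
  have lo: "m / 4 * (v \<bullet> v) \<le> v \<bullet> (g c y *v v)" if "y \<in> cball ?x r" for y v
    using m(2)[of v] r(4)[OF that, of v] by simp
  have "2 * (r / 2) = r" by simp
  then show ?thesis
    using that[of c "r / 2" "m / 4" N] c r(1,2) m(1) N up lo by simp
qed

section \<open>The distance of a connected manifold and the Hopf--Rinow theorem\<close>

lemma curve_length_subpiece:
  assumes "c \<in> A" "\<sigma> C1_differentiable_on {0..1}" "\<sigma> ` {0..1} \<subseteq> chart_img c"
    and st: "0 \<le> s" "s \<le> t" "t \<le> 1"
  shows "curve_length A g (chart_inv c (\<sigma> s)) (chart_inv c (\<sigma> t))
    (integral {s..t} (\<lambda>t. sqrt (vector_derivative \<sigma> (at t) \<bullet> (g c (\<sigma> t) *v vector_derivative \<sigma> (at t)))))"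
proof (cases "s = t")
  \<comment> \<open>The affine substitution below needs a positive scaling factor, so a degenerate
    interval is covered by the trivial curve.\<close>
  case True
  have "\<sigma> t \<in> chart_img c" using assms(3) st by auto
  then show ?thesis using True by (simp add: curve_length.trivial chart_inv_carrier assms(1))
next
  case False
  define m where "m = t - s"
  have m: "m > 0" using False st by (simp add: m_def)
  let ?s = "\<lambda>t. vector_derivative \<sigma> (at t)"
  define F where "F t = sqrt (?s t \<bullet> (g c (\<sigma> t) *v ?s t))" for t
  define \<tau> where "\<tau> u = \<sigma> (m *\<^sub>R u + s)" for u :: real
  have in01: "m *\<^sub>R u + s \<in> {0..1}" if "u \<in> {0..1}" for u
  proof -
    have "m * u \<le> m * 1" "0 \<le> m * u" using that m by (auto intro: mult_left_mono)
    then show ?thesis using st by (simp add: m_def)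
  qed
  have D: "(\<tau> has_vector_derivative m *\<^sub>R ?s (m *\<^sub>R u + s)) (at u)" if "u \<in> {0..1}" for u
  proof -
    have "(\<sigma> has_vector_derivative ?s (m *\<^sub>R u + s)) (at (m *\<^sub>R u + s))"
      using assms(2) in01[OF that] by (auto simp: C1_differentiable_on_eq vector_derivative_works)
    moreover have "((\<lambda>u. m *\<^sub>R u + s) has_vector_derivative m) (at u)"
      by (auto intro!: derivative_eq_intros)
    ultimately have "((\<sigma> \<circ> (\<lambda>u. m *\<^sub>R u + s)) has_vector_derivative m *\<^sub>R ?s (m *\<^sub>R u + s)) (at u)"
      by (rule vector_diff_chain_at[rotated])
    then show ?thesis by (simp add: o_def \<tau>_def[abs_def])
  qed
  have cs: "continuous_on {0..1} ?s" using assms(2) by (simp add: C1_differentiable_on_eq)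
  have "continuous_on {0..1} (\<lambda>u. m *\<^sub>R ?s (m *\<^sub>R u + s))"
    using in01 by (intro continuous_intros continuous_on_compose2[OF cs]) auto
  then have C1: "\<tau> C1_differentiable_on {0..1}"
    using D unfolding C1_differentiable_on_def by (intro exI[of _ "\<lambda>u. m *\<^sub>R ?s (m *\<^sub>R u + s)"]) simp
  have img: "\<tau> ` {0..1} \<subseteq> chart_img c" using in01 assms(3) by (auto simp: \<tau>_def)
  have cF: "continuous_on {0..1} F"
    using coord_length_integrand_continuous[OF assms(1-3)] by (simp add: F_def[abs_def])
  have "(F has_integral integral {s..t} F) (cbox s t)"
    using integrable_integral[OF integrable_continuous_interval[OF continuous_on_subset[OF cF]], of s t] st
    by simp
  from has_integral_affinity'[OF this m, of s]
  have "((\<lambda>u. F (m *\<^sub>R u + s)) has_integral (integral {s..t} F / m)) {0..1}"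
    using m by (simp add: m_def divide_inverse mult.commute)
  then have "((\<lambda>u. m * F (m *\<^sub>R u + s)) has_integral (integral {s..t} F)) {0..1}"
    using has_integral_mult_right[of _ "integral {s..t} F / m" "{0..1}" m] m by simp
  then have "integral {0..1} (\<lambda>u. m * F (m *\<^sub>R u + s)) = integral {s..t} F"
    by (rule integral_unique)
  moreover have "integral {0..1} (\<lambda>u. m * F (m *\<^sub>R u + s)) = coord_length (g c) \<tau>"
    unfolding coord_length_def
  proof (rule integral_cong)
    show "m * F (m *\<^sub>R u + s) =
        sqrt (vector_derivative \<tau> (at u) \<bullet> (g c (\<tau> u) *v vector_derivative \<tau> (at u)))"
      if "u \<in> {0..1}" for u
      unfolding vector_derivative_at[OF D[OF that]] using m
      by (simp add: F_def \<tau>_def matrix_vector_mult_scaleR real_sqrt_mult)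
  qed
  moreover have "\<tau> 0 = \<sigma> s" "\<tau> 1 = \<sigma> t" by (simp_all add: \<tau>_def m_def)
  ultimately show ?thesis
    using curve_length_piece[OF assms(1) C1 img] by (simp add: F_def[abs_def])
qed

text \<open>Takes the place of minimizing geodesics: a curve can be cut at any prescribed length,
  which yields intermediate points for the distance.\<close>

lemma curve_length_split:
  "curve_length A g q r L \<Longrightarrow> 0 \<le> a \<Longrightarrow> a \<le> L \<Longrightarrow>
    \<exists>z. curve_length A g q z a \<and> curve_length A g z r (L - a)"
proof (induction arbitrary: a rule: curve_length.induct)
  case (trivial q)
  then show ?case by (auto intro!: exI[of _ q] curve_length.trivial)
next
  case (append q c \<sigma> L)
  let ?F = "\<lambda>t. sqrt (vector_derivative \<sigma> (at t) \<bullet> (g c (\<sigma> t) *v vector_derivative \<sigma> (at t)))"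
  show ?case
  proof (cases "a \<le> L")
    case True
    then obtain z where z: "curve_length A g q z a" "curve_length A g z (chart_inv c (\<sigma> 0)) (L - a)"
      using append.IH append.prems by blast
    have "curve_length A g z (chart_inv c (\<sigma> 1)) (L - a + coord_length (g c) \<sigma>)"
      by (rule curve_length.append[OF z(2) append.hyps(2-4)])
    then show ?thesis using z(1) by (auto simp: algebra_simps)
  next
    case False
    have int: "?F integrable_on {0..1}"
      by (rule integrable_continuous_interval[OF coord_length_integrand_continuous[OF append.hyps(2-4)]])
    \<comment> \<open>The cut falls into the last piece. Its length function is continuous, hence
      attains the missing amount \<open>a - L\<close>.\<close>
    have "continuous_on {0..1} (\<lambda>t. integral {0..t} ?F)"
      by (rule indefinite_integral_continuous_1[OF int])
    then obtain t where t: "0 \<le> t" "t \<le> 1" "integral {0..t} ?F = a - L"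
      using IVT'[of "\<lambda>t. integral {0..t} ?F" 0 "a - L" 1] False append.prems
      by (auto simp: coord_length_def)
    have "integral {0..t} ?F + integral {t..1} ?F = integral {0..1} ?F"
      using t int by (intro Henstock_Kurzweil_Integration.integral_combine) auto
    then have rest: "integral {t..1} ?F = L + coord_length (g c) \<sigma> - a"
      using t(3) by (simp add: coord_length_def)
    have "curve_length A g (chart_inv c (\<sigma> 0)) (chart_inv c (\<sigma> t)) (a - L)"
      using curve_length_subpiece[OF append.hyps(2-4), of 0 t] t by simp
    from curve_length_trans[OF this append.hyps(1)]
    have "curve_length A g q (chart_inv c (\<sigma> t)) a" by simp
    moreover have "curve_length A g (chart_inv c (\<sigma> t)) (chart_inv c (\<sigma> 1)) (L + coord_length (g c) \<sigma> - a)"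
      using curve_length_subpiece[OF append.hyps(2-4), of t 1] t by (simp add: rest)
    ultimately show ?thesis by blast
  qed
qed

text \<open>Short coordinate segments reach every point of a small coordinate ball. The compact set
  around \<open>V\<close> provides the local compactness for the Hopf-Rinow argument.\<close>

lemma curve_length_near:
  assumes q: "q \<in> carrier A" and "\<epsilon> > 0"
  obtains V where "open V" "q \<in> V" "V \<subseteq> carrier A"
    "\<And>r. r \<in> V \<Longrightarrow> \<exists>L<\<epsilon>. curve_length A g q r L" "\<exists>K. compact K \<and> V \<subseteq> K \<and> K \<subseteq> carrier A"
proof -
  obtain c s m N where c: "c \<in> A" "q \<in> chart_dom c" "s > 0" "N > 0"
    "cball (chart_map c q) (2 * s) \<subseteq> chart_map c ` (chart_dom c \<inter> UNIV)"
    and N: "\<And>y v. y \<in> cball (chart_map c q) (2 * s) \<Longrightarrow> v \<bullet> (g c y *v v) \<le> N * (v \<bullet> v)"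
    by (rule ex_normal_chart[OF q open_UNIV UNIV_I]) blast
  let ?x = "chart_map c q"
  have img: "cball ?x (2 * s) \<subseteq> chart_img c" using c(5) by (simp add: chart_img_def)
  \<comment> \<open>The half makes the final inequality strict, and \<open>s\<close> keeps the
    segments where the bound \<open>N\<close> holds.\<close>
  define \<delta> where "\<delta> = min s (\<epsilon> / (2 * sqrt N))"
  have \<delta>: "\<delta> > 0" "\<delta> \<le> s" "sqrt N * \<delta> < \<epsilon>"
  proof -
    show "\<delta> > 0" "\<delta> \<le> s" using c assms(2) by (auto simp: \<delta>_def)
    have "sqrt N * \<delta> \<le> sqrt N * (\<epsilon> / (2 * sqrt N))"
      using c(4) by (intro mult_left_mono) (auto simp: \<delta>_def)
    also have "\<dots> < \<epsilon>" using c(4) assms(2) by simp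
    finally show "sqrt N * \<delta> < \<epsilon>" .
  qed
  have sub: "ball ?x \<delta> \<subseteq> chart_img c" "cball ?x \<delta> \<subseteq> chart_img c" using img \<delta> c(3) by auto
  show ?thesis
  proof (rule that[of "chart_inv c ` ball ?x \<delta>"])
    show "open (chart_inv c ` ball ?x \<delta>)" by (rule open_chart_inv_image[OF c(1) open_ball sub(1)])
    show "q \<in> chart_inv c ` ball ?x \<delta>"
      using chart_inv_map[OF c(1,2)] \<delta>(1) by (metis centre_in_ball image_eqI)
    show "chart_inv c ` ball ?x \<delta> \<subseteq> carrier A" using sub(1) chart_inv_carrier[OF c(1)] by blast
    show "\<exists>K. compact K \<and> chart_inv c ` ball ?x \<delta> \<subseteq> K \<and> K \<subseteq> carrier A"
      using compact_chart_inv_image[OF c(1) compact_cball sub(2)] sub(2) chart_inv_carrier[OF c(1)]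
      by (intro exI[of _ "chart_inv c ` cball ?x \<delta>"]) auto
    fix r assume "r \<in> chart_inv c ` ball ?x \<delta>"
    then obtain y where y: "y \<in> ball ?x \<delta>" "r = chart_inv c y" by blast
    have seg: "closed_segment ?x y \<subseteq> ball ?x \<delta>"
      using y(1) \<delta>(1) by (intro closed_segment_subset) auto
    have le: "sqrt ((y - ?x) \<bullet> (g c z *v (y - ?x))) \<le> sqrt N * \<delta>" if "z \<in> closed_segment ?x y" for z
    proof -
      have "z \<in> cball ?x (2 * s)" using seg that \<delta> c(3) by fastforce
      then have "sqrt ((y - ?x) \<bullet> (g c z *v (y - ?x))) \<le> sqrt (N * ((y - ?x) \<bullet> (y - ?x)))"
        using N by simp
      also have "\<dots> = sqrt N * norm (y - ?x)" by (simp add: real_sqrt_mult norm_eq_sqrt_inner)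
      also have "\<dots> \<le> sqrt N * \<delta>"
        using y(1) c(4) by (intro mult_left_mono) (auto simp: dist_norm norm_minus_commute)
      finally show ?thesis .
    qed
    obtain L where "L \<le> sqrt N * \<delta>" "curve_length A g (chart_inv c ?x) (chart_inv c y) L"
      by (rule curve_length_segment[OF c(1) subset_trans[OF seg sub(1)] le])
    then show "\<exists>L<\<epsilon>. curve_length A g q r L"
      using \<delta>(3) y(2) chart_inv_map[OF c(1,2)] by (metis le_less_trans)
  qed
qed

lemma ex_bump_in_open:
  assumes "q \<in> carrier A" "open U" "q \<in> U"
  obtains f K where "C1_manifold UNIV f" "grad_bound f K" "f q = 1" "\<And>r. f r \<noteq> 0 \<Longrightarrow> r \<in> U"
proof -
  obtain c s m N where c: "c \<in> A" "q \<in> chart_dom c" "s > 0" "m > 0"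
    "cball (chart_map c q) (2 * s) \<subseteq> chart_map c ` (chart_dom c \<inter> U)"
    and m: "\<And>y v. y \<in> cball (chart_map c q) (2 * s) \<Longrightarrow> m * (v \<bullet> v) \<le> v \<bullet> (g c y *v v)"
    by (rule ex_normal_chart[OF assms]) blast
  let ?f = "bump c (chart_map c q) s"
  have img: "cball (chart_map c q) (2 * s) \<subseteq> chart_img c" using c(5) by (auto simp: chart_img_def)
  obtain K where "grad_bound ?f K" using ex_grad_bound_bump[OF c(1,3) img c(4) m] by blast
  moreover have "?f q = 1" using bump_eq_1[OF c(3,2)] c(3) by simp
  moreover have "r \<in> U" if "?f r \<noteq> 0" for r
  proof -
    have r: "r \<in> chart_dom c" "chart_map c r \<in> cball (chart_map c q) (2 * s)"
      using bump_nonzero[OF c(3) that] by auto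
    then obtain r' where "r' \<in> chart_dom c" "r' \<in> U" "chart_map c r = chart_map c r'" using c(5) by blast
    then show ?thesis using chart_inv_map[OF c(1)] r(1) by metis
  qed
  ultimately show ?thesis using that[of ?f K] bump_C1[OF c(1,3) img] by blast
qed

end

section \<open>The Riemannian distance as a metric\<close>

locale connected_riem = riem +
  assumes connected: "connected (carrier A)"
begin

abbreviation "rdist \<equiv> riemannian_dist A g"

text \<open>The points reachable from \<open>q\<close> form an open set, and so do the others,
  because a short curve back from a reachable neighbour would reach them. Connectedness leaves no
  unreachable point.\<close>

lemma ex_curve:
  assumes q: "q \<in> carrier A" and r: "r \<in> carrier A"
  shows "\<exists>L. curve_length A g q r L"
proof -
  define R where "R = {r. \<exists>L. curve_length A g q r L}"
  have R: "R \<subseteq> carrier A" using curve_length_carrier by (auto simp: R_def)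
  have near: "\<exists>V. open V \<and> t \<in> V \<and> V \<subseteq> carrier A \<and> (\<forall>u\<in>V. \<exists>L. curve_length A g t u L)"
    if "t \<in> carrier A" for t
    using curve_length_near[OF that zero_less_one] by metis
  have "open R"
  proof (subst open_subopen, intro ballI)
    fix t assume t: "t \<in> R"
    then obtain V where V: "open V" "t \<in> V" "\<forall>u\<in>V. \<exists>L. curve_length A g t u L"
      using near R by blast
    then have "V \<subseteq> R" using t curve_length_trans by (fastforce simp: R_def)
    then show "\<exists>T. open T \<and> t \<in> T \<and> T \<subseteq> R" using V by blast
  qed
  moreover have "open (carrier A - R)"
  proof (subst open_subopen, intro ballI)
    fix t assume t: "t \<in> carrier A - R"
    then obtain V where V: "open V" "t \<in> V" "V \<subseteq> carrier A" "\<forall>u\<in>V. \<exists>L. curve_length A g t u L"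
      using near by blast
    have "u \<notin> R" if "u \<in> V" for u
      using that V(4) t curve_length_trans curve_length_sym by (fastforce simp: R_def)
    then show "\<exists>T. open T \<and> t \<in> T \<and> T \<subseteq> carrier A - R" using V by blast
  qed
  moreover have "q \<in> R" using curve_length.trivial[OF q] by (auto simp: R_def)
  ultimately have "carrier A - R = {}"
    using connectedD[OF connected, of R "carrier A - R"] R by blast
  then show ?thesis using r by (auto simp: R_def)
qed

lemma rdist_le: "curve_length A g q r L \<Longrightarrow> rdist q r \<le> L"
  using curve_length_carrier[of q r L] curve_length_nonneg
  unfolding riemannian_dist_def by (auto intro!: cInf_lower bdd_belowI[of _ 0])

text \<open>An infimum over the empty set would be unspecified; \<open>ex_curve\<close> rules this
  out, so near-optimal curves exist.\<close>

lemma rdist_less_iff: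
  assumes "q \<in> carrier A" "r \<in> carrier A"
  shows "rdist q r < e \<longleftrightarrow> (\<exists>L<e. curve_length A g q r L)"
proof -
  have "bdd_below {L. curve_length A g q r L}" using curve_length_nonneg by (auto intro!: bdd_belowI[of _ 0])
  then show ?thesis
    using ex_curve[OF assms] assms by (subst riemannian_dist_def) (auto simp: cInf_less_iff)
qed

lemma rdist_nonneg: "rdist q r \<ge> 0"
  using ex_curve[of q r] curve_length_nonneg
  unfolding riemannian_dist_def by (auto intro!: cInf_greatest)

lemma rdist_lipschitz:
  assumes "C1_manifold UNIV f" "grad_bound f K" "q \<in> carrier A" "r \<in> carrier A"
  shows "\<bar>f r - f q\<bar> \<le> K * rdist q r"
proof -
  have K: "K \<ge> 0" using assms(2) by (simp add: grad_bound_def)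
  have *: "\<bar>f r - f q\<bar> \<le> K * (rdist q r + e)" if e: "e > 0" for e
  proof -
    obtain L where L: "L < rdist q r + e" "curve_length A g q r L"
      using rdist_less_iff[OF assms(3,4), of "rdist q r + e"] e by auto
    have "\<bar>f r - f q\<bar> \<le> K * L" by (rule curve_length_lipschitz[OF assms(1,2) L(2)])
    also have "\<dots> \<le> K * (rdist q r + e)"
      using L(1) K by (intro mult_left_mono) auto
    finally show ?thesis .
  qed
  show ?thesis
  proof (rule field_le_epsilon)
    fix e :: real assume e: "e > 0"
    \<comment> \<open>Dividing by \<open>K + 1\<close> instead of \<open>K\<close> covers the case
      \<open>K = 0\<close>.\<close>
    have "K * (e / (K + 1)) \<le> e" using K e by (simp add: field_simps)
    then show "\<bar>f r - f q\<bar> \<le> K * rdist q r + e"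
      using *[of "e / (K + 1)"] K e by (simp add: distrib_left)
  qed
qed

text \<open>A bump that is 1 at \<open>q\<close> and 0 off \<open>U\<close> changes by 1 along any
  curve that leaves \<open>U\<close>, and its gradient bound makes such curves long. This is the
  source of lower bounds on the distance.\<close>

lemma ex_rdist_ball_in_open:
  assumes "q \<in> carrier A" "open U" "q \<in> U"
  obtains e where "e > 0" "\<And>r. r \<in> carrier A \<Longrightarrow> rdist q r < e \<Longrightarrow> r \<in> U"
proof -
  obtain f K where f: "C1_manifold UNIV f" "grad_bound f K" "f q = 1" "\<And>r. f r \<noteq> 0 \<Longrightarrow> r \<in> U"
    using ex_bump_in_open[OF assms] by blast
  have K: "K \<ge> 0" using f(2) by (simp add: grad_bound_def)
  have "r \<in> U" if r: "r \<in> carrier A" "rdist q r < 1 / (K + 1)" for r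
  proof (rule ccontr)
    assume "r \<notin> U"
    then have "1 \<le> K * rdist q r" using f(3,4) rdist_lipschitz[OF f(1,2) assms(1) r(1)] by force
    also have "\<dots> \<le> K * (1 / (K + 1))" using r(2) K by (intro mult_left_mono) auto
    also have "\<dots> < 1" using K by simp
    finally show False by simp
  qed
  then show ?thesis using that[of "1 / (K + 1)"] K by auto
qed

sublocale dist: Metric_space "carrier A" rdist
proof
  show "0 \<le> rdist q r" for q r by (rule rdist_nonneg)
  show "rdist q r = rdist r q" for q r
  proof -
    have "{L. curve_length A g q r L} = {L. curve_length A g r q L}" using curve_length_sym by blast
    then show ?thesis by (auto simp: riemannian_dist_def)
  qed
  fix q r assume q: "q \<in> carrier A" and r: "r \<in> carrier A"
  show "rdist q r = 0 \<longleftrightarrow> q = r"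
  proof
    assume 0: "rdist q r = 0"
    show "q = r"
    proof (rule ccontr)
      assume "q \<noteq> r"
      then obtain U where "open U" "q \<in> U" "r \<notin> U" using hausdorff[of q r] by blast
      then show False using ex_rdist_ball_in_open[OF q, of U] r 0 by metis
    qed
  next
    assume "q = r"
    then show "rdist q r = 0"
      using rdist_le[OF curve_length.trivial[OF q]] rdist_nonneg[of q q] by simp
  qed
  fix t assume t: "t \<in> carrier A"
  show "rdist q t \<le> rdist q r + rdist r t"
  proof (rule field_le_epsilon)
    fix e :: real assume e: "e > 0"
    obtain L where L: "L < rdist q r + e / 2" "curve_length A g q r L"
      using rdist_less_iff[OF q r, of "rdist q r + e / 2"] e by auto
    obtain L' where L': "L' < rdist r t + e / 2" "curve_length A g r t L'"
      using rdist_less_iff[OF r t, of "rdist r t + e / 2"] e by auto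
    have "rdist q t \<le> L + L'" by (rule rdist_le[OF curve_length_trans[OF L'(2) L(2)]])
    then show "rdist q t \<le> rdist q r + rdist r t + e" using L L' by simp
  qed
qed

text \<open>Bumps place a metric ball in every open set, and short segments place an open set in
  every metric ball. Compactness can then be moved between the metric and the manifold.\<close>

lemma mtopology_eq: "dist.mtopology = top_of_set (carrier A)"
proof (rule topology_eq[THEN iffD2], intro allI)
  fix S
  have "openin (top_of_set (carrier A)) S \<longleftrightarrow> open S \<and> S \<subseteq> carrier A"
    using openin_open_eq[OF open_carrier] by blast
  also have "\<dots> \<longleftrightarrow> openin dist.mtopology S"
  proof (intro iffI conjI)
    assume S: "open S \<and> S \<subseteq> carrier A"
    have "\<exists>r>0. dist.mball q r \<subseteq> S" if q: "q \<in> S" for q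
    proof -
      have "q \<in> carrier A" using S q by blast
      then obtain e where "e > 0" "\<And>r. r \<in> carrier A \<Longrightarrow> rdist q r < e \<Longrightarrow> r \<in> S"
        using ex_rdist_ball_in_open[of q S] S q by metis
      then show ?thesis by (auto intro!: exI[of _ e])
    qed
    then show "openin dist.mtopology S" using S by (auto simp: dist.openin_mtopology)
  next
    assume S: "openin dist.mtopology S"
    then show "S \<subseteq> carrier A" by (simp add: dist.openin_mtopology)
    show "open S"
    proof (subst open_subopen, intro ballI)
      fix q assume q: "q \<in> S"
      then obtain r where r: "r > 0" "dist.mball q r \<subseteq> S" using S by (auto simp: dist.openin_mtopology)
      have qM: "q \<in> carrier A" using q \<open>S \<subseteq> carrier A\<close> by blast
      obtain V where V: "open V" "q \<in> V" "V \<subseteq> carrier A" "\<And>t. t \<in> V \<Longrightarrow> \<exists>L<r. curve_length A g q t L"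
        using curve_length_near[OF qM r(1)] by metis
      have "V \<subseteq> dist.mball q r"
        using V(3,4) qM rdist_less_iff[OF qM] by (auto simp: subset_iff)
      then show "\<exists>T. open T \<and> q \<in> T \<and> T \<subseteq> S" using V r by blast
    qed
  qed
  finally show "openin dist.mtopology S = openin (top_of_set (carrier A)) S" by simp
qed

lemma compactin_mtopology: "compactin dist.mtopology S \<longleftrightarrow> compact S \<and> S \<subseteq> carrier A"
  by (simp add: mtopology_eq compactin_subtopology)

section \<open>The Hopf-Rinow theorem: compactness of closed balls\<close>

lemma rdist_intermediate:
  assumes "q \<in> carrier A" "r \<in> carrier A" "rdist q r < a + b" "a \<ge> 0" "b > 0"
  obtains z where "z \<in> carrier A" "rdist q z \<le> a" "rdist z r < b"
proof -
  obtain L where L: "L < a + b" "curve_length A g q r L" using rdist_less_iff assms(1-3) by blast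
  \<comment> \<open>A curve shorter than \<open>a\<close> is cut at its end, and the remaining
    length is 0.\<close>
  define a' where "a' = min a L"
  have a': "0 \<le> a'" "a' \<le> L" "L - a' < b" "a' \<le> a"
    using L(1) assms(4,5) curve_length_nonneg[OF L(2)] by (auto simp: a'_def)
  obtain z where z: "curve_length A g q z a'" "curve_length A g z r (L - a')"
    using curve_length_split[OF L(2) a'(1,2)] by blast
  show ?thesis
    using that[of z] curve_length_carrier[OF z(1)] rdist_le[OF z(1)] rdist_le[OF z(2)] a' by linarith
qed

text \<open>Closed balls are shown to be totally bounded; the set of admissible radii is closed because a
  ball of radius \<open>r\<close> lies within \<open>\<epsilon>\<close> of the ball of radius \<open>r - \<epsilon>\<close>, and open by local
  compactness.\<close>

lemma compact_mcball:
  assumes complete: "dist.mcomplete" and p0: "p0 \<in> carrier A"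
  shows "compact (dist.mcball p0 R)"
proof -
  \<comment> \<open>Total boundedness is inherited by smaller radii and is accessible through finite
    nets at the limit radius. Completeness turns it into compactness where a finite subcover is
    extracted, and at the end.\<close>
  define P where "P r \<longleftrightarrow> dist.mtotally_bounded (dist.mcball p0 r)" for r
  have mono: "P s" if "P r" "s \<le> r" for r s
    using dist.mtotally_bounded_subset that dist.mcball_subset_concentric unfolding P_def by metis
  have compact: "compact (dist.mcball p0 r)" if "P r" for r
  proof -
    have "compactin dist.mtopology (dist.mtopology closure_of (dist.mcball p0 r))"
      using dist.mtotally_bounded_eq_compact_closure_of[OF complete] that unfolding P_def by blast
    moreover have "dist.mtopology closure_of (dist.mcball p0 r) = dist.mcball p0 r"
      by (intro closure_of_closedin dist.closedin_mcball)
    ultimately show ?thesis using compactin_mtopology by simp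
  qed
  have step: "\<exists>\<delta>>0. P (r + \<delta>)" if Pr: "P r" and r0: "r \<ge> 0" for r
  proof -
    have "\<exists>d>0. dist.mtotally_bounded (dist.mcball q (2 * d))" if q: "q \<in> carrier A" for q
    proof -
      obtain V K where V: "open V" "q \<in> V" "V \<subseteq> K" "compact K" "K \<subseteq> carrier A"
        using curve_length_near[OF q zero_less_one] by metis
      obtain e where e: "e > 0" "\<And>r. r \<in> carrier A \<Longrightarrow> rdist q r < e \<Longrightarrow> r \<in> V"
        using ex_rdist_ball_in_open[OF q V(1,2)] by blast
      have "dist.mtotally_bounded K"
        using V(4,5) by (intro dist.compactin_imp_mtotally_bounded) (simp add: compactin_mtopology)
      moreover have "dist.mcball q (2 * (e / 3)) \<subseteq> K"
      proof
        fix t assume t: "t \<in> dist.mcball q (2 * (e / 3))"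
        then have "t \<in> carrier A" "rdist q t \<le> 2 * (e / 3)" by auto
        moreover from this have "rdist q t < e" using e(1) by simp
        ultimately show "t \<in> K" using e(2) V(3) by blast
      qed
      ultimately have "dist.mtotally_bounded (dist.mcball q (2 * (e / 3)))"
        by (rule dist.mtotally_bounded_subset)
      then show ?thesis using e(1) by (intro exI[of _ "e / 3"]) simp
    qed
    then obtain D where D: "\<And>q. q \<in> carrier A \<Longrightarrow> D q > 0 \<and> dist.mtotally_bounded (dist.mcball q (2 * D q))"
      by metis
    have "compactin dist.mtopology (dist.mcball p0 r)"
      using compact[OF Pr] by (auto simp: compactin_mtopology)
    moreover have "\<And>U. U \<in> (\<lambda>q. dist.mball q (D q)) ` dist.mcball p0 r \<Longrightarrow> openin dist.mtopology U" by auto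
    moreover have "dist.mcball p0 r \<subseteq> \<Union> ((\<lambda>q. dist.mball q (D q)) ` dist.mcball p0 r)"
    proof
      fix t assume t: "t \<in> dist.mcball p0 r"
      then have "t \<in> carrier A" by simp
      then have "t \<in> dist.mball t (D t)" using D by simp
      then show "t \<in> \<Union> ((\<lambda>q. dist.mball q (D q)) ` dist.mcball p0 r)" using t by blast
    qed
    ultimately obtain \<F> where \<F>: "finite \<F>" "\<F> \<subseteq> (\<lambda>q. dist.mball q (D q)) ` dist.mcball p0 r"
      "dist.mcball p0 r \<subseteq> \<Union>\<F>"
      unfolding compactin_def by meson
    then obtain Q where Q: "finite Q" "Q \<subseteq> dist.mcball p0 r" "dist.mcball p0 r \<subseteq> (\<Union>q\<in>Q. dist.mball q (D q))"
      using finite_subset_image[OF \<F>(1,2)] by blast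
    have "p0 \<in> dist.mcball p0 r" using p0 r0 by simp
    then have Qne: "Q \<noteq> {}" using Q(3) by blast
    have QM: "q \<in> carrier A" if "q \<in> Q" for q using Q(2) that by (meson dist.in_mcball subsetD)
    \<comment> \<open>A point at distance below \<open>2 * \<delta>\<close> from one of the balls of
      radius \<open>D q\<close> lies in the ball of radius \<open>2 * D q\<close>. So the finitely
      many doubled balls cover a concentric ball of larger radius.\<close>
    define \<delta> where "\<delta> = Min (D ` Q) / 2"
    have \<delta>: "\<delta> > 0" "\<And>q. q \<in> Q \<Longrightarrow> 2 * \<delta> \<le> D q"
      using Q(1) Qne D QM by (auto simp: \<delta>_def)
    have "dist.mcball p0 (r + \<delta>) \<subseteq> (\<Union>q\<in>Q. dist.mcball q (2 * D q))"
    proof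
      fix t assume t: "t \<in> dist.mcball p0 (r + \<delta>)"
      then have tM: "t \<in> carrier A" and td: "rdist p0 t < r + 2 * \<delta>" using \<delta>(1) by auto
      obtain z where z: "z \<in> carrier A" "rdist p0 z \<le> r" "rdist z t < 2 * \<delta>"
        using rdist_intermediate[OF p0 tM td r0] \<delta>(1) by auto
      then obtain q where q: "q \<in> Q" "rdist q z < D q" using Q(3) p0 by fastforce
      have "rdist q t \<le> rdist q z + rdist z t" using dist.triangle QM[OF q(1)] z(1) tM by blast
      also have "\<dots> \<le> 2 * D q" using q(2) z(3) \<delta>(2)[OF q(1)] by simp
      finally show "t \<in> (\<Union>q\<in>Q. dist.mcball q (2 * D q))" using q(1) QM tM by auto
    qed
    moreover have "dist.mtotally_bounded (\<Union>q\<in>Q. dist.mcball q (2 * D q))"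
      using Q(1) D QM by (intro dist.mtotally_bounded_Union) auto
    ultimately have "P (r + \<delta>)" unfolding P_def using dist.mtotally_bounded_subset by blast
    then show ?thesis using \<delta>(1) by blast
  qed
  have limit: "P r" if below: "\<And>s. 0 \<le> s \<Longrightarrow> s < r \<Longrightarrow> P s" and r: "r > 0" for r
    unfolding P_def dist.mtotally_bounded_def
  proof (intro allI impI)
    fix \<epsilon> :: real assume \<epsilon>: "\<epsilon> > 0"
    \<comment> \<open>A net for radius \<open>s\<close> at scale \<open>\<epsilon> / 2\<close>
      serves radius \<open>r\<close> at scale \<open>\<epsilon>\<close>, as the gap between the
      radii is below \<open>\<epsilon> / 2\<close>. The maximum keeps \<open>s\<close> in the range
      of the assumption.\<close>
    define s where "s = max 0 (r - \<epsilon> / 4)"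
    have s: "0 \<le> s" "s < r" "r < s + \<epsilon> / 2" using \<epsilon> r by (auto simp: s_def)
    obtain K where K: "finite K" "K \<subseteq> dist.mcball p0 s" "dist.mcball p0 s \<subseteq> (\<Union>x\<in>K. dist.mball x (\<epsilon> / 2))"
      using below[OF s(1,2)] half_gt_zero[OF \<epsilon>] unfolding P_def dist.mtotally_bounded_def by metis
    have "dist.mcball p0 r \<subseteq> (\<Union>x\<in>K. dist.mball x \<epsilon>)"
    proof
      fix t assume t: "t \<in> dist.mcball p0 r"
      then have tM: "t \<in> carrier A" and td: "rdist p0 t < s + \<epsilon> / 2" using s(3) by auto
      obtain z where z: "z \<in> carrier A" "rdist p0 z \<le> s" "rdist z t < \<epsilon> / 2"
        using rdist_intermediate[OF p0 tM td s(1)] \<epsilon> by auto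
      then obtain x where x: "x \<in> K" "x \<in> carrier A" "rdist x z < \<epsilon> / 2" using K(3) p0 by fastforce
      have "rdist x t \<le> rdist x z + rdist z t" using dist.triangle x(2) z(1) tM by blast
      then show "t \<in> (\<Union>x\<in>K. dist.mball x \<epsilon>)" using x z(3) tM by force
    qed
    moreover have "K \<subseteq> dist.mcball p0 r"
      using K(2) dist.mcball_subset_concentric[of s r p0] s(2) by (meson less_imp_le subset_trans)
    ultimately show "\<exists>K. finite K \<and> K \<subseteq> dist.mcball p0 r \<and> dist.mcball p0 r \<subseteq> (\<Union>x\<in>K. dist.mball x \<epsilon>)"
      using K(1) by blast
  qed
  have P0: "P 0"
  proof -
    have "dist.mcball p0 0 = {p0}" using p0 dist.zero[OF p0] rdist_nonneg[of p0]
      by (auto simp: dist.mcball_def order_antisym_conv)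
    then show ?thesis using p0 by (simp add: P_def)
  qed
  have "P r" if "r \<ge> 0" for r
  proof (rule ccontr)
    assume r: "\<not> P r"
    define S where "S = {s. 0 \<le> s \<and> P s}"
    have bd: "bdd_above S"
    proof (rule bdd_aboveI[of _ r])
      show "x \<le> r" if "x \<in> S" for x
        using that r mono[of x r] by (rule_tac ccontr) (simp add: S_def)
    qed
    have ne: "0 \<in> S" using P0 by (simp add: S_def)
    define t where "t = Sup S"
    have t0: "t \<ge> 0" unfolding t_def by (rule cSup_upper[OF ne bd])
    have below: "P s" if s: "0 \<le> s" "s < t" for s
    proof -
      obtain u where "u \<in> S" "s < u" using s(2) less_cSup_iff[OF _ bd] ne unfolding t_def by blast
      then show ?thesis using mono by (auto simp: S_def intro: less_imp_le)
    qed
    have "P t"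
    proof (cases "t = 0")
      case True then show ?thesis using P0 by simp
    next
      case False then show ?thesis using limit below t0 by simp
    qed
    then obtain \<delta> where "\<delta> > 0" "P (t + \<delta>)" using step t0 by blast
    \<comment> \<open>The openness step has produced an admissible radius beyond the
      supremum.\<close>
    then have "t + \<delta> \<le> t" unfolding t_def using t0[unfolded t_def] by (intro cSup_upper bd) (simp add: S_def)
    then show False using \<open>\<delta> > 0\<close> by simp
  qed
  then have "P (max R 0)" by simp
  then show ?thesis using mono[of "max R 0" R] compact by simp
qed

end

section \<open>Integration by parts against a Lipschitz function\<close>

text \<open>The Lipschitz function is never differentiated: the derivative of the smooth factor is the limit
  of difference quotients, which a translation moves onto the Lipschitz factor.\<close>

lemma C1_compact_support_bounds:
  fixes Y :: "real^'n::finite \<Rightarrow> real"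
  assumes "C1_on UNIV Y" "compact K" "\<And>x. x \<notin> K \<Longrightarrow> Y x = 0"
  obtains C where "C \<ge> 0" "\<And>x. norm (gradient Y x) \<le> C" "\<And>x y. \<bar>Y x - Y y\<bar> \<le> C * norm (x - y)"
    "\<And>x. x \<notin> K \<Longrightarrow> gradient Y x = 0"
proof -
  have zero: "gradient Y x = 0" if "x \<notin> K" for x
    using gradient_transform[of "- K" x Y "\<lambda>_. 0"] that assms(2,3) gradient_const
    by (simp add: compact_imp_closed open_Compl)
  have "continuous_on K (gradient Y)"
    using C1_on_continuous_gradient[OF assms(1)] continuous_on_subset by blast
  then have "bounded (gradient Y ` K)"
    using assms(2) by (intro compact_imp_bounded compact_continuous_image)
  then obtain C where C: "C > 0" "\<And>x. x \<in> K \<Longrightarrow> norm (gradient Y x) \<le> C"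
    by (auto simp: bounded_pos)
  have bound: "norm (gradient Y x) \<le> C" for x
    using C zero[of x] by (cases "x \<in> K") auto
  have "norm (Y x - Y y) \<le> C * norm (x - y)" for x y
  proof (rule differentiable_bound[of UNIV Y "\<lambda>x v. gradient Y x \<bullet> v"])
    show "(Y has_derivative (\<lambda>v. gradient Y x \<bullet> v)) (at x within UNIV)" for x
      using has_derivative_gradient[OF C1_on_differentiable[OF assms(1)]] by simp
    show "onorm (\<lambda>v. gradient Y x \<bullet> v) \<le> C" for x
    proof (rule onorm_bound)
      show "norm (gradient Y x \<bullet> v) \<le> C * norm v" for v
        using Cauchy_Schwarz_ineq2[of "gradient Y x" v] bound[of x]
        by (simp add: order_trans mult_right_mono)
    qed (use C in simp)
  qed auto
  then show ?thesis using that[of C] C(1) bound zero by simp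
qed

lemma integrable_compact_support:
  fixes F Y :: "real^'n::finite \<Rightarrow> real"
  assumes "continuous_on UNIV Y" "compact K" "\<And>x. x \<notin> K \<Longrightarrow> Y x = 0"
    and "F \<in> borel_measurable borel" "\<And>x. \<bar>F x\<bar> \<le> B"
  shows "integrable lborel (\<lambda>x. F x * Y x)"
proof -
  have "integrable lborel (\<lambda>x. indicator K x *\<^sub>R Y x)"
    using borel_integrable_compact[OF assms(2), of Y] assms(1) continuous_on_subset by blast
  also have "(\<lambda>x. indicator K x *\<^sub>R Y x) = Y" using assms(3) by (auto simp: fun_eq_iff indicator_def)
  finally have "integrable lborel (\<lambda>x. B * Y x)" by simp
  then show ?thesis
  proof (rule Bochner_Integration.integrable_bound)
    show "(\<lambda>x. F x * Y x) \<in> borel_measurable lborel"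
      using assms(4) borel_measurable_continuous_onI[OF assms(1)] by simp
    show "AE x in lborel. norm (F x * Y x) \<le> norm (B * Y x)"
      using assms(5) by (intro AE_I2) (simp add: abs_mult mult_right_mono order_trans[OF _ abs_ge_self])
  qed
qed

lemma weak_directional_derivative:
  fixes Y F :: "real^'n::finite \<Rightarrow> real"
  assumes Y: "C1_on UNIV Y" "compact K" "\<And>x. x \<notin> K \<Longrightarrow> Y x = 0"
    and F: "F \<in> borel_measurable borel" "\<And>x. \<bar>F x\<bar> \<le> B"
  shows "(\<lambda>n. \<integral>x. F x * ((Y (x + (1 / Suc n) *\<^sub>R e) - Y x) * Suc n) \<partial>lborel)
    \<longlonglongrightarrow> (\<integral>x. F x * (gradient Y x \<bullet> e) \<partial>lborel)"
proof -
  obtain C where C: "C \<ge> 0" "\<And>x. norm (gradient Y x) \<le> C" "\<And>x y. \<bar>Y x - Y y\<bar> \<le> C * norm (x - y)"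
    "\<And>x. x \<notin> K \<Longrightarrow> gradient Y x = 0"
    using C1_compact_support_bounds[OF Y] by metis
  have B: "B \<ge> 0" using F(2)[of 0] by linarith
  have cY: "continuous_on UNIV Y" by (rule C1_on_continuous[OF Y(1)])
  have [measurable]: "Y \<in> borel_measurable borel" "F \<in> borel_measurable borel"
    using borel_measurable_continuous_onI[OF cY] F by auto
  have [measurable]: "gradient Y \<in> borel_measurable borel"
    using C1_on_continuous_gradient[OF Y(1)] by (rule borel_measurable_continuous_onI)
  \<comment> \<open>One compact set contains the supports of all translates by
    \<open>h *\<^sub>R e\<close> with \<open>0 \<le> h \<le> 1\<close>, so its indicator can serve
    as dominating function.\<close>
  define K1 where "K1 = {x - t | x t. x \<in> K \<and> t \<in> closed_segment 0 e}"
  have K1: "compact K1" unfolding K1_def by (intro compact_differences Y(2) compact_segment)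
  have out: "Y (x + h *\<^sub>R e) = 0" if "x \<notin> K1" "0 \<le> h" "h \<le> 1" for x h
  proof (rule ccontr)
    assume "Y (x + h *\<^sub>R e) \<noteq> 0"
    then have "x + h *\<^sub>R e \<in> K" using Y(3) by blast
    moreover have "h *\<^sub>R e \<in> closed_segment 0 e" using that by (auto simp: in_segment)
    moreover have "x = (x + h *\<^sub>R e) - h *\<^sub>R e" by simp
    ultimately show False using that(1) unfolding K1_def by blast
  qed
  show ?thesis
  proof (rule integral_dominated_convergence[where w="\<lambda>x. indicator K1 x *\<^sub>R (B * (C * norm e))"])
    show "integrable lborel (\<lambda>x. indicator K1 x *\<^sub>R (B * (C * norm e)))"
      by (rule borel_integrable_compact[OF K1]) simp
    show "AE x in lborel. (\<lambda>n. F x * ((Y (x + (1 / Suc n) *\<^sub>R e) - Y x) * Suc n))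
        \<longlonglongrightarrow> F x * (gradient Y x \<bullet> e)"
    proof (rule AE_I2)
      fix x
      have "(Y has_derivative (\<lambda>v. gradient Y x \<bullet> v)) (at x)"
        by (intro has_derivative_gradient C1_on_differentiable[OF Y(1)]) simp
      moreover have "((\<lambda>t. x + t *\<^sub>R e) has_derivative (\<lambda>t. t *\<^sub>R e)) (at 0)"
        by (auto intro!: derivative_eq_intros)
      ultimately have "((\<lambda>t. Y (x + t *\<^sub>R e)) has_derivative (\<lambda>t. gradient Y x \<bullet> (t *\<^sub>R e))) (at 0)"
        using has_derivative_compose[of "\<lambda>t. x + t *\<^sub>R e" "\<lambda>t. t *\<^sub>R e" 0 UNIV Y "\<lambda>v. gradient Y x \<bullet> v"]
        by simp
      then have "((\<lambda>t. Y (x + t *\<^sub>R e)) has_field_derivative (gradient Y x \<bullet> e)) (at 0)"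
        by (simp add: has_field_derivative_def mult.commute[of _ "gradient Y x \<bullet> e"] inner_scaleR_right)
      then have "((\<lambda>h. (Y (x + h *\<^sub>R e) - Y x) / h) \<longlongrightarrow> gradient Y x \<bullet> e) (at 0)"
        by (simp add: DERIV_def)
      moreover have "filterlim (\<lambda>n. 1 / real (Suc n)) (at 0) sequentially"
        using LIMSEQ_inverse_real_of_nat by (simp add: filterlim_at inverse_eq_divide)
      ultimately have "(\<lambda>n. (Y (x + (1 / real (Suc n)) *\<^sub>R e) - Y x) / (1 / real (Suc n)))
          \<longlonglongrightarrow> gradient Y x \<bullet> e"
        by (rule filterlim_compose)
      then have "(\<lambda>n. (Y (x + (1 / real (Suc n)) *\<^sub>R e) - Y x) * real (Suc n)) \<longlonglongrightarrow> gradient Y x \<bullet> e"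
        by (simp only: divide_divide_eq_right div_by_1)
      then show "(\<lambda>n. F x * ((Y (x + (1 / Suc n) *\<^sub>R e) - Y x) * Suc n)) \<longlonglongrightarrow> F x * (gradient Y x \<bullet> e)"
        by (intro tendsto_mult_left)
    qed
    fix n
    show "AE x in lborel. norm (F x * ((Y (x + (1 / Suc n) *\<^sub>R e) - Y x) * Suc n))
        \<le> indicator K1 x *\<^sub>R (B * (C * norm e))"
    proof (rule AE_I2)
      fix x
      show "norm (F x * ((Y (x + (1 / Suc n) *\<^sub>R e) - Y x) * Suc n)) \<le> indicator K1 x *\<^sub>R (B * (C * norm e))"
      proof (cases "x \<in> K1")
        case True
        have "\<bar>Y (x + (1 / Suc n) *\<^sub>R e) - Y x\<bar> \<le> C * (norm e / Suc n)"
          using C(3)[of "x + (1 / Suc n) *\<^sub>R e" x] by simp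
        then have "\<bar>Y (x + (1 / Suc n) *\<^sub>R e) - Y x\<bar> * Suc n \<le> (C * (norm e / Suc n)) * Suc n"
          by (rule mult_right_mono) simp
        then have "\<bar>Y (x + (1 / Suc n) *\<^sub>R e) - Y x\<bar> * Suc n \<le> C * norm e"
          by (simp del: of_nat_Suc)
        then have "\<bar>F x\<bar> * (\<bar>Y (x + (1 / Suc n) *\<^sub>R e) - Y x\<bar> * Suc n) \<le> B * (C * norm e)"
          by (rule mult_mono[OF F(2) _ B]) simp
        then show ?thesis using True by (simp add: abs_mult del: of_nat_Suc)
      next
        case False
        have "Y (x + (1 / Suc n) *\<^sub>R e) = 0" "Y (x + 0 *\<^sub>R e) = 0" using False by (intro out; simp)+
        then show ?thesis using False by simp
      qed
    qed
  qed measurable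
qed

lemma lborel_integral_translate:
  fixes f :: "real^'n::finite \<Rightarrow> real"
  assumes "f \<in> borel_measurable borel"
  shows "(\<integral>x. f (x + a) \<partial>lborel) = (\<integral>x. f x \<partial>lborel)"
    and "integrable lborel (\<lambda>x. f (x + a)) \<longleftrightarrow> integrable lborel f"
proof -
  have "(\<integral>x. f x \<partial>distr lborel borel ((+) a)) = (\<integral>x. f (a + x) \<partial>lborel)"
    by (rule integral_distr) (use assms in auto)
  then show "(\<integral>x. f (x + a) \<partial>lborel) = (\<integral>x. f x \<partial>lborel)"
    by (simp add: lborel_distr_plus add.commute)
  have "integrable (distr lborel borel ((+) a)) f \<longleftrightarrow> integrable lborel (\<lambda>x. f (a + x))"
    by (rule integrable_distr_eq) (use assms in auto)
  then show "integrable lborel (\<lambda>x. f (x + a)) \<longleftrightarrow> integrable lborel f"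
    by (simp add: lborel_distr_plus add.commute)
qed

text \<open>A difference of squares factors into \<open>l * h\<close> times
  \<open>2 * \<zeta> + l * h\<close>. The first part keeps one factor \<open>\<zeta>\<close>, which
  Young's inequality needs later; the second disappears as \<open>h\<close> tends to 0.
  \<open>T\<close> confines the bound to the place where \<open>\<zeta>\<close> varies.\<close>

lemma lipschitz_square_directional_bound:
  fixes Y \<zeta> :: "real^'n::finite \<Rightarrow> real"
  assumes Y: "C1_on UNIV Y" "compact K" "\<And>x. x \<notin> K \<Longrightarrow> Y x = 0"
    and \<zeta>: "\<zeta> \<in> borel_measurable borel" "\<And>x. 0 \<le> \<zeta> x" "\<And>x. \<zeta> x \<le> 1"
    and lip: "h0 > 0" "l \<ge> 0" "\<And>x h. x \<in> K \<Longrightarrow> 0 < h \<Longrightarrow> h \<le> h0 \<Longrightarrow> \<bar>\<zeta> (x - h *\<^sub>R e) - \<zeta> x\<bar> \<le> l * h"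
    and T: "T \<in> sets borel"
      "\<And>x h. x \<in> K \<Longrightarrow> x \<notin> T \<Longrightarrow> 0 < h \<Longrightarrow> h \<le> h0 \<Longrightarrow> \<zeta> (x - h *\<^sub>R e) = \<zeta> x"
  shows "\<bar>\<integral>x. (\<zeta> x)\<^sup>2 * (gradient Y x \<bullet> e) \<partial>lborel\<bar> \<le> 2 * l * (\<integral>x. indicator T x * \<zeta> x * \<bar>Y x\<bar> \<partial>lborel)"
proof -
  have cY: "continuous_on UNIV Y" by (rule C1_on_continuous[OF Y(1)])
  have [measurable]: "Y \<in> borel_measurable borel" "\<zeta> \<in> borel_measurable borel" "T \<in> sets borel"
    using borel_measurable_continuous_onI[OF cY] \<zeta> T by auto
  define I where "I = (\<integral>x. indicator T x * \<zeta> x * \<bar>Y x\<bar> \<partial>lborel)"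
  define J where "J = (\<integral>x. \<bar>Y x\<bar> \<partial>lborel)"
  have F1: "\<bar>(\<zeta> x)\<^sup>2\<bar> \<le> 1" for x using \<zeta>(2,3) by (simp add: power_le_one)
  have cont: "continuous_on UNIV (\<lambda>x. \<bar>Y x\<bar>)" using cY by (rule continuous_on_rabs)
  have intI: "integrable lborel (\<lambda>x. (indicator T x * \<zeta> x) * \<bar>Y x\<bar>)"
    by (rule integrable_compact_support[OF cont Y(2), where B=1])
      (use Y(3) \<zeta>(2,3) in \<open>auto simp: indicator_def\<close>)
  have intJ: "integrable lborel (\<lambda>x. \<bar>Y x\<bar>)"
    using integrable_compact_support[OF cont Y(2), where B=1 and F="\<lambda>_. 1"] Y(3) by simp
  have lim: "(\<lambda>n. \<integral>x. (\<zeta> x)\<^sup>2 * ((Y (x + (1 / Suc n) *\<^sub>R e) - Y x) * Suc n) \<partial>lborel)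
      \<longlonglongrightarrow> (\<integral>x. (\<zeta> x)\<^sup>2 * (gradient Y x \<bullet> e) \<partial>lborel)"
    by (rule weak_directional_derivative[OF Y _ F1]) measurable
  have est: "\<bar>\<integral>x. (\<zeta> x)\<^sup>2 * ((Y (x + (1 / Suc n) *\<^sub>R e) - Y x) * Suc n) \<partial>lborel\<bar>
      \<le> 2 * l * I + l\<^sup>2 * (1 / Suc n) * J" if n: "1 / real (Suc n) \<le> h0" for n
  proof -
    define h where "h = 1 / real (Suc n)"
    have h: "h > 0" "h \<le> h0" "real (Suc n) = 1 / h" using n by (simp_all add: h_def)
    have i1: "integrable lborel (\<lambda>x. (\<zeta> x)\<^sup>2 * Y x)"
      by (rule integrable_compact_support[OF cY Y(2,3) _ F1]) measurable
    have i3: "integrable lborel (\<lambda>x. (\<zeta> (x - h *\<^sub>R e))\<^sup>2 * Y x)"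
      by (rule integrable_compact_support[OF cY Y(2,3) _ F1]) measurable
    have i2: "integrable lborel (\<lambda>x. (\<zeta> x)\<^sup>2 * Y (x + h *\<^sub>R e))"
      using lborel_integral_translate(2)[of "\<lambda>x. (\<zeta> (x - h *\<^sub>R e))\<^sup>2 * Y x" "h *\<^sub>R e"] i3 by simp
    \<comment> \<open>Translation invariance of Lebesgue measure moves the shift from
      \<open>Y\<close> to \<open>\<zeta>\<close>.\<close>
    have e2: "(\<integral>x. (\<zeta> x)\<^sup>2 * Y (x + h *\<^sub>R e) \<partial>lborel) = (\<integral>x. (\<zeta> (x - h *\<^sub>R e))\<^sup>2 * Y x \<partial>lborel)"
      using lborel_integral_translate(1)[of "\<lambda>x. (\<zeta> (x - h *\<^sub>R e))\<^sup>2 * Y x" "h *\<^sub>R e"] by simp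
    have "(\<integral>x. (\<zeta> x)\<^sup>2 * ((Y (x + h *\<^sub>R e) - Y x) * (1 / h)) \<partial>lborel)
        = (\<integral>x. ((\<zeta> x)\<^sup>2 * Y (x + h *\<^sub>R e) - (\<zeta> x)\<^sup>2 * Y x) / h \<partial>lborel)"
      by (intro Bochner_Integration.integral_cong) (simp_all add: right_diff_distrib diff_divide_distrib)
    also have "\<dots> = ((\<integral>x. (\<zeta> x)\<^sup>2 * Y (x + h *\<^sub>R e) \<partial>lborel) - (\<integral>x. (\<zeta> x)\<^sup>2 * Y x \<partial>lborel)) / h"
      using i1 i2 by simp
    also have "\<dots> = (\<integral>x. ((\<zeta> (x - h *\<^sub>R e))\<^sup>2 * Y x - (\<zeta> x)\<^sup>2 * Y x) / h \<partial>lborel)"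
      unfolding e2 using i1 i3 by simp
    also have "\<bar>\<dots>\<bar> \<le> (\<integral>x. 2 * l * (indicator T x * \<zeta> x * \<bar>Y x\<bar>) + l\<^sup>2 * h * \<bar>Y x\<bar> \<partial>lborel)"
    proof (rule integral_abs_bound_integral)
      show "integrable lborel (\<lambda>x. ((\<zeta> (x - h *\<^sub>R e))\<^sup>2 * Y x - (\<zeta> x)\<^sup>2 * Y x) / h)" using i1 i3 by simp
      show "integrable lborel (\<lambda>x. 2 * l * (indicator T x * \<zeta> x * \<bar>Y x\<bar>) + l\<^sup>2 * h * \<bar>Y x\<bar>)"
        using intI intJ by simp
      fix x
      show "\<bar>((\<zeta> (x - h *\<^sub>R e))\<^sup>2 * Y x - (\<zeta> x)\<^sup>2 * Y x) / h\<bar>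
          \<le> 2 * l * (indicator T x * \<zeta> x * \<bar>Y x\<bar>) + l\<^sup>2 * h * \<bar>Y x\<bar>"
      proof (cases "x \<in> K")
        case False
        then show ?thesis using Y(3) by simp
      next
        case True
        define a where "a = \<zeta> (x - h *\<^sub>R e)"
        define b where "b = \<zeta> x"
        show ?thesis
        proof (cases "x \<in> T")
          case False
          then have "a = b" using T(2)[OF True False h(1,2)] by (simp add: a_def b_def)
          then have "((\<zeta> (x - h *\<^sub>R e))\<^sup>2 * Y x - (\<zeta> x)\<^sup>2 * Y x) / h = 0" by (simp add: a_def b_def)
          moreover have "0 \<le> l\<^sup>2 * h * \<bar>Y x\<bar>" using h(1) by simp
          moreover have "indicat_real T x = 0" using False by simp
          ultimately show ?thesis by (simp only: abs_zero mult_zero_left mult_zero_right add_0)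
        next
          case inT: True
          have d: "\<bar>a - b\<bar> \<le> l * h" using lip(3)[OF True h(1,2)] by (simp add: a_def b_def)
          have b: "0 \<le> b" "0 \<le> a" using \<zeta> by (auto simp: a_def b_def)
          have "a\<^sup>2 - b\<^sup>2 = (a - b) * (a + b)" by (simp add: power2_eq_square algebra_simps)
          then have "\<bar>a\<^sup>2 - b\<^sup>2\<bar> = \<bar>a - b\<bar> * (a + b)" using b by (simp add: abs_mult)
          \<comment> \<open>The sum \<open>a + b\<close> is compared with \<open>2 * b\<close>, so
            that only the unshifted value of the cutoff survives in the limit.\<close>
          also have "\<dots> \<le> (l * h) * (2 * b + l * h)"
            using d b lip(2) h(1) by (intro mult_mono) auto
          finally have "\<bar>a\<^sup>2 - b\<^sup>2\<bar> * \<bar>Y x\<bar> \<le> (l * h) * (2 * b + l * h) * \<bar>Y x\<bar>" by (rule mult_right_mono) simp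
          then have "\<bar>a\<^sup>2 - b\<^sup>2\<bar> * \<bar>Y x\<bar> / h \<le> (l * h) * (2 * b + l * h) * \<bar>Y x\<bar> / h"
            using h(1) by (intro divide_right_mono) auto
          also have "\<dots> = 2 * l * (b * \<bar>Y x\<bar>) + l\<^sup>2 * h * \<bar>Y x\<bar>"
            using h(1) by (simp add: power2_eq_square field_simps)
          finally have "\<bar>a\<^sup>2 - b\<^sup>2\<bar> * \<bar>Y x\<bar> / h \<le> 2 * l * (b * \<bar>Y x\<bar>) + l\<^sup>2 * h * \<bar>Y x\<bar>" .
          moreover have "\<bar>(a\<^sup>2 * Y x - b\<^sup>2 * Y x) / h\<bar> = \<bar>a\<^sup>2 - b\<^sup>2\<bar> * \<bar>Y x\<bar> / h"
            using h(1) by (simp add: abs_mult left_diff_distrib[symmetric])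
          ultimately show ?thesis using inT by (simp add: a_def b_def)
        qed
      qed
    qed
    also have "\<dots> = 2 * l * I + l\<^sup>2 * h * J" unfolding I_def J_def using intI intJ by simp
    finally show ?thesis by (simp add: h_def)
  qed
  have "(\<lambda>n. 2 * l * I + l\<^sup>2 * (1 / real (Suc n)) * J) \<longlonglongrightarrow> 2 * l * I + l\<^sup>2 * 0 * J"
    using LIMSEQ_inverse_real_of_nat by (intro tendsto_intros) (simp add: inverse_eq_divide)
  moreover have "\<forall>\<^sub>F n in sequentially. 1 / real (Suc n) \<le> h0"
    using order_tendstoD(2)[OF LIMSEQ_inverse_real_of_nat lip(1)]
    by eventually_elim (simp add: inverse_eq_divide)
  then have "\<forall>\<^sub>F n in sequentially. \<bar>\<integral>x. (\<zeta> x)\<^sup>2 * ((Y (x + (1 / Suc n) *\<^sub>R e) - Y x) * Suc n) \<partial>lborel\<bar>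
      \<le> 2 * l * I + l\<^sup>2 * (1 / Suc n) * J"
    by eventually_elim (rule est)
  ultimately have "\<bar>\<integral>x. (\<zeta> x)\<^sup>2 * (gradient Y x \<bullet> e) \<partial>lborel\<bar> \<le> 2 * l * I + l\<^sup>2 * 0 * J"
    using tendsto_rabs[OF lim] by (intro tendsto_le[OF trivial_limit_sequentially])
  then show ?thesis by (simp add: I_def)
qed

text \<open>As \<open>E\<close> and \<open>D\<close> are constant, the divergence is the sum of the
  derivatives of the frame components \<open>D *v V\<close> along the columns of \<open>E\<close>.
  Only the variation of \<open>\<zeta>\<close> along these columns and the size of the frame
  components enter, so no comparison of coordinates with the metric spoils the constant.\<close>

lemma lipschitz_square_divergence_bound:
  fixes V :: "real^'n::finite \<Rightarrow> real^'n" and \<zeta> W :: "real^'n \<Rightarrow> real" and E D :: "real^'n^'n"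
  assumes V: "\<And>i. C1_on UNIV (\<lambda>x. V x $ i)" "compact K" "\<And>x. x \<notin> K \<Longrightarrow> V x = 0"
    and ED: "E ** D = mat 1"
    and \<zeta>: "\<zeta> \<in> borel_measurable borel" "\<And>x. 0 \<le> \<zeta> x" "\<And>x. \<zeta> x \<le> 1"
    and lip: "h0 > 0" "l \<ge> 0"
      "\<And>x h k. x \<in> K \<Longrightarrow> 0 < h \<Longrightarrow> h \<le> h0 \<Longrightarrow> \<bar>\<zeta> (x - h *\<^sub>R column k E) - \<zeta> x\<bar> \<le> l * h"
    and T: "T \<in> sets borel"
      "\<And>x h k. x \<in> K \<Longrightarrow> x \<notin> T \<Longrightarrow> 0 < h \<Longrightarrow> h \<le> h0 \<Longrightarrow> \<zeta> (x - h *\<^sub>R column k E) = \<zeta> x"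
    and W: "\<And>x k. x \<in> K \<Longrightarrow> \<bar>(D *v V x) $ k\<bar> \<le> W x" "integrable lborel (\<lambda>x. indicator T x * \<zeta> x * W x)"
      "\<And>x. 0 \<le> W x"
  shows "\<bar>\<integral>x. (\<zeta> x)\<^sup>2 * (\<Sum>i\<in>UNIV. partial i (\<lambda>y. V y $ i) x) \<partial>lborel\<bar>
    \<le> 2 * real CARD('n) * l * (\<integral>x. indicator T x * \<zeta> x * W x \<partial>lborel)"
proof -
  define Y where "Y k x = (D *v V x) $ k" for k x
  have Ysum: "Y k = (\<lambda>x. \<Sum>j\<in>UNIV. D $ k $ j * V x $ j)" for k
    by (auto simp: Y_def matrix_vector_mult_def)
  have YC1: "C1_on UNIV (Y k)" for k
    unfolding Ysum by (intro C1_on_sum C1_on_mult C1_on_const V(1))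
  have Y0: "Y k x = 0" if "x \<notin> K" for k x using V(3)[OF that] by (simp add: Y_def)
  have Vd: "(\<lambda>x. V x $ j) differentiable (at x)" for j x by (rule C1_on_differentiable[OF V(1)]) simp
  have gradY: "gradient (Y k) x = (\<Sum>j\<in>UNIV. D $ k $ j *\<^sub>R gradient (\<lambda>y. V y $ j) x)" for k x
  proof -
    have "gradient (\<lambda>y. D $ k $ j * V y $ j) x = D $ k $ j *\<^sub>R gradient (\<lambda>y. V y $ j) x" for j
      using gradient_mult[of "\<lambda>_. D $ k $ j", OF _ Vd] by (simp add: gradient_const)
    moreover have "(\<lambda>y. D $ k $ j * V y $ j) differentiable (at x)" for j
      using Vd by (intro differentiable_mult) auto
    ultimately show ?thesis unfolding Ysum by (subst gradient_sum) auto
  qed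
  have col: "(\<Sum>k\<in>UNIV. D $ k $ j *\<^sub>R column k E) = axis j 1" for j
  proof -
    have "(\<Sum>k\<in>UNIV. D $ k $ j *\<^sub>R column k E) $ i = (E ** D) $ i $ j" for i
      by (simp add: column_def matrix_matrix_mult_def mult.commute)
    then show ?thesis unfolding ED by (simp add: vec_eq_iff mat_def axis_def)
  qed
  have div: "(\<Sum>i\<in>UNIV. partial i (\<lambda>y. V y $ i) x) = (\<Sum>k\<in>UNIV. gradient (Y k) x \<bullet> column k E)" for x
  proof -
    have "(\<Sum>k\<in>UNIV. gradient (Y k) x \<bullet> column k E)
        = (\<Sum>k\<in>UNIV. \<Sum>j\<in>UNIV. gradient (\<lambda>y. V y $ j) x \<bullet> (D $ k $ j *\<^sub>R column k E))"
      by (simp add: gradY inner_sum_left)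
    also have "\<dots> = (\<Sum>j\<in>UNIV. gradient (\<lambda>y. V y $ j) x \<bullet> (\<Sum>k\<in>UNIV. D $ k $ j *\<^sub>R column k E))"
      by (subst sum.swap) (simp add: inner_sum_right)
    also have "\<dots> = (\<Sum>j\<in>UNIV. partial j (\<lambda>y. V y $ j) x)"
      by (simp add: col inner_axis gradient_def)
    finally show ?thesis by simp
  qed
  have F1: "\<bar>(\<zeta> x)\<^sup>2\<bar> \<le> 1" for x using \<zeta>(2,3) by (simp add: power_le_one)
  have [measurable]: "\<zeta> \<in> borel_measurable borel" "T \<in> sets borel" by fact+
  have int: "integrable lborel (\<lambda>x. (\<zeta> x)\<^sup>2 * (gradient (Y k) x \<bullet> column k E))" for k
  proof (rule integrable_compact_support[OF _ V(2) _ _ F1])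
    show "continuous_on UNIV (\<lambda>x. gradient (Y k) x \<bullet> column k E)"
      by (intro continuous_intros C1_on_continuous_gradient YC1)
    show "gradient (Y k) x \<bullet> column k E = 0" if "x \<notin> K" for x
      using C1_compact_support_bounds[OF YC1 V(2) Y0] that by (metis inner_zero_left)
  qed simp
  have "(\<integral>x. (\<zeta> x)\<^sup>2 * (\<Sum>i\<in>UNIV. partial i (\<lambda>y. V y $ i) x) \<partial>lborel)
      = (\<Sum>k\<in>UNIV. \<integral>x. (\<zeta> x)\<^sup>2 * (gradient (Y k) x \<bullet> column k E) \<partial>lborel)"
    unfolding div sum_distrib_left by (rule Bochner_Integration.integral_sum) (rule int)
  also have "\<bar>\<dots>\<bar> \<le> (\<Sum>k\<in>UNIV. \<bar>\<integral>x. (\<zeta> x)\<^sup>2 * (gradient (Y k) x \<bullet> column k E) \<partial>lborel\<bar>)"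
    by (rule sum_abs)
  also have "\<dots> \<le> (\<Sum>k\<in>(UNIV::'n set). 2 * l * (\<integral>x. indicator T x * \<zeta> x * W x \<partial>lborel))"
  proof (rule sum_mono)
    fix k
    have "\<bar>\<integral>x. (\<zeta> x)\<^sup>2 * (gradient (Y k) x \<bullet> column k E) \<partial>lborel\<bar>
        \<le> 2 * l * (\<integral>x. indicator T x * \<zeta> x * \<bar>Y k x\<bar> \<partial>lborel)"
      by (rule lipschitz_square_directional_bound[OF YC1 V(2) Y0 \<zeta> lip T])
    also have "\<dots> \<le> 2 * l * (\<integral>x. indicator T x * \<zeta> x * W x \<partial>lborel)"
    proof (intro mult_left_mono integral_mono_AE W(2))
      have "continuous_on UNIV (\<lambda>x. \<bar>Y k x\<bar>)" using C1_on_continuous[OF YC1] by (rule continuous_on_rabs)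
      then show "integrable lborel (\<lambda>x. indicator T x * \<zeta> x * \<bar>Y k x\<bar>)"
        by (rule integrable_compact_support[OF _ V(2), where B=1])
          (use Y0 \<zeta>(2,3) in \<open>auto simp: indicator_def\<close>)
      show "AE x in lborel. indicator T x * \<zeta> x * \<bar>Y k x\<bar> \<le> indicator T x * \<zeta> x * W x"
      proof (rule AE_I2)
        fix x
        have "\<bar>Y k x\<bar> \<le> W x" using W(1)[of x k] W(3)[of x] Y0[of x k] by (cases "x \<in> K") (auto simp: Y_def)
        then show "indicator T x * \<zeta> x * \<bar>Y k x\<bar> \<le> indicator T x * \<zeta> x * W x"
          using \<zeta>(2) by (intro mult_left_mono) auto
      qed
    qed (use lip(2) in simp)
    finally show "\<bar>\<integral>x. (\<zeta> x)\<^sup>2 * (gradient (Y k) x \<bullet> column k E) \<partial>lborel\<bar>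
        \<le> 2 * l * (\<integral>x. indicator T x * \<zeta> x * W x \<partial>lborel)" .
  qed
  also have "\<dots> = 2 * real CARD('n) * l * (\<integral>x. indicator T x * \<zeta> x * W x \<partial>lborel)" by simp
  finally show ?thesis .
qed

section \<open>The Riemannian measure in charts\<close>

locale riem_measure = riem A g for A :: "('a::t2_space, 'n::finite) chart set" and g +
  fixes \<mu> :: "'a measure"
  assumes measure: "riemannian_measure A g \<mu>"
begin

lemma sets_mu: "sets \<mu> = sets (restrict_space borel (carrier A))"
  using measure by (simp add: riemannian_measure_def)

lemma space_mu: "space \<mu> = carrier A"
  using sets_eq_imp_space_eq[OF sets_mu] by (simp add: space_restrict_space)

lemma in_sets_mu: "B \<in> sets \<mu> \<longleftrightarrow> B \<subseteq> carrier A \<and> B \<in> sets borel"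
  unfolding sets_mu by (rule sets_restrict_space_iff) (simp add: borel_open open_carrier)

lemma measurable_mu_eq: "measurable \<mu> N = measurable (restrict_space borel (carrier A)) N"
  by (rule measurable_cong_sets[OF sets_mu refl])

lemma continuous_measurable_mu:
  fixes f :: "'a \<Rightarrow> real"
  assumes "continuous_on (carrier A) f" shows "f \<in> borel_measurable \<mu>"
  unfolding measurable_mu_eq by (rule borel_measurable_continuous_on_restrict[OF assms])

definition density_chart :: "('a, 'n) chart \<Rightarrow> real^'n \<Rightarrow> real" where
  "density_chart c x = indicator (chart_img c) x * sqrt (det (g c x))"

lemma density_chart_nonneg: "c \<in> A \<Longrightarrow> density_chart c x \<ge> 0"
  using volume_density_pos[of c x] by (cases "x \<in> chart_img c") (auto simp: density_chart_def)

lemma density_chart_measurable: "c \<in> A \<Longrightarrow> density_chart c \<in> borel_measurable borel"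
  using borel_measurable_continuous_on_indicator[of "chart_img c" "\<lambda>x. sqrt (det (g c x))"]
    C1_on_continuous[OF volume_density_C1] chart_open(2)[of c]
  by (simp add: density_chart_def[abs_def] borel_open)

text \<open>Off the image, \<open>chart_inv c\<close> is unspecified and may lie outside the
  manifold. A fixed point \<open>q0\<close> makes the map measurable into \<open>\<mu>\<close>, and
  \<open>density_chart\<close> vanishes wherever it is used.\<close>

definition chart_inv_total :: "('a, 'n) chart \<Rightarrow> 'a \<Rightarrow> real^'n \<Rightarrow> 'a" where
  "chart_inv_total c q0 x = (if x \<in> chart_img c then chart_inv c x else q0)"

lemma chart_inv_total_measurable:
  assumes "c \<in> A" "q0 \<in> chart_dom c"
  shows "chart_inv_total c q0 \<in> measurable borel \<mu>"
proof (rule measurableI)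
  show "chart_inv_total c q0 x \<in> space \<mu>" for x
    using assms(2) chart_inv_carrier[OF assms(1)] chart_dom_subset[OF assms(1)]
    by (auto simp: chart_inv_total_def space_mu)
  fix B assume "B \<in> sets \<mu>"
  then have B: "B \<in> sets borel" by (simp add: in_sets_mu)
  have img: "chart_img c \<in> sets borel" using chart_open(2)[OF assms(1)] by (rule borel_open)
  have "chart_inv c \<in> borel_measurable (restrict_space borel (chart_img c))"
    by (rule borel_measurable_continuous_on_restrict[OF chart_inv_continuous[OF assms(1)]])
  from measurable_sets[OF this B]
  have "chart_inv c -` B \<inter> chart_img c \<in> sets (restrict_space borel (chart_img c))"
    by (simp add: space_restrict_space)
  then have 1: "chart_inv c -` B \<inter> chart_img c \<in> sets borel"
    using sets_restrict_space_iff[of "chart_img c" borel] img by simp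
  have "chart_inv_total c q0 -` B \<inter> space borel
      = (chart_inv c -` B \<inter> chart_img c) \<union> (if q0 \<in> B then - chart_img c else {})"
    by (auto simp: chart_inv_total_def split: if_splits)
  then show "chart_inv_total c q0 -` B \<inter> space borel \<in> sets borel" using 1 img by auto
qed

text \<open>The defining property of \<open>\<mu>\<close> concerns measures of sets in a chart
  domain. Recast as an equality with an image measure, it yields the change of variables for all
  integrals.\<close>

lemma measure_in_chart:
  assumes c: "c \<in> A" and q0: "q0 \<in> chart_dom c"
  shows "density \<mu> (\<lambda>q. ennreal (indicator (chart_dom c) q)) =
    distr (density lborel (\<lambda>x. ennreal (density_chart c x))) \<mu> (chart_inv_total c q0)"
    (is "?L = ?R")
proof (rule measure_eqI)
  fix B assume "B \<in> sets ?L"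
  then have B: "B \<in> sets \<mu>" by simp
  have D: "chart_dom c \<in> sets \<mu>" "chart_dom c \<in> sets borel"
    using chart_open(1)[OF c] chart_dom_subset[OF c] by (auto simp: in_sets_mu borel_open)
  have DB: "chart_dom c \<inter> B \<in> sets \<mu>" using B D by auto
  have "emeasure ?L B = (\<integral>\<^sup>+q. ennreal (indicator (chart_dom c) q) * indicator B q \<partial>\<mu>)"
    by (intro emeasure_density B) (use D in measurable)
  also have "\<dots> = (\<integral>\<^sup>+q. indicator (chart_dom c \<inter> B) q \<partial>\<mu>)"
    by (intro nn_integral_cong) (simp add: indicator_inter_arith ennreal_indicator)
  also have "\<dots> = emeasure \<mu> (chart_dom c \<inter> B)" by (rule nn_integral_indicator[OF DB])
  also have "\<dots> = (\<integral>\<^sup>+x\<in>chart_map c ` (chart_dom c \<inter> B). ennreal (sqrt (det (g c x))) \<partial>lborel)"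
    using measure c DB unfolding riemannian_measure_def in_sets_mu by (meson Int_lower1)
  also have "\<dots> = (\<integral>\<^sup>+x. ennreal (density_chart c x) * indicator (chart_inv_total c q0 -` B) x \<partial>lborel)"
    unfolding chart_map_image[OF c]
    by (intro nn_integral_cong)
      (auto simp: density_chart_def chart_inv_total_def split: split_indicator)
  also have "\<dots> = emeasure (density lborel (\<lambda>x. ennreal (density_chart c x)))
      (chart_inv_total c q0 -` B \<inter> space lborel)"
    using measurable_sets[OF chart_inv_total_measurable[OF c q0] B] density_chart_measurable[OF c]
    by (subst emeasure_density) auto
  also have "\<dots> = emeasure ?R B"
    using chart_inv_total_measurable[OF c q0] B by (subst emeasure_distr) auto
  finally show "emeasure ?L B = emeasure ?R B" .
qed simp

lemma chart_integral:
  fixes f :: "'a \<Rightarrow> real"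
  assumes c: "c \<in> A" and f: "f \<in> borel_measurable \<mu>"
    and supp: "\<And>q. q \<in> carrier A \<Longrightarrow> q \<notin> chart_dom c \<Longrightarrow> f q = 0"
  shows "integrable \<mu> f \<longleftrightarrow> integrable lborel (\<lambda>x. density_chart c x * f (chart_inv c x))"
    and "(\<integral>q. f q \<partial>\<mu>) = (\<integral>x. density_chart c x * f (chart_inv c x) \<partial>lborel)"
proof -
  have *: "(integrable \<mu> f \<longleftrightarrow> integrable lborel (\<lambda>x. density_chart c x * f (chart_inv c x)))
    \<and> (\<integral>q. f q \<partial>\<mu>) = (\<integral>x. density_chart c x * f (chart_inv c x) \<partial>lborel)"
  proof (cases "chart_dom c = {}")
    \<comment> \<open>An empty chart offers no base point \<open>q0\<close>.\<close>
    case True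
    have "density_chart c = (\<lambda>_. 0)"
      using True by (auto simp: density_chart_def chart_img_def)
    moreover have "f q = 0" if "q \<in> space \<mu>" for q using supp that True by (auto simp: space_mu)
    then have "integrable \<mu> f \<longleftrightarrow> integrable \<mu> (\<lambda>_. 0::real)" "(\<integral>q. f q \<partial>\<mu>) = (\<integral>q. 0 \<partial>\<mu>)"
      using Bochner_Integration.integrable_cong[OF refl, of \<mu> f "\<lambda>_. 0"]
        Bochner_Integration.integral_cong[OF refl, of \<mu> f "\<lambda>_. 0"] by auto
    ultimately show ?thesis by simp
  next
    case False
    then obtain q0 where q0: "q0 \<in> chart_dom c" by blast
    let ?i = "chart_inv_total c q0" and ?d = "density_chart c"
    have D: "chart_dom c \<in> sets \<mu>"
      using chart_open(1)[OF c] chart_dom_subset[OF c] by (auto simp: in_sets_mu borel_open)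
    note [measurable] = f chart_inv_total_measurable[OF c q0] density_chart_measurable[OF c] D
    have pt: "indicator (chart_dom c) q *\<^sub>R f q = f q" if "q \<in> space \<mu>" for q
      using supp that by (auto simp: space_mu split: split_indicator)
    have ptx: "?d x *\<^sub>R f (?i x) = ?d x * f (chart_inv c x)" for x
      by (auto simp: density_chart_def chart_inv_total_def)
    have "integrable \<mu> f \<longleftrightarrow> integrable \<mu> (\<lambda>q. indicator (chart_dom c) q *\<^sub>R f q)"
      by (rule Bochner_Integration.integrable_cong[OF refl]) (simp only: pt)
    also have "\<dots> \<longleftrightarrow> integrable (density \<mu> (\<lambda>q. ennreal (indicator (chart_dom c) q))) f"
      by (subst integrable_density) auto
    also have "\<dots> \<longleftrightarrow> integrable (density lborel (\<lambda>x. ennreal (?d x))) (\<lambda>x. f (?i x))"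
      unfolding measure_in_chart[OF c q0] by (subst integrable_distr_eq) auto
    also have "\<dots> \<longleftrightarrow> integrable lborel (\<lambda>x. ?d x *\<^sub>R f (?i x))"
      using density_chart_nonneg[OF c] by (subst integrable_density) auto
    finally have 1: "integrable \<mu> f \<longleftrightarrow> integrable lborel (\<lambda>x. ?d x * f (chart_inv c x))"
      unfolding ptx .
    have "(\<integral>q. f q \<partial>\<mu>) = (\<integral>q. indicator (chart_dom c) q *\<^sub>R f q \<partial>\<mu>)"
      by (rule Bochner_Integration.integral_cong[OF refl]) (simp only: pt)
    also have "\<dots> = (\<integral>q. f q \<partial>density \<mu> (\<lambda>q. ennreal (indicator (chart_dom c) q)))"
      by (subst integral_density) auto
    also have "\<dots> = (\<integral>x. f (?i x) \<partial>density lborel (\<lambda>x. ennreal (?d x)))"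
      unfolding measure_in_chart[OF c q0] by (subst integral_distr) auto
    also have "\<dots> = (\<integral>x. ?d x *\<^sub>R f (?i x) \<partial>lborel)"
      using density_chart_nonneg[OF c] by (subst integral_density) auto
    finally have 2: "(\<integral>q. f q \<partial>\<mu>) = (\<integral>x. ?d x * f (chart_inv c x) \<partial>lborel)"
      unfolding ptx .
    show ?thesis using 1 2 by blast
  qed
  then show "integrable \<mu> f \<longleftrightarrow> integrable lborel (\<lambda>x. density_chart c x * f (chart_inv c x))"
    "(\<integral>q. f q \<partial>\<mu>) = (\<integral>x. density_chart c x * f (chart_inv c x) \<partial>lborel)" by auto
qed

end

section \<open>The cutoff estimate\<close>

definition Psi :: "real \<Rightarrow> real" where
  "Psi t = t * arctan t - ln (1 + t\<^sup>2) / 2"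

lemma DERIV_Psi: "(Psi has_field_derivative arctan t) (at t)"
proof -
  have pos: "1 + t\<^sup>2 > 0" by (simp add: add_pos_nonneg)
  then show ?thesis
    unfolding Psi_def[abs_def] by (auto intro!: derivative_eq_intros) (simp add: field_simps)
qed

lemma abs_arctan_bounds: "\<bar>arctan t\<bar> \<le> 2" "\<bar>arctan t\<bar> \<le> \<bar>t\<bar>"
proof -
  have "\<bar>arctan t\<bar> < pi / 2" using arctan_bounded[of t] by linarith
  then show "\<bar>arctan t\<bar> \<le> 2" using pi_less_4 by linarith
  have "arctan x \<le> x" if "0 \<le> x" for x using that by (rule arctan_le_self)
  then show "\<bar>arctan t\<bar> \<le> \<bar>t\<bar>" by (metis abs_arctan abs_ge_zero abs_idempotent)
qed

lemma abs_Psi_le: "\<bar>Psi t\<bar> \<le> 2 * \<bar>t\<bar>"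
proof -
  have "norm (Psi t - Psi 0) \<le> 2 * norm (t - 0)"
    by (rule field_differentiable_bound[of UNIV Psi arctan])
      (use abs_arctan_bounds(1) in \<open>auto intro: DERIV_subset[OF DERIV_Psi]\<close>)
  then show ?thesis by (simp add: Psi_def)
qed

text \<open>The 5 is \<open>1 + 2\<^sup>2\<close>: the square of the arctangent is at most
  \<open>t\<^sup>2\<close> for the first summand, and at most \<open>2\<^sup>2\<close> for the
  second.\<close>

lemma arctan_square_bound: "(arctan t)\<^sup>2 * (1 + t\<^sup>2) \<le> 5 * t\<^sup>2"
proof -
  have "(arctan t)\<^sup>2 \<le> 2\<^sup>2" "(arctan t)\<^sup>2 \<le> t\<^sup>2"
    using abs_arctan_bounds[of t] abs_le_square_iff[of "arctan t" 2] abs_le_square_iff[of "arctan t" t]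
    by simp_all
  then have "(arctan t)\<^sup>2 + (arctan t)\<^sup>2 * t\<^sup>2 \<le> t\<^sup>2 + 2\<^sup>2 * t\<^sup>2"
    by (intro add_mono mult_right_mono) auto
  then show ?thesis by (simp add: algebra_simps)
qed

lemma divergence_mult:
  fixes F :: "real^'n::finite \<Rightarrow> real^'n"
  assumes "a differentiable (at x)" "\<And>i. (\<lambda>y. F y $ i) differentiable (at x)"
  shows "(\<Sum>i\<in>UNIV. partial i (\<lambda>y. a y * F y $ i) x) =
    a x * (\<Sum>i\<in>UNIV. partial i (\<lambda>y. F y $ i) x) + gradient a x \<bullet> F x"
proof -
  have "partial i (\<lambda>y. a y * F y $ i) x = a x * partial i (\<lambda>y. F y $ i) x + F x $ i * gradient a x $ i" for i
    using arg_cong[OF gradient_mult[OF assms(1) assms(2)[of i]], of "\<lambda>w. w $ i"]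
    by (simp add: gradient_def)
  then show ?thesis by (simp add: sum.distrib sum_distrib_left inner_vec_def mult.commute)
qed

text \<open>\<open>S\<close> is closed in the whole space and not merely in \<open>U\<close>, so the
  extension vanishes in a neighbourhood of every boundary point of \<open>U\<close>.\<close>

lemma C1_on_extend_zero:
  fixes F :: "'b::real_normed_vector \<Rightarrow> real"
  assumes "open U" "C1_on U F" "closed S" "S \<subseteq> U" "\<And>x. x \<in> U \<Longrightarrow> x \<notin> S \<Longrightarrow> F x = 0"
  shows "C1_on UNIV (\<lambda>x. if x \<in> U then F x else 0)"
proof (rule C1_on_open_Union)
  let ?F = "\<lambda>x. if x \<in> U then F x else 0"
  fix x :: 'b
  show "\<exists>V. open V \<and> x \<in> V \<and> C1_on V ?F"
  proof (cases "x \<in> U")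
    case True
    have "C1_on U ?F" using C1_on_cong[OF assms(1), of F ?F] assms(2) by simp
    then show ?thesis using assms(1) True by blast
  next
    case False
    have op: "open (- S)" using assms(3) by auto
    have "?F y = 0" if "y \<in> - S" for y using assms(5) that by auto
    then have "C1_on (- S) ?F" using C1_on_cong[OF op, of ?F "\<lambda>_. 0"] by simp
    then show ?thesis using op False assms(4) by blast
  qed
qed

context riem
begin

lemma continuous_lift:
  fixes b :: "real^'n \<Rightarrow> real"
  assumes c: "c \<in> A" and b: "continuous_on (chart_img c) b" and K: "compact K" "K \<subseteq> chart_img c"
    and f: "\<And>x. x \<in> chart_img c \<Longrightarrow> f (chart_inv c x) = b x"
      "\<And>q. q \<in> carrier A \<Longrightarrow> q \<notin> chart_inv c ` K \<Longrightarrow> f q = 0"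
  shows "continuous_on (carrier A) f"
proof (rule continuous_at_imp_continuous_on, rule ballI)
  fix q assume q: "q \<in> carrier A"
  show "continuous (at q) f"
  proof (cases "q \<in> chart_dom c")
    case True
    have "continuous_on (chart_dom c) (\<lambda>q. b (chart_map c q))"
      by (intro continuous_on_compose2[OF b chart_map_continuous[OF c]]) (auto simp: chart_map_mem)
    moreover have "b (chart_map c r) = f r" if "r \<in> chart_dom c" for r
      using f(1)[OF chart_map_mem[OF that]] chart_inv_map[OF c that] by simp
    ultimately have "continuous_on (chart_dom c) f" by (metis (mono_tags, lifting) continuous_on_cong)
    then show ?thesis using True chart_open(1)[OF c] by (simp add: continuous_on_eq_continuous_at)
  next
    case False
    let ?U = "carrier A - chart_inv c ` K"
    have "closed (chart_inv c ` K)"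
      using compact_chart_inv_image[OF c K] by (rule compact_imp_closed)
    then have "open ?U" using open_carrier by auto
    moreover have "q \<in> ?U" using q False K(2) chart_inv_mem[OF c] by blast
    moreover have "continuous_on ?U f"
      using f(2) continuous_on_cong[OF refl, of ?U f "\<lambda>_. 0"] by simp
    ultimately show ?thesis by (simp add: continuous_on_eq_continuous_at)
  qed
qed

lemma gradient_locally_const:
  assumes "c \<in> A" "q \<in> chart_dom c" "open V" "q \<in> V" "\<And>r. r \<in> V \<Longrightarrow> f r = k"
  shows "gradient (f \<circ> chart_inv c) (chart_map c q) = 0"
proof -
  let ?U = "chart_map c ` (chart_dom c \<inter> V)"
  have "(f \<circ> chart_inv c) x = k" if "x \<in> ?U" for x
    using that assms(5) by (auto simp: chart_inv_map[OF assms(1)])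
  moreover have "chart_map c q \<in> ?U" using assms(2,4) by blast
  ultimately show ?thesis
    using gradient_transform[OF open_chart_map_image[OF assms(1,3)], of "chart_map c q" "f \<circ> chart_inv c" "\<lambda>_. k"]
      gradient_const by simp
qed

text \<open>The gradient of \<open>f\<close> vanishes in whichever chart \<open>pairing\<close>
  selects. Hence \<open>h\<close> may be arbitrary, which is how the pairing with \<open>v\<close>
  is evaluated at the puncture itself.\<close>

lemma pairing_locally_const:
  assumes "q \<in> carrier A" "open V" "q \<in> V" "\<And>r. r \<in> V \<Longrightarrow> f r = k"
  shows "pairing f h q = 0"
proof -
  obtain c where "c \<in> A" "q \<in> chart_dom c" using assms(1) by (auto simp: carrier_def)
  note c = some_chart[OF this]
  show ?thesis
    unfolding pairing_def chart_pairing_def using gradient_locally_const[OF c assms(2-4)] by simp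
qed

text \<open>Around the point with coordinates \<open>x0\<close>, the columns of \<open>E\<close> form a frame of vectors of length at
  most \<open>2\<close>, whose dual frame \<open>D\<close> is bounded as well.\<close>

definition adapted :: "('a, 'n) chart \<Rightarrow> real^'n \<Rightarrow> real \<Rightarrow> real^'n^'n \<Rightarrow> real^'n^'n \<Rightarrow> bool" where
  "adapted c x0 s E D \<longleftrightarrow> c \<in> A \<and> s > 0 \<and> cball x0 (3 * s) \<subseteq> chart_img c \<and> E ** D = mat 1 \<and>
    (\<forall>y\<in>cball x0 (3 * s). (\<forall>k. sqrt (column k E \<bullet> (g c y *v column k E)) \<le> 2) \<and>
       (\<forall>Y k. \<bar>(D *v Y) $ k\<bar> \<le> 2 * sqrt (Y \<bullet> (g c y *v Y))))"

text \<open>The frame is an Auerbach basis at the centre. Nearby the quadratic forms change by a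
  factor of at most 4, hence lengths by 2. Radius \<open>3 * s\<close> leaves a margin around
  supports of radius \<open>2 * s\<close> for the translations of the difference quotients.\<close>

lemma ex_adapted:
  assumes "q \<in> carrier A" "open U" "q \<in> U"
  obtains c s E D where "q \<in> chart_dom c" "adapted c (chart_map c q) s E D"
    "cball (chart_map c q) (3 * s) \<subseteq> chart_map c ` (chart_dom c \<inter> U)"
proof -
  obtain c where c: "c \<in> A" "q \<in> chart_dom c" using assms(1) by (auto simp: carrier_def)
  let ?V = "chart_map c ` (chart_dom c \<inter> U)" and ?x = "chart_map c q"
  have V: "open ?V" "?x \<in> ?V" "?V \<subseteq> chart_img c"
    using open_chart_map_image[OF c(1) assms(2)] c assms(3) by (auto simp: chart_img_def)
  have pd: "posdef (g c ?x)" using metric_posdef c chart_map_mem by blast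
  obtain r where r: "r > 0" "cball ?x r \<subseteq> ?V"
    "\<And>y v. y \<in> cball ?x r \<Longrightarrow> v \<bullet> (g c y *v v) \<le> 4 * (v \<bullet> (g c ?x *v v))"
    "\<And>y v. y \<in> cball ?x r \<Longrightarrow> v \<bullet> (g c ?x *v v) \<le> 4 * (v \<bullet> (g c y *v v))"
    using posdef_locally_comparable[OF continuous_on_subset[OF metric_continuous[OF c(1)] V(3)] V(1,2) pd]
    by blast
  obtain E D :: "real^'n^'n" where ED: "E ** D = mat 1"
    "\<And>k. column k E \<bullet> (g c ?x *v column k E) \<le> 1"
    "\<And>Y k. \<bar>(D *v Y) $ k\<bar> \<le> sqrt (Y \<bullet> (g c ?x *v Y))"
    using posdef_frame[OF pd] by blast
  have "sqrt (column k E \<bullet> (g c y *v column k E)) \<le> 2" if "y \<in> cball ?x r" for y k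
  proof -
    have "column k E \<bullet> (g c y *v column k E) \<le> 4" using r(3)[OF that, of "column k E"] ED(2)[of k] by linarith
    then have "sqrt (column k E \<bullet> (g c y *v column k E)) \<le> sqrt (2\<^sup>2)" by (intro real_sqrt_le_mono) simp
    then show ?thesis by simp
  qed
  moreover have "\<bar>(D *v Y) $ k\<bar> \<le> 2 * sqrt (Y \<bullet> (g c y *v Y))" if "y \<in> cball ?x r" for y Y k
  proof -
    have "\<bar>(D *v Y) $ k\<bar> \<le> sqrt (4 * (Y \<bullet> (g c y *v Y)))"
      using ED(3)[of Y k] real_sqrt_le_mono[OF r(4)[OF that, of Y]] by (rule order_trans)
    then show ?thesis by (simp add: real_sqrt_mult)
  qed
  moreover have "3 * (r / 3) = r" by simp
  ultimately have "adapted c ?x (r / 3) E D"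
    using c(1) r(1,2) V(3) ED(1) unfolding adapted_def by auto
  then show ?thesis using that[of c "r / 3" E D] c(2) r(2) by simp
qed

end

context connected_riem
begin

lemma rdist_reverse_triangle:
  assumes "p \<in> carrier A" "q \<in> carrier A" "r \<in> carrier A"
  shows "\<bar>rdist p q - rdist p r\<bar> \<le> rdist q r"
  using dist.triangle[of p q r] dist.triangle[of p r q] dist.commute[of q r] assms by simp

lemma continuous_on_rdist:
  assumes p: "p \<in> carrier A" shows "continuous_on (carrier A) (rdist p)"
  unfolding continuous_on_def
proof (intro ballI tendstoI)
  fix q e assume q: "q \<in> carrier A" and e: "(0::real) < e"
  obtain V where V: "open V" "q \<in> V" "V \<subseteq> carrier A" "\<And>r. r \<in> V \<Longrightarrow> \<exists>L<e. curve_length A g q r L"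
    using curve_length_near[OF q e] by metis
  have "dist (rdist p r) (rdist p q) < e" if "r \<in> V" for r
  proof -
    have r: "r \<in> carrier A" using V(3) that by blast
    then have "rdist q r < e" using V(4)[OF that] rdist_less_iff[OF q] by blast
    then show ?thesis using rdist_reverse_triangle[OF p q r] by (simp add: dist_real_def abs_minus_commute)
  qed
  then show "\<forall>\<^sub>F r in at q within carrier A. dist (rdist p r) (rdist p q) < e"
    unfolding eventually_at_topological using V(1,2) by blast
qed

end

section \<open>Lipschitz cutoffs at infinity and the estimate in one chart\<close>

locale liouville_base = connected_riem A g + riem_measure A g \<mu>
  for A :: "('a::t2_space, 'n::finite) chart set" and g and \<mu> +
  fixes p :: 'a
  assumes p: "p \<in> carrier A"
begin

definition zeta :: "real \<Rightarrow> 'a \<Rightarrow> real" where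
  "zeta R q = max 0 (min 1 (2 - rdist p q / R))"

text \<open>\<open>zeta R\<close> equals 1 up to distance \<open>R\<close>. With threshold
  \<open>R / 2\<close>, points outside this set can be moved a little without leaving the region
  where the cutoff is constant.\<close>

definition far :: "real \<Rightarrow> 'a set" where
  "far R = {q \<in> carrier A. R / 2 < rdist p q}"

lemma zeta_bounds: "0 \<le> zeta R q" "zeta R q \<le> 1"
  by (auto simp: zeta_def)

lemma zeta_eq_1: "R > 0 \<Longrightarrow> rdist p q \<le> R \<Longrightarrow> zeta R q = 1"
  by (simp add: zeta_def)

lemma zeta_nonzero: "R > 0 \<Longrightarrow> zeta R q \<noteq> 0 \<Longrightarrow> rdist p q \<le> 2 * R"
  by (auto simp: zeta_def max_def min_def divide_simps split: if_splits)

lemma zeta_lipschitz: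
  assumes "R > 0" "q \<in> carrier A" "r \<in> carrier A"
  shows "\<bar>zeta R q - zeta R r\<bar> \<le> rdist q r / R"
proof -
  have "\<bar>zeta R q - zeta R r\<bar> \<le> \<bar>rdist p q / R - rdist p r / R\<bar>"
    unfolding zeta_def by (auto simp: max_def min_def abs_if)
  also have "\<dots> = \<bar>rdist p q - rdist p r\<bar> / R"
    using assms(1) by (simp add: diff_divide_distrib[symmetric])
  also have "\<dots> \<le> rdist q r / R"
    using rdist_reverse_triangle[OF p assms(2,3)] assms(1) by (intro divide_right_mono) auto
  finally show ?thesis .
qed

lemma continuous_on_zeta: "continuous_on (carrier A) (zeta R)"
  unfolding zeta_def divide_inverse by (intro continuous_intros continuous_on_rdist p)

lemma zeta_measurable: "zeta R \<in> borel_measurable \<mu>"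
  by (rule continuous_measurable_mu[OF continuous_on_zeta])

lemma rdist_measurable: "rdist p \<in> borel_measurable \<mu>"
  by (rule continuous_measurable_mu[OF continuous_on_rdist[OF p]])

lemma far_measurable: "far R \<in> sets \<mu>"
proof -
  have "{q \<in> space \<mu>. R / 2 < rdist p q} \<in> sets \<mu>" using rdist_measurable by measurable
  then show ?thesis by (simp add: far_def space_mu)
qed

lemma chart_zeta_measurable:
  assumes "c \<in> A"
  shows "(\<lambda>x. indicator (chart_img c) x * zeta R (chart_inv c x)) \<in> borel_measurable borel"
proof -
  have "continuous_on (chart_img c) (\<lambda>x. zeta R (chart_inv c x))"
    by (intro continuous_on_compose2[OF continuous_on_zeta chart_inv_continuous[OF assms]])
      (auto simp: chart_inv_carrier[OF assms])
  then show ?thesis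
    using borel_measurable_continuous_on_indicator[of "chart_img c" "\<lambda>x. zeta R (chart_inv c x)"]
      chart_open(2)[OF assms] by (simp add: borel_open)
qed

lemma chart_far_borel:
  assumes "c \<in> A" shows "chart_img c \<inter> chart_inv c -` far R \<in> sets borel"
proof -
  have "continuous_on (chart_img c) (\<lambda>x. rdist p (chart_inv c x))"
    by (intro continuous_on_compose2[OF continuous_on_rdist[OF p] chart_inv_continuous[OF assms]])
      (auto simp: chart_inv_carrier[OF assms])
  from continuous_open_preimage[OF this chart_open(2)[OF assms] open_greaterThan[of "R / 2"]]
  have "open (chart_img c \<inter> (\<lambda>x. rdist p (chart_inv c x)) -` {R / 2<..})" .
  moreover have "chart_img c \<inter> (\<lambda>x. rdist p (chart_inv c x)) -` {R / 2<..}
      = chart_img c \<inter> chart_inv c -` far R"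
    using chart_inv_carrier[OF assms] by (auto simp: far_def)
  ultimately show ?thesis by (simp add: borel_open)
qed

text \<open>Here \<open>V / sqrt (det g)\<close> are the coordinates of a vector field; \<open>h\<close> is its divergence and \<open>f\<close> its
  length.\<close>

lemma chart_field_estimate:
  assumes ad: "adapted c x0 s E D" and R: "R > 0"
    and V: "\<And>i. C1_on UNIV (\<lambda>x. V x $ i)" "\<And>x. x \<notin> cball x0 (2 * s) \<Longrightarrow> V x = 0"
    and h: "\<And>x. x \<in> chart_img c \<Longrightarrow>
        sqrt (det (g c x)) * h (chart_inv c x) = (\<Sum>i\<in>UNIV. partial i (\<lambda>y. V y $ i) x)"
      "\<And>q. q \<in> carrier A \<Longrightarrow> q \<notin> chart_inv c ` cball x0 (2 * s) \<Longrightarrow> h q = 0"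
    and f: "f \<in> borel_measurable \<mu>"
      "\<And>q. q \<in> carrier A \<Longrightarrow> q \<notin> chart_inv c ` cball x0 (2 * s) \<Longrightarrow> f q = 0"
      "\<And>x. x \<in> cball x0 (2 * s) \<Longrightarrow> chart_inv c x \<in> far R \<Longrightarrow>
        sqrt (V x \<bullet> (g c x *v V x)) = sqrt (det (g c x)) * f (chart_inv c x)"
  shows "integrable \<mu> (\<lambda>q. (zeta R q)\<^sup>2 * h q)"
    and "integrable \<mu> (\<lambda>q. indicator (far R) q * zeta R q * f q)"
    and "\<bar>\<integral>q. (zeta R q)\<^sup>2 * h q \<partial>\<mu>\<bar>
      \<le> 8 * real CARD('n) / R * (\<integral>q. indicator (far R) q * zeta R q * f q \<partial>\<mu>)"
proof -
  have c: "c \<in> A" and s: "s > 0" and img: "cball x0 (3 * s) \<subseteq> chart_img c" and ED: "E ** D = mat 1"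
    and frame: "\<And>y k. y \<in> cball x0 (3 * s) \<Longrightarrow> sqrt (column k E \<bullet> (g c y *v column k E)) \<le> 2"
      "\<And>y Y k. y \<in> cball x0 (3 * s) \<Longrightarrow> \<bar>(D *v Y) $ k\<bar> \<le> 2 * sqrt (Y \<bullet> (g c y *v Y))"
    using ad unfolding adapted_def by auto
  let ?K = "cball x0 (2 * s)"
  have K3: "?K \<subseteq> cball x0 (3 * s)" using s by auto
  have K: "?K \<subseteq> chart_img c" using K3 img by blast
  define dv where "dv x = (\<Sum>i\<in>UNIV. partial i (\<lambda>y. V y $ i) x)" for x
  define z where "z x = indicator (chart_img c) x * zeta R (chart_inv c x)" for x
  define T where "T = chart_img c \<inter> chart_inv c -` far R"
  have zm: "z \<in> borel_measurable borel" unfolding z_def by (rule chart_zeta_measurable[OF c])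
  have Tm: "T \<in> sets borel" unfolding T_def by (rule chart_far_borel[OF c])
  have zb: "0 \<le> z x" "z x \<le> 1" for x
    using zeta_bounds by (auto simp: z_def split: split_indicator)
  have z2: "\<bar>(z x)\<^sup>2\<bar> \<le> 1" for x using zb[of x] by (simp add: power_le_one)
  have pV: "partial i (\<lambda>y. V y $ i) = (\<lambda>x. frechet_derivative (\<lambda>y. V y $ i) (at x) (axis i 1))" for i
    by (simp add: partial_def fun_eq_iff)
  have dv_cont: "continuous_on UNIV dv"
    unfolding dv_def pV by (intro continuous_on_sum C1_on_continuous_derivative V(1))
  have dv0: "dv x = 0" if "x \<notin> ?K" for x
  proof -
    have "partial i (\<lambda>y. V y $ i) x = partial i (\<lambda>_. 0) x" for i
      unfolding partial_def using that V(2)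
      by (subst frechet_derivative_transform[of "- ?K" x _ "\<lambda>_. 0"]) auto
    then show ?thesis by (simp add: dv_def partial_def)
  qed
  have hm: "h \<in> borel_measurable \<mu>"
  proof (rule continuous_measurable_mu, rule continuous_lift[OF c _ compact_cball K _ h(2)])
    show "continuous_on (chart_img c) (\<lambda>x. dv x / sqrt (det (g c x)))"
      using volume_density_pos[OF c]
      by (intro continuous_on_divide continuous_on_subset[OF dv_cont] C1_on_continuous volume_density_C1 c)
        (auto simp: less_imp_neq[THEN not_sym])
    show "h (chart_inv c x) = dv x / sqrt (det (g c x))" if "x \<in> chart_img c" for x
      using h(1)[OF that] volume_density_pos[OF c that] by (simp add: dv_def field_simps)
  qed
  have supp: "q \<notin> chart_inv c ` ?K" if "q \<in> carrier A" "q \<notin> chart_dom c" for q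
    using that K chart_inv_mem[OF c] by blast
  have zh: "density_chart c x * ((zeta R (chart_inv c x))\<^sup>2 * h (chart_inv c x)) = (z x)\<^sup>2 * dv x" for x
  proof (cases "x \<in> chart_img c")
    case True
    then have "density_chart c x * h (chart_inv c x) = dv x" "z x = zeta R (chart_inv c x)"
      using h(1) by (simp_all add: density_chart_def dv_def z_def)
    then show ?thesis by (simp add: mult.left_commute)
  next
    case False
    then have "x \<notin> ?K" using K by blast
    then show ?thesis using dv0[of x] False by (simp add: density_chart_def)
  qed
  have m1: "(\<lambda>q. (zeta R q)\<^sup>2 * h q) \<in> borel_measurable \<mu>" using zeta_measurable hm by measurable
  have m2: "(\<lambda>q. indicator (far R) q * zeta R q * f q) \<in> borel_measurable \<mu>"
    using zeta_measurable f(1) far_measurable by measurable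
  have int1: "integrable lborel (\<lambda>x. (z x)\<^sup>2 * dv x)"
    by (rule integrable_compact_support[OF dv_cont compact_cball dv0 _ z2]) (use zm in measurable)
  show "integrable \<mu> (\<lambda>q. (zeta R q)\<^sup>2 * h q)"
    using chart_integral(1)[OF c m1] h(2) supp int1 by (simp add: zh)
  have I1: "(\<integral>q. (zeta R q)\<^sup>2 * h q \<partial>\<mu>) = (\<integral>x. (z x)\<^sup>2 * dv x \<partial>lborel)"
    using chart_integral(2)[OF c m1] h(2) supp by (simp add: zh)
  \<comment> \<open>The factor 2 is the bound of \<open>adapted\<close> on the dual frame.\<close>
  define W where "W x = indicator ?K x * (2 * sqrt (V x \<bullet> (g c x *v V x)))" for x
  have zf: "density_chart c x * (indicator (far R) (chart_inv c x) * zeta R (chart_inv c x) * f (chart_inv c x))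
      = (indicator T x * z x * W x) / 2" for x
  proof (cases "x \<in> T")
    case True
    then have xi: "x \<in> chart_img c" "chart_inv c x \<in> far R" by (auto simp: T_def)
    show ?thesis
    proof (cases "x \<in> ?K")
      case True
      then show ?thesis using f(3)[OF True xi(2)] \<open>x \<in> T\<close> xi
        by (simp add: density_chart_def W_def z_def mult_ac)
    next
      case False
      have "chart_inv c x \<notin> chart_inv c ` ?K"
      proof
        assume "chart_inv c x \<in> chart_inv c ` ?K"
        then obtain y where y: "y \<in> ?K" "chart_inv c x = chart_inv c y" by blast
        then have "y \<in> chart_img c" using K by blast
        then have "x = y" using chart_map_inv[OF c, of y] chart_map_inv[OF c xi(1)] y(2) by simp
        then show False using False y(1) by simp
      qed
      then have "f (chart_inv c x) = 0" using f(2) chart_inv_carrier[OF c xi(1)] by blast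
      then show ?thesis using False by (simp add: W_def)
    qed
  next
    case False
    then show ?thesis by (auto simp: T_def density_chart_def split: split_indicator)
  qed
  have Vc: "continuous_on UNIV (\<lambda>x. V x $ i)" for i by (rule C1_on_continuous[OF V(1)])
  have gc: "continuous_on ?K (\<lambda>x. g c x $ i $ j)" for i j
    using continuous_on_subset[OF C1_on_continuous[OF metric_component_C1[OF c]] K] .
  have "continuous_on ?K (\<lambda>x. 2 * sqrt (V x \<bullet> (g c x *v V x)))"
    unfolding inner_vec_def matrix_vector_mult_def vec_lambda_beta inner_real_def
    by (intro continuous_on_mult continuous_on_const continuous_on_real_sqrt continuous_on_sum gc
        continuous_on_subset[OF Vc]) auto
  from borel_integrable_compact[OF compact_cball this]
  have Wint: "integrable lborel W" by (simp add: W_def[abs_def])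
  have W0: "0 \<le> W x" for x
  proof (cases "x \<in> ?K")
    case True
    then have "0 \<le> V x \<bullet> (g c x *v V x)" using K by (intro posdef_nonneg metric_posdef[OF c]) blast
    then show ?thesis by (simp add: W_def)
  qed (simp add: W_def)
  have int2: "integrable lborel (\<lambda>x. indicator T x * z x * W x)"
  proof (rule Bochner_Integration.integrable_bound[OF Wint])
    show "(\<lambda>x. indicator T x * z x * W x) \<in> borel_measurable lborel"
      using zm Tm borel_measurable_integrable[OF Wint] by measurable
    show "AE x in lborel. norm (indicator T x * z x * W x) \<le> norm (W x)"
    proof (rule AE_I2)
      fix x
      have "\<bar>indicator T x * z x\<bar> \<le> 1" using zb[of x] by (simp split: split_indicator)
      then have "\<bar>indicator T x * z x\<bar> * \<bar>W x\<bar> \<le> 1 * \<bar>W x\<bar>" by (rule mult_right_mono) simp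
      then show "norm (indicator T x * z x * W x) \<le> norm (W x)" by (simp only: abs_mult real_norm_def mult_1)
    qed
  qed
  show "integrable \<mu> (\<lambda>q. indicator (far R) q * zeta R q * f q)"
    using chart_integral(1)[OF c m2] f(2) supp int2 by (simp add: zf)
  have I2: "(\<integral>q. indicator (far R) q * zeta R q * f q \<partial>\<mu>) = (\<integral>x. indicator T x * z x * W x \<partial>lborel) / 2"
    using chart_integral(2)[OF c m2] f(2) supp by (simp add: zf)
  define B where "B = 1 + (\<Sum>k\<in>UNIV. norm (column k E))"
  have B: "B > 0" "norm (column k E) \<le> B" for k
  proof -
    show "B > 0" unfolding B_def by (intro add_pos_nonneg sum_nonneg) auto
    have "norm (column k E) \<le> (\<Sum>k\<in>UNIV. norm (column k E))" by (rule member_le_sum) auto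
    then show "norm (column k E) \<le> B" by (simp add: B_def)
  qed
  \<comment> \<open>Steps along the frame move by a distance of at most \<open>2 * t\<close>. The
    bound \<open>R / 4\<close> keeps points outside \<open>far R\<close> within distance
    \<open>R\<close> of \<open>p\<close>, and \<open>s / B\<close> keeps translates in the ball of
    radius \<open>3 * s\<close>.\<close>
  define h0 where "h0 = min (R / 4) (s / B)"
  have h0: "h0 > 0" using R s B by (simp add: h0_def)
  have step: "rdist (chart_inv c x) (chart_inv c (x - t *\<^sub>R column k E)) \<le> 2 * t"
    "x - t *\<^sub>R column k E \<in> chart_img c"
    if x: "x \<in> ?K" and t: "0 < t" "t \<le> h0" for x t k
  proof -
    let ?y = "x - t *\<^sub>R column k E"
    have "norm (t *\<^sub>R column k E) \<le> (s / B) * B"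
      using t B(2)[of k] s by (simp only: norm_scaleR) (intro mult_mono, auto simp: h0_def)
    then have "norm (t *\<^sub>R column k E) \<le> s" using B(1) by simp
    then have "dist x ?y \<le> s" by (simp add: dist_norm)
    then have "?y \<in> cball x0 (3 * s)" using x dist_triangle[of x0 ?y x] by simp
    moreover have "x \<in> cball x0 (3 * s)" using x K3 by blast
    ultimately have seg: "closed_segment x ?y \<subseteq> cball x0 (3 * s)"
      by (intro closed_segment_subset) auto
    have le: "sqrt ((?y - x) \<bullet> (g c w *v (?y - x))) \<le> 2 * t" if "w \<in> closed_segment x ?y" for w
    proof -
      have "?y - x = (- t) *\<^sub>R column k E" by simp
      then have "(?y - x) \<bullet> (g c w *v (?y - x)) = t\<^sup>2 * (column k E \<bullet> (g c w *v column k E))"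
        by (simp only: matrix_vector_mult_scaleR) (simp add: power2_eq_square)
      then have "sqrt ((?y - x) \<bullet> (g c w *v (?y - x))) = t * sqrt (column k E \<bullet> (g c w *v column k E))"
        using t(1) by (simp add: real_sqrt_mult)
      also have "\<dots> \<le> t * 2" using frame(1)[of w k] seg that t(1) by (intro mult_left_mono) auto
      finally show ?thesis by simp
    qed
    obtain L where L: "L \<le> 2 * t" "curve_length A g (chart_inv c x) (chart_inv c ?y) L"
      by (rule curve_length_segment[OF c subset_trans[OF seg img] le])
    then show "rdist (chart_inv c x) (chart_inv c ?y) \<le> 2 * t" using rdist_le[OF L(2)] by linarith
    show "?y \<in> chart_img c" using \<open>?y \<in> cball x0 (3 * s)\<close> img by blast
  qed
  \<comment> \<open>The Lipschitz constant is \<open>2 / R\<close>, as the frame vectors have length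
    at most 2. With the prefactor \<open>2 * CARD('n)\<close> and the 2 in \<open>W\<close> this
    gives the constant \<open>8 * CARD('n) / R\<close>.\<close>
  have "\<bar>\<integral>x. (z x)\<^sup>2 * (\<Sum>i\<in>UNIV. partial i (\<lambda>y. V y $ i) x) \<partial>lborel\<bar>
      \<le> 2 * real CARD('n) * (2 / R) * (\<integral>x. indicator T x * z x * W x \<partial>lborel)"
  proof (rule lipschitz_square_divergence_bound[OF V(1) compact_cball V(2) ED zm zb h0 _ _ Tm _ _ int2 W0])
    show "0 \<le> 2 / R" using R by simp
    fix x t k assume x: "x \<in> ?K" and t: "0 < t" "t \<le> h0"
    let ?y = "x - t *\<^sub>R column k E"
    have xi: "x \<in> chart_img c" "?y \<in> chart_img c" using x K step(2)[OF x t] by auto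
    note car = chart_inv_carrier[OF c xi(1)] chart_inv_carrier[OF c xi(2)]
    have d: "rdist (chart_inv c x) (chart_inv c ?y) \<le> 2 * t" by (rule step(1)[OF x t])
    have "\<bar>zeta R (chart_inv c x) - zeta R (chart_inv c ?y)\<bar> \<le> rdist (chart_inv c x) (chart_inv c ?y) / R"
      by (rule zeta_lipschitz[OF R car])
    also have "\<dots> \<le> 2 * t / R" using d R by (intro divide_right_mono) auto
    finally show "\<bar>z ?y - z x\<bar> \<le> 2 / R * t" using xi by (simp add: z_def abs_minus_commute)
    assume "x \<notin> T"
    then have r1: "rdist p (chart_inv c x) \<le> R / 2" using xi car by (auto simp: T_def far_def)
    have "rdist p (chart_inv c ?y) \<le> R / 2 + 2 * t"
      using dist.triangle[OF p car] r1 d by linarith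
    also have "\<dots> \<le> R" using t(2) by (simp add: h0_def)
    finally have "rdist p (chart_inv c ?y) \<le> R" .
    then show "z ?y = z x" using r1 R xi by (simp add: z_def zeta_eq_1)
  next
    fix x k assume x: "x \<in> ?K"
    then show "\<bar>(D *v V x) $ k\<bar> \<le> W x" using frame(2)[of x "V x" k] K3 by (auto simp: W_def)
  qed
  then show "\<bar>\<integral>q. (zeta R q)\<^sup>2 * h q \<partial>\<mu>\<bar>
      \<le> 8 * real CARD('n) / R * (\<integral>q. indicator (far R) q * zeta R q * f q \<partial>\<mu>)"
    unfolding I1 I2 by (simp add: dv_def mult_ac)
qed

end

section \<open>Harmonic functions on the punctured manifold\<close>

locale liouville = liouville_base A g \<mu> p
  for A :: "('a::t2_space, 'n::finite) chart set" and g and \<mu> and p +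
  fixes u :: "'a \<Rightarrow> real"
  assumes harmonic: "harmonic_on_manifold A g (carrier A - {p}) u"
begin

abbreviation "N \<equiv> carrier A - {p}"

lemma open_N: "open N"
  using open_carrier by auto

abbreviation Om :: "('a, 'n) chart \<Rightarrow> (real^'n) set" where
  "Om c \<equiv> chart_map c ` (chart_dom c \<inter> N)"

lemma Om_iff: "c \<in> A \<Longrightarrow> x \<in> Om c \<longleftrightarrow> x \<in> chart_img c \<and> chart_inv c x \<noteq> p"
  using chart_map_image[of c N] chart_inv_carrier[of c x] by auto

lemma open_Om: "c \<in> A \<Longrightarrow> open (Om c)"
  by (rule open_chart_map_image[OF _ open_N])

lemma u_C2: "c \<in> A \<Longrightarrow> Ck_on 2 (Om c) (u \<circ> chart_inv c)"
  using harmonic by (simp add: harmonic_on_manifold_def)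

lemma u_C1: "C1_manifold N u"
  unfolding C1_manifold_def using u_C2 Ck2_imp_C1 by blast

definition v :: "'a \<Rightarrow> real" where "v q = Psi (u q)"

lemma v_C1: "C1_manifold N v"
  unfolding C1_manifold_def v_def comp_def
  by (intro ballI C1_on_real_compose[where h = Psi and h' = arctan])
    (use u_C1 in \<open>auto simp: C1_manifold_def comp_def intro!: DERIV_Psi continuous_on_arctan continuous_on_id\<close>)

text \<open>The metric gradient of \<open>u\<close> weighted by the volume density: harmonicity says
  that its Euclidean divergence is 0.\<close>

definition flux :: "('a, 'n) chart \<Rightarrow> real^'n \<Rightarrow> real^'n" where
  "flux c y = sqrt (det (g c y)) *\<^sub>R (matrix_inv (g c y) *v gradient (u \<circ> chart_inv c) y)"

lemma C1_on_weighted_grad: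
  assumes c: "c \<in> A" and "U \<subseteq> chart_img c" and e: "\<And>j. C1_on U (\<lambda>y. gradient e y $ j)"
  shows "C1_on U (\<lambda>y. (sqrt (det (g c y)) *\<^sub>R (matrix_inv (g c y) *v gradient e y)) $ i)"
proof -
  have "(\<lambda>y. (sqrt (det (g c y)) *\<^sub>R (matrix_inv (g c y) *v gradient e y)) $ i)
      = (\<lambda>y. sqrt (det (g c y)) * (\<Sum>j\<in>UNIV. matrix_inv (g c y) $ i $ j * gradient e y $ j))"
    by (simp add: fun_eq_iff matrix_vector_mult_def)
  then show ?thesis
    using C1_on_subset[OF volume_density_C1[OF c] assms(2)] C1_on_subset[OF inverse_metric_C1[OF c] assms(2)]
    by (simp only:) (intro C1_on_mult C1_on_sum e; assumption)
qed

lemma Om_subset: "c \<in> A \<Longrightarrow> Om c \<subseteq> chart_img c"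
  by (auto simp: chart_img_def)

lemma flux_C1: "c \<in> A \<Longrightarrow> C1_on (Om c) (\<lambda>y. flux c y $ i)"
  unfolding flux_def
proof (rule C1_on_weighted_grad[OF _ Om_subset])
  fix j assume "c \<in> A"
  then show "C1_on (Om c) (\<lambda>y. gradient (u \<circ> chart_inv c) y $ j)"
    using C1_on_partial[OF u_C2, of c j] by (simp add: gradient_def)
qed auto

lemma flux_divergence:
  assumes "c \<in> A" "x \<in> Om c"
  shows "(\<Sum>i\<in>UNIV. partial i (\<lambda>y. flux c y $ i) x) = 0"
proof -
  obtain q where q: "q \<in> chart_dom c \<inter> N" "x = chart_map c q" using assms(2) by blast
  have "laplacian g c u q = 0" using harmonic assms(1) q(1) by (simp add: harmonic_on_manifold_def)
  moreover have "x \<in> chart_img c" using assms Om_subset by blast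
  then have "sqrt (det (g c x)) \<noteq> 0" using volume_density_pos[OF assms(1), of x] by simp
  ultimately have "(\<Sum>i\<in>UNIV. partial i (\<lambda>y. sqrt (det (g c y)) * grad (g c) (u \<circ> chart_inv c) y $ i) x) = 0"
    using q(2) by (simp add: laplacian_def divergence_def)
  then show ?thesis by (simp add: flux_def grad_def gradient_def)
qed

lemma pairing_u_u_chart:
  assumes "c \<in> A" "x \<in> Om c"
  shows "pairing u u (chart_inv c x) = gradient (u \<circ> chart_inv c) x \<bullet>
    (matrix_inv (g c x) *v gradient (u \<circ> chart_inv c) x)"
proof -
  have x: "x \<in> chart_img c" "chart_inv c x \<in> N" using assms Om_iff chart_inv_carrier by auto
  show ?thesis
    using pairing_eq[OF assms(1) chart_inv_mem[OF assms(1) x(1)] u_C1 u_C1 x(2,2)]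
    by (simp add: chart_pairing_def chart_map_inv[OF assms(1) x(1)])
qed

lemma gradient_v_chart:
  assumes "c \<in> A" "x \<in> Om c"
  shows "gradient (v \<circ> chart_inv c) x = arctan (u (chart_inv c x)) *\<^sub>R gradient (u \<circ> chart_inv c) x"
proof -
  have "(u \<circ> chart_inv c) differentiable (at x)"
    by (rule C1_on_differentiable[OF Ck2_imp_C1[OF u_C2[OF assms(1)]] assms(2)])
  from gradient_compose[OF this DERIV_Psi] show ?thesis by (simp add: v_def comp_def)
qed

lemma pairing_v_chart:
  assumes "c \<in> A" "x \<in> Om c" "C1_manifold UNIV \<theta>"
  shows "pairing \<theta> v (chart_inv c x) = arctan (u (chart_inv c x)) *
    (gradient (\<theta> \<circ> chart_inv c) x \<bullet> (matrix_inv (g c x) *v gradient (u \<circ> chart_inv c) x))"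
proof -
  have x: "x \<in> chart_img c" "chart_inv c x \<in> N" using assms Om_iff chart_inv_carrier by auto
  show ?thesis
    using pairing_eq[OF assms(1) chart_inv_mem[OF assms(1) x(1)] assms(3) v_C1 UNIV_I x(2)]
    by (simp add: chart_pairing_def chart_map_inv[OF assms(1) x(1)] gradient_v_chart[OF assms(1,2)]
        matrix_vector_mult_scaleR)
qed

text \<open>This is \<open>div grad v\<close>: harmonicity of \<open>u\<close> leaves the second
  derivative of \<open>Psi\<close> at \<open>u\<close> times the squared length of grad u. The
  indicator fixes the value at \<open>p\<close>.\<close>

definition w :: "'a \<Rightarrow> real" where
  "w q = indicator N q * (pairing u u q / (1 + (u q)\<^sup>2))"

text \<open>The length of grad v, as the derivative of \<open>Psi\<close> is the arctangent.\<close>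

definition nv :: "'a \<Rightarrow> real" where
  "nv q = indicator N q * (\<bar>arctan (u q)\<bar> * sqrt (pairing u u q))"

lemma pairing_u_u_nonneg: "q \<in> N \<Longrightarrow> pairing u u q \<ge> 0"
proof -
  assume q: "q \<in> N"
  then obtain c where c: "c \<in> A" "q \<in> chart_dom c" by (auto simp: carrier_def)
  then have "chart_map c q \<in> Om c" using q by blast
  then show ?thesis
    using pairing_u_u_chart[OF c(1), of "chart_map c q"] chart_inv_map[OF c]
      posdef_inv_nonneg[OF metric_posdef[OF c(1) chart_map_mem[OF c(2)]]] by simp
qed

lemma w_nonneg: "w q \<ge> 0"
  using pairing_u_u_nonneg[of q] by (simp add: w_def split: split_indicator)

lemma continuous_u: "continuous_on N u"
  using C1_manifold_continuous[OF u_C1 open_N] by (simp add: Int_absorb1)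

lemma continuous_pairing_u_u: "continuous_on N (pairing u u)"
proof -
  have "continuous_on (carrier A \<inter> N) (pairing u u)"
  proof (rule continuous_in_charts[OF open_N])
    fix c assume c: "c \<in> A"
    have "continuous_on (Om c) (\<lambda>x. gradient (u \<circ> chart_inv c) x $ i)" for i
      by (intro continuous_on_component C1_on_continuous_gradient Ck2_imp_C1 u_C2 c)
    moreover have "continuous_on (Om c) (\<lambda>x. matrix_inv (g c x) $ i $ j)" for i j
      by (rule continuous_on_subset[OF C1_on_continuous[OF inverse_metric_C1[OF c]] Om_subset[OF c]])
    ultimately have "continuous_on (Om c) (\<lambda>x. gradient (u \<circ> chart_inv c) x \<bullet>
        (matrix_inv (g c x) *v gradient (u \<circ> chart_inv c) x))"
      unfolding inner_vec_def matrix_vector_mult_def vec_lambda_beta inner_real_def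
      by (intro continuous_on_sum continuous_on_mult)
    moreover have "(pairing u u \<circ> chart_inv c) x = gradient (u \<circ> chart_inv c) x \<bullet>
        (matrix_inv (g c x) *v gradient (u \<circ> chart_inv c) x)" if "x \<in> Om c" for x
      using pairing_u_u_chart[OF c that] by simp
    ultimately show "continuous_on (Om c) (pairing u u \<circ> chart_inv c)"
      by (metis (mono_tags, lifting) continuous_on_cong)
  qed
  then show ?thesis by (simp add: Int_absorb1)
qed

lemma indicator_measurable_mu:
  fixes f :: "'a \<Rightarrow> real"
  assumes "continuous_on N f" shows "(\<lambda>q. indicator N q * f q) \<in> borel_measurable \<mu>"
proof -
  have "(\<lambda>q. indicator N q * f q) \<in> borel_measurable borel"
    using borel_measurable_continuous_on_indicator[OF borel_open[OF open_N] assms] by simp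
  then show ?thesis unfolding measurable_mu_eq by (rule measurable_restrict_space1)
qed

lemma continuous_w: "continuous_on N (\<lambda>q. pairing u u q / (1 + (u q)\<^sup>2))"
proof (intro continuous_intros continuous_pairing_u_u continuous_u ballI)
  show "1 + (u q)\<^sup>2 \<noteq> 0" for q using zero_le_power2[of "u q"] by linarith
qed

lemma nv_measurable: "nv \<in> borel_measurable \<mu>"
  unfolding nv_def
  by (rule indicator_measurable_mu) (intro continuous_intros continuous_pairing_u_u continuous_u)

text \<open>The estimate for the field \<open>\<theta> (e grad v - v grad e)\<close>, where \<open>e\<close> is a cutoff at the
  puncture given in the chart and \<open>H\<close> is the coordinate form of its gradient.\<close>

lemma piece_estimate:
  assumes ad: "adapted c x0 s E D" and R: "R > 0"
    and \<theta>: "C1_manifold UNIV \<theta>" "\<And>q. \<theta> q \<ge> 0"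
      "\<And>q. \<theta> q \<noteq> 0 \<Longrightarrow> q \<in> chart_dom c \<and> chart_map c q \<in> cball x0 (2 * s)"
    and e: "C1_on (chart_img c) e" "\<And>i. C1_on (chart_img c) (\<lambda>y. H y $ i)"
      "\<And>y. H y = sqrt (det (g c y)) *\<^sub>R (matrix_inv (g c y) *v gradient e y)"
    and S: "open S" "p \<in> S"
      "\<And>x. x \<in> chart_img c \<Longrightarrow> chart_inv c x \<in> S \<Longrightarrow> \<theta> (chart_inv c x) * e x = 0 \<and> \<theta> (chart_inv c x) *\<^sub>R H x = 0"
    and sep: "\<And>x. x \<in> chart_img c \<Longrightarrow>
      gradient (\<theta> \<circ> chart_inv c) x = 0 \<or> (e x = 1 \<and> gradient e x = 0)"
    and far: "\<And>x. x \<in> cball x0 (2 * s) \<Longrightarrow> chart_inv c x \<in> far R \<Longrightarrow> e x = 1 \<and> H x = 0"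
    and h: "\<And>x. x \<in> Om c \<Longrightarrow> h (chart_inv c x) = \<theta> (chart_inv c x) * e x * w (chart_inv c x)
        + pairing \<theta> v (chart_inv c x)
        - \<theta> (chart_inv c x) * v (chart_inv c x) * ((\<Sum>i\<in>UNIV. partial i (\<lambda>y. H y $ i) x) / sqrt (det (g c x)))"
      "\<And>q. q \<in> carrier A \<Longrightarrow> q \<notin> chart_inv c ` cball x0 (2 * s) \<Longrightarrow> h q = 0" "h p = 0"
  shows "integrable \<mu> (\<lambda>q. (zeta R q)\<^sup>2 * h q)"
    and "integrable \<mu> (\<lambda>q. indicator (far R) q * zeta R q * (\<theta> q * nv q))"
    and "\<bar>\<integral>q. (zeta R q)\<^sup>2 * h q \<partial>\<mu>\<bar>
      \<le> 8 * real CARD('n) / R * (\<integral>q. indicator (far R) q * zeta R q * (\<theta> q * nv q) \<partial>\<mu>)"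
proof -
  have c: "c \<in> A" and s: "s > 0" and img3: "cball x0 (3 * s) \<subseteq> chart_img c"
    using ad unfolding adapted_def by auto
  let ?K = "cball x0 (2 * s)"
  have "?K \<subseteq> cball x0 (3 * s)" using s by auto
  then have K: "?K \<subseteq> chart_img c" using img3 by blast
  let ?u = "u \<circ> chart_inv c" and ?t = "\<theta> \<circ> chart_inv c" and ?v = "v \<circ> chart_inv c"
  \<comment> \<open>Since grad v is \<open>arctan u\<close> times grad u, the terms
    \<open>a *\<^sub>R flux c\<close> and \<open>b *\<^sub>R H\<close> are the density times
    \<open>\<theta> e grad v\<close> and \<open>\<theta> v grad e\<close>.\<close>
  define a where "a x = ?t x * e x * arctan (?u x)" for x
  define b where "b x = ?t x * ?v x" for x
  define F where "F x = a x *\<^sub>R flux c x - b x *\<^sub>R H x" for x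
  define V where "V x = (if x \<in> Om c then F x else 0)" for x
  have "C1_on (chart_img c) ?t" using \<theta>(1) c by (auto simp: C1_manifold_def chart_img_def)
  from C1_on_subset[OF this Om_subset[OF c]] have tC: "C1_on (Om c) ?t" .
  have uC: "C1_on (Om c) ?u" by (rule Ck2_imp_C1[OF u_C2[OF c]])
  have vC: "C1_on (Om c) ?v" using v_C1 c by (auto simp: C1_manifold_def)
  have eC: "C1_on (Om c) e" "\<And>i. C1_on (Om c) (\<lambda>y. H y $ i)"
    by (rule C1_on_subset[OF e(1) Om_subset[OF c]], rule C1_on_subset[OF e(2) Om_subset[OF c]])
  have inv1: "1 + (t::real)\<^sup>2 \<noteq> 0" for t using zero_le_power2[of t] by linarith
  have atC: "C1_on (Om c) (\<lambda>x. arctan (?u x))"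
    by (rule C1_on_real_compose[OF uC, where h' = "\<lambda>t. inverse (1 + t\<^sup>2)"])
      (auto intro!: DERIV_arctan continuous_intros simp: inv1)
  have aC: "C1_on (Om c) a" unfolding a_def by (intro C1_on_mult tC eC atC)
  have bC: "C1_on (Om c) b" unfolding b_def by (intro C1_on_mult tC vC)
  \<comment> \<open>A neighbourhood of the puncture on which both coefficients vanish is removed
    from the ball. What remains is closed, avoids the puncture and contains the support of the
    field.\<close>
  define Z where "Z = ?K - chart_map c ` (chart_dom c \<inter> S)"
  have cZ: "closed Z" unfolding Z_def using open_chart_map_image[OF c S(1)] by auto
  have ZOm: "Z \<subseteq> Om c"
  proof
    fix x assume "x \<in> Z"
    then have "x \<in> chart_img c" "chart_inv c x \<notin> S"
      using K unfolding Z_def chart_map_image[OF c] by auto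
    then show "x \<in> Om c" using S(2) by (auto simp: Om_iff[OF c])
  qed
  have F0: "F x = 0" if "x \<in> Om c" "x \<notin> Z" for x
  proof -
    have x: "x \<in> chart_img c" using that(1) Om_iff[OF c] by blast
    have "?t x * e x = 0 \<and> ?t x *\<^sub>R H x = 0"
    proof (cases "x \<in> ?K")
      case True
      then have "chart_inv c x \<in> S" using that(2) x unfolding Z_def chart_map_image[OF c] by blast
      then show ?thesis using S(3)[OF x] by simp
    next
      case False
      then have "?t x = 0" using \<theta>(3)[of "chart_inv c x"] chart_map_inv[OF c x] by auto
      then show ?thesis by simp
    qed
    then show ?thesis by (auto simp: F_def a_def b_def)
  qed
  have VC: "C1_on UNIV (\<lambda>x. V x $ i)" for i
  proof -
    have "C1_on (Om c) (\<lambda>x. F x $ i)"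
      unfolding F_def vector_minus_component vector_scaleR_component real_scaleR_def
      by (intro C1_on_diff C1_on_mult aC bC flux_C1[OF c] eC)
    from C1_on_extend_zero[OF open_Om[OF c] this cZ ZOm] F0
    have "C1_on UNIV (\<lambda>x. if x \<in> Om c then F x $ i else 0)" by simp
    moreover have "(\<lambda>x. V x $ i) = (\<lambda>x. if x \<in> Om c then F x $ i else 0)"
      by (auto simp: V_def)
    ultimately show ?thesis by simp
  qed
  have V0: "V x = 0" if "x \<notin> Z" for x using F0 that by (simp add: V_def)
  have ZK: "Z \<subseteq> ?K" by (auto simp: Z_def)
  have dV0: "(\<Sum>i\<in>UNIV. partial i (\<lambda>y. V y $ i) x) = 0" if "x \<notin> Z" for x
  proof -
    have "partial i (\<lambda>y. V y $ i) x = partial i (\<lambda>_. 0) x" for i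
      unfolding partial_def using that V0 cZ
      by (subst frechet_derivative_transform[of "- Z" x _ "\<lambda>_. 0"]) auto
    then show ?thesis by (simp add: partial_def)
  qed
  have main: "sqrt (det (g c x)) * h (chart_inv c x) = (\<Sum>i\<in>UNIV. partial i (\<lambda>y. V y $ i) x)"
    if x: "x \<in> chart_img c" for x
  proof (cases "x \<in> Om c")
    case False
    then have "chart_inv c x = p" using x Om_iff[OF c] by blast
    then show ?thesis using h(3) dV0[of x] False ZOm by auto
  next
    case True
    let ?d = "sqrt (det (g c x))" and ?G = "matrix_inv (g c x)"
    let ?gu = "gradient ?u x" and ?gt = "gradient ?t x" and ?ge = "gradient e x"
    have pd: "posdef (g c x)" by (rule metric_posdef[OF c x])
    have df: "?u differentiable (at x)" "?t differentiable (at x)" "e differentiable (at x)"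
      "a differentiable (at x)" "b differentiable (at x)" "?v differentiable (at x)"
      "(\<lambda>x. arctan (?u x)) differentiable (at x)"
      by (rule C1_on_differentiable[OF _ True]; fact)+
    have dFl: "(\<lambda>y. flux c y $ i) differentiable (at x)" "(\<lambda>y. H y $ i) differentiable (at x)" for i
      by (rule C1_on_differentiable[OF flux_C1[OF c] True], rule C1_on_differentiable[OF eC(2) True])
    have "partial i (\<lambda>y. V y $ i) x = partial i (\<lambda>y. a y * flux c y $ i) x - partial i (\<lambda>y. b y * H y $ i) x" for i
    proof -
      have "partial i (\<lambda>y. V y $ i) x = partial i (\<lambda>y. a y * flux c y $ i - b y * H y $ i) x"
        unfolding partial_def
        by (subst frechet_derivative_transform[OF open_Om[OF c] True, of _ "\<lambda>y. a y * flux c y $ i - b y * H y $ i"])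
          (auto simp: V_def F_def)
      also have "\<dots> = partial i (\<lambda>y. a y * flux c y $ i) x - partial i (\<lambda>y. b y * H y $ i) x"
      proof -
        have "(\<lambda>y. a y * flux c y $ i) differentiable (at x)" "(\<lambda>y. b y * H y $ i) differentiable (at x)"
          using df dFl by (auto intro: differentiable_mult)
        from has_derivative_diff[OF this[unfolded frechet_derivative_works]]
        show ?thesis unfolding partial_def by (subst frechet_derivative_at[symmetric]) auto
      qed
      finally show ?thesis .
    qed
    then have "(\<Sum>i\<in>UNIV. partial i (\<lambda>y. V y $ i) x)
        = (\<Sum>i\<in>UNIV. partial i (\<lambda>y. a y * flux c y $ i) x) - (\<Sum>i\<in>UNIV. partial i (\<lambda>y. b y * H y $ i) x)"
      by (simp add: sum_subtractf)
    also have "\<dots> = gradient a x \<bullet> flux c x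
        - (b x * (\<Sum>i\<in>UNIV. partial i (\<lambda>y. H y $ i) x) + gradient b x \<bullet> H x)"
      using divergence_mult[OF df(4) dFl(1)] divergence_mult[OF df(5) dFl(2)] flux_divergence[OF c True]
      by simp
    finally have dV: "(\<Sum>i\<in>UNIV. partial i (\<lambda>y. V y $ i) x) = gradient a x \<bullet> flux c x
        - (b x * (\<Sum>i\<in>UNIV. partial i (\<lambda>y. H y $ i) x) + gradient b x \<bullet> H x)" .
    have gat: "gradient (\<lambda>x. arctan (?u x)) x = inverse (1 + (?u x)\<^sup>2) *\<^sub>R ?gu"
      by (rule gradient_compose[OF df(1) DERIV_arctan])
    have te: "(\<lambda>x. ?t x * e x) differentiable (at x)" using df(2,3) by (rule differentiable_mult)
    have ga: "gradient a x = (?t x * e x) *\<^sub>R (inverse (1 + (?u x)\<^sup>2) *\<^sub>R ?gu)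
        + arctan (?u x) *\<^sub>R (?t x *\<^sub>R ?ge + e x *\<^sub>R ?gt)"
      unfolding a_def using gradient_mult[OF te df(7)] gradient_mult[OF df(2,3)] gat by simp
    have gb: "gradient b x = ?t x *\<^sub>R (arctan (?u x) *\<^sub>R ?gu) + ?v x *\<^sub>R ?gt"
      unfolding b_def using gradient_mult[OF df(2,6)] gradient_v_chart[OF c True] by simp
    have w: "w (chart_inv c x) = (?gu \<bullet> (?G *v ?gu)) * inverse (1 + (?u x)\<^sup>2)"
      using pairing_u_u_chart[OF c True] True Om_iff[OF c] chart_inv_carrier[OF c x]
      by (simp add: w_def divide_inverse)
    \<comment> \<open>The mixed terms in grad e and grad u cancel by symmetry of the inverse metric;
      the field is antisymmetric for this purpose.\<close>
    have sym: "?ge \<bullet> (?G *v ?gu) = ?gu \<bullet> (?G *v ?ge)" by (rule posdef_inv_symmetric[OF pd])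
    have "gradient a x \<bullet> flux c x - gradient b x \<bullet> H x
      = ?d * (?t x * e x * w (chart_inv c x)
        + (e x * (arctan (?u x) * (?gt \<bullet> (?G *v ?gu))) - ?v x * (?gt \<bullet> (?G *v ?ge))))"
      unfolding ga gb w flux_def e(3) by (simp add: inner_add_left sym algebra_simps)
    also have "e x * (arctan (?u x) * (?gt \<bullet> (?G *v ?gu))) - ?v x * (?gt \<bullet> (?G *v ?ge))
        = pairing \<theta> v (chart_inv c x)"
      \<comment> \<open>Either grad \<theta> is 0 and all terms vanish, or \<open>e = 1\<close> with
        gradient 0 and only the pairing of \<open>\<theta>\<close> with \<open>v\<close> is
        left.\<close>
      using sep[OF x] pairing_v_chart[OF c True \<theta>(1)] by auto
    finally have step: "gradient a x \<bullet> flux c x - gradient b x \<bullet> H x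
      = ?d * (?t x * e x * w (chart_inv c x) + pairing \<theta> v (chart_inv c x))" .
    have dpos: "?d > 0" by (rule volume_density_pos[OF c x])
    have "?d * h (chart_inv c x) = ?d * (?t x * e x * w (chart_inv c x) + pairing \<theta> v (chart_inv c x))
        - b x * (\<Sum>i\<in>UNIV. partial i (\<lambda>y. H y $ i) x)"
      unfolding h(1)[OF True] b_def using dpos by (simp add: right_diff_distrib)
    then show ?thesis using dV step by linarith
  qed
  have fm: "(\<lambda>q. \<theta> q * nv q) \<in> borel_measurable \<mu>"
  proof (rule borel_measurable_times[OF _ nv_measurable])
    show "\<theta> \<in> borel_measurable \<mu>"
      using C1_manifold_continuous[OF \<theta>(1) open_UNIV] by (intro continuous_measurable_mu) simp
  qed
  have f0: "\<theta> q * nv q = 0" if "q \<in> carrier A" "q \<notin> chart_inv c ` ?K" for q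
    using \<theta>(3)[of q] chart_inv_map[OF c, of q] that(2) by (metis image_eqI mult_eq_0_iff)
  have VK: "V x = 0" if "x \<notin> ?K" for x using V0 ZK that by blast
  have fV: "sqrt (V x \<bullet> (g c x *v V x)) = sqrt (det (g c x)) * (\<theta> (chart_inv c x) * nv (chart_inv c x))"
    if xK: "x \<in> ?K" and xf: "chart_inv c x \<in> far R" for x
  proof -
    have x: "x \<in> chart_img c" using K xK by blast
    have "chart_inv c x \<noteq> p" using xf R dist.zero[OF p p] by (auto simp: far_def)
    then have Om: "x \<in> Om c" using x Om_iff[OF c] by blast
    \<comment> \<open>Far out the puncture cutoff is invisible, so the field is
      \<open>\<theta> grad v\<close> and its length is \<open>\<theta> * nv\<close>.\<close>
    have eH: "e x = 1" "H x = 0" using far[OF xK xf] by auto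
    have pd: "posdef (g c x)" by (rule metric_posdef[OF c x])
    let ?d = "sqrt (det (g c x))" and ?gu = "gradient ?u x"
    have Vx: "V x = (?t x * arctan (?u x) * ?d) *\<^sub>R (matrix_inv (g c x) *v ?gu)"
      using Om eH by (simp add: V_def F_def a_def flux_def)
    have pu: "pairing u u (chart_inv c x) = ?gu \<bullet> (matrix_inv (g c x) *v ?gu)"
      by (rule pairing_u_u_chart[OF c Om])
    have "V x \<bullet> (g c x *v V x) = (?t x * arctan (?u x) * ?d)\<^sup>2 * pairing u u (chart_inv c x)"
      unfolding Vx pu by (simp add: matrix_vector_mult_scaleR posdef_matrix_inv(3)[OF pd] power2_eq_square inner_commute)
    then have "sqrt (V x \<bullet> (g c x *v V x)) = \<bar>?t x * arctan (?u x) * ?d\<bar> * sqrt (pairing u u (chart_inv c x))"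
      by (simp add: real_sqrt_mult)
    also have "\<bar>?t x * arctan (?u x) * ?d\<bar> = ?t x * \<bar>arctan (?u x)\<bar> * ?d"
      using \<theta>(2) volume_density_pos[OF c x] by (simp add: abs_mult)
    finally show ?thesis
      using Om Om_iff[OF c] chart_inv_carrier[OF c x] by (simp add: nv_def)
  qed
  note est = chart_field_estimate[OF ad R VC VK main h(2) fm f0 fV]
  show "integrable \<mu> (\<lambda>q. (zeta R q)\<^sup>2 * h q)"
    and "integrable \<mu> (\<lambda>q. indicator (far R) q * zeta R q * (\<theta> q * nv q))"
    and "\<bar>\<integral>q. (zeta R q)\<^sup>2 * h q \<partial>\<mu>\<bar>
      \<le> 8 * real CARD('n) / R * (\<integral>q. indicator (far R) q * zeta R q * (\<theta> q * nv q) \<partial>\<mu>)"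
    using est by blast+
qed

section \<open>Assembling the chart estimates with weights\<close>

definition bounded_weight :: "real \<Rightarrow> ('a \<Rightarrow> real) \<Rightarrow> bool" where
  "bounded_weight R \<theta> \<longleftrightarrow> C1_manifold UNIV \<theta> \<and>
     integrable \<mu> (\<lambda>q. (zeta R q)\<^sup>2 * (\<theta> q * w q + pairing \<theta> v q)) \<and>
     integrable \<mu> (\<lambda>q. indicator (far R) q * zeta R q * (\<theta> q * nv q)) \<and>
     \<bar>\<integral>q. (zeta R q)\<^sup>2 * (\<theta> q * w q + pairing \<theta> v q) \<partial>\<mu>\<bar>
      \<le> 8 * real CARD('n) / R * (\<integral>q. indicator (far R) q * zeta R q * (\<theta> q * nv q) \<partial>\<mu>)"

lemma pairing_zero_off_support:
  assumes c: "c \<in> A" and K: "compact K" "K \<subseteq> chart_img c" and q: "q \<in> carrier A" "q \<notin> chart_inv c ` K"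
    and \<theta>: "\<And>q. \<theta> q \<noteq> 0 \<Longrightarrow> q \<in> chart_dom c \<and> chart_map c q \<in> K"
  shows "\<theta> q = 0" "pairing \<theta> f q = 0"
proof -
  have *: "\<theta> r = 0" if "r \<notin> chart_inv c ` K" for r
    using \<theta>[of r] chart_inv_map[OF c, of r] that by (metis image_eqI)
  then show "\<theta> q = 0" using q by blast
  have "closed (chart_inv c ` K)" using compact_chart_inv_image[OF c K] by (rule compact_imp_closed)
  then show "pairing \<theta> f q = 0"
    using * q by (intro pairing_locally_const[of q "- (chart_inv c ` K)" _ 0]) auto
qed

text \<open>The integrand \<open>\<theta> * w + pairing \<theta> v\<close> is the divergence of
  \<open>\<theta> grad v\<close>. A weight that vanishes near the puncture is the case
  \<open>e = 1\<close>, \<open>H = 0\<close> of \<open>piece_estimate\<close>.\<close>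

lemma bounded_weight_piece:
  assumes ad: "adapted c x0 s E D" and R: "R > 0"
    and \<theta>: "C1_manifold UNIV \<theta>" "\<And>q. \<theta> q \<ge> 0"
      "\<And>q. \<theta> q \<noteq> 0 \<Longrightarrow> q \<in> chart_dom c \<and> chart_map c q \<in> cball x0 (2 * s)"
    and S: "open S" "p \<in> S" "\<And>q. q \<in> S \<Longrightarrow> \<theta> q = 0"
  shows "bounded_weight R \<theta>"
proof -
  have c: "c \<in> A" and s: "s > 0" and img3: "cball x0 (3 * s) \<subseteq> chart_img c"
    using ad unfolding adapted_def by auto
  have "cball x0 (2 * s) \<subseteq> cball x0 (3 * s)" using s by auto
  then have K: "cball x0 (2 * s) \<subseteq> chart_img c" using img3 by blast
  have g1: "gradient (\<lambda>_. 1) y = 0" for y :: "real^'n" by (rule gradient_const)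
  have p1: "partial i (\<lambda>_. 0) y = 0" for i and y :: "real^'n" by (simp add: partial_def)
  note est = piece_estimate[OF ad R \<theta>, where e = "\<lambda>_. 1" and H = "\<lambda>_. 0" and S = S
      and h = "\<lambda>q. \<theta> q * w q + pairing \<theta> v q"]
  have off: "\<theta> q * w q + pairing \<theta> v q = 0"
    if "q \<in> carrier A" "q \<notin> chart_inv c ` cball x0 (2 * s)" for q
    using pairing_zero_off_support[OF c compact_cball K that \<theta>(3)] by simp
  have at_p: "\<theta> p * w p + pairing \<theta> v p = 0"
    using pairing_locally_const[OF p S] S by simp
  show ?thesis
    unfolding bounded_weight_def
    by (intro conjI \<theta>(1) est) (use S off at_p g1 p1 in auto)
qed

text \<open>Additivity concerns the gradients of the weights in one fixed chart, so it persists at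
  the puncture, where \<open>v\<close> need not be differentiable.\<close>

lemma pairing_add:
  assumes "C1_manifold UNIV \<theta>" "C1_manifold UNIV \<theta>'" "q \<in> carrier A"
  shows "pairing (\<lambda>q. \<theta> q + \<theta>' q) f q = pairing \<theta> f q + pairing \<theta>' f q"
proof -
  obtain c where "c \<in> A" "q \<in> chart_dom c" using assms(3) by (auto simp: carrier_def)
  note c = some_chart[OF this]
  let ?c = "SOME c. c \<in> A \<and> q \<in> chart_dom c"
  have "((\<lambda>q. \<theta> q + \<theta>' q) \<circ> chart_inv ?c) = (\<lambda>x. (\<theta> \<circ> chart_inv ?c) x + (\<theta>' \<circ> chart_inv ?c) x)"
    by auto
  moreover have "gradient \<dots> (chart_map ?c q) =
      gradient (\<theta> \<circ> chart_inv ?c) (chart_map ?c q) + gradient (\<theta>' \<circ> chart_inv ?c) (chart_map ?c q)"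
    using has_derivative_add[OF has_derivative_gradient[OF C1_manifold_differentiable[OF assms(1) c UNIV_I]]
      has_derivative_gradient[OF C1_manifold_differentiable[OF assms(2) c UNIV_I]]]
    by (intro gradient_unique) (simp add: inner_add_left)
  ultimately show ?thesis
    unfolding pairing_def chart_pairing_def by (simp add: inner_add_left)
qed

lemma C1_manifold_add: "C1_manifold U f \<Longrightarrow> C1_manifold U h \<Longrightarrow> C1_manifold U (\<lambda>q. f q + h q)"
  by (auto simp: C1_manifold_def comp_def intro: C1_on_add)

text \<open>The triangle inequality on the left meets linearity on the right, so the number of
  pieces does not enter the constant.\<close>

lemma bounded_weight_add:
  assumes R: "R > 0" and t: "bounded_weight R \<theta>" "bounded_weight R \<theta>'"
  shows "bounded_weight R (\<lambda>q. \<theta> q + \<theta>' q)"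
proof -
  have C: "C1_manifold UNIV \<theta>" "C1_manifold UNIV \<theta>'" using t by (auto simp: bounded_weight_def)
  define k where "k \<theta> q = (zeta R q)\<^sup>2 * (\<theta> q * w q + pairing \<theta> v q)" for \<theta> q
  define l where "l \<theta> q = indicator (far R) q * zeta R q * (\<theta> q * nv q)" for \<theta> q
  have k: "k (\<lambda>q. \<theta> q + \<theta>' q) q = k \<theta> q + k \<theta>' q" if "q \<in> space \<mu>" for q
    using pairing_add[OF C] that by (simp add: k_def space_mu algebra_simps)
  have l: "l (\<lambda>q. \<theta> q + \<theta>' q) = (\<lambda>q. l \<theta> q + l \<theta>' q)"
    by (simp add: l_def fun_eq_iff algebra_simps)
  have t': "integrable \<mu> (k \<theta>)" "integrable \<mu> (k \<theta>')" "integrable \<mu> (l \<theta>)" "integrable \<mu> (l \<theta>')"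
    "\<bar>integral\<^sup>L \<mu> (k \<theta>)\<bar> \<le> 8 * real CARD('n) / R * integral\<^sup>L \<mu> (l \<theta>)"
    "\<bar>integral\<^sup>L \<mu> (k \<theta>')\<bar> \<le> 8 * real CARD('n) / R * integral\<^sup>L \<mu> (l \<theta>')"
    using t unfolding bounded_weight_def k_def[abs_def] l_def[abs_def] by blast+
  have "integrable \<mu> (k (\<lambda>q. \<theta> q + \<theta>' q))"
    using Bochner_Integration.integrable_cong[OF refl, of \<mu> "k (\<lambda>q. \<theta> q + \<theta>' q)" "\<lambda>q. k \<theta> q + k \<theta>' q"]
      k t'(1,2) by simp
  moreover have "integral\<^sup>L \<mu> (k (\<lambda>q. \<theta> q + \<theta>' q)) = integral\<^sup>L \<mu> (k \<theta>) + integral\<^sup>L \<mu> (k \<theta>')"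
    using Bochner_Integration.integral_cong[OF refl, of \<mu> "k (\<lambda>q. \<theta> q + \<theta>' q)" "\<lambda>q. k \<theta> q + k \<theta>' q"]
      k t'(1,2) by simp
  moreover have "integrable \<mu> (l (\<lambda>q. \<theta> q + \<theta>' q))" using t'(3,4) by (simp add: l)
  moreover have "integral\<^sup>L \<mu> (l (\<lambda>q. \<theta> q + \<theta>' q)) = integral\<^sup>L \<mu> (l \<theta>) + integral\<^sup>L \<mu> (l \<theta>')"
    using t'(3,4) by (simp add: l)
  moreover have "\<bar>integral\<^sup>L \<mu> (k \<theta>) + integral\<^sup>L \<mu> (k \<theta>')\<bar>
      \<le> 8 * real CARD('n) / R * (integral\<^sup>L \<mu> (l \<theta>) + integral\<^sup>L \<mu> (l \<theta>'))"
    using t'(5,6) abs_triangle_ineq[of "integral\<^sup>L \<mu> (k \<theta>)" "integral\<^sup>L \<mu> (k \<theta>')"]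
    unfolding distrib_left by linarith
  ultimately show ?thesis
    using C1_manifold_add[OF C] unfolding bounded_weight_def k_def[abs_def] l_def[abs_def] by simp
qed

definition adapted_bump :: "('a \<Rightarrow> real) \<Rightarrow> bool" where
  "adapted_bump b \<longleftrightarrow> (\<exists>c x0 s E D. adapted c x0 s E D \<and> b = bump c x0 s)"

lemma adapted_bump_C1: "adapted_bump b \<Longrightarrow> C1_manifold UNIV b"
proof -
  assume "adapted_bump b"
  then obtain c x0 s E D where *: "adapted c x0 s E D" "b = bump c x0 s" unfolding adapted_bump_def by blast
  then have "c \<in> A" "s > 0" "cball x0 (3 * s) \<subseteq> chart_img c" by (auto simp: adapted_def)
  moreover from this have "cball x0 (2 * s) \<subseteq> cball x0 (3 * s)" by auto
  ultimately show ?thesis unfolding *(2) by (intro bump_C1) auto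
qed

text \<open>A partition of unity without division: \<open>r * b\<close> lives in one adapted chart,
  and the induction continues with \<open>r * (1 - b)\<close>. The total weight equals
  \<open>r\<close> wherever some bump is 1, because the product then vanishes.\<close>

lemma bounded_weight_bumps:
  assumes R: "R > 0" and S: "open S" "p \<in> S"
  shows "C1_manifold UNIV r \<Longrightarrow> (\<And>q. 0 \<le> r q) \<Longrightarrow> (\<And>q. q \<in> S \<Longrightarrow> r q = 0) \<Longrightarrow>
    (\<And>b. b \<in> set bs \<Longrightarrow> adapted_bump b) \<Longrightarrow>
    bounded_weight R (\<lambda>q. r q - r q * prod_list (map (\<lambda>b. 1 - b q) bs))"
proof (induction bs arbitrary: r)
  case Nil
  have "pairing (\<lambda>q. 0) v q = 0" if "q \<in> space \<mu>" for q
    using pairing_locally_const[of q UNIV "\<lambda>_. 0" 0] that by (simp add: space_mu)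
  then have "(zeta R q)\<^sup>2 * pairing (\<lambda>q. 0) v q = 0" if "q \<in> space \<mu>" for q using that by simp
  then have "integrable \<mu> (\<lambda>q. (zeta R q)\<^sup>2 * pairing (\<lambda>q. 0) v q)"
    "(\<integral>q. (zeta R q)\<^sup>2 * pairing (\<lambda>q. 0) v q \<partial>\<mu>) = 0"
    using Bochner_Integration.integrable_cong[OF refl, of \<mu> _ "\<lambda>_. 0::real"]
      Bochner_Integration.integral_cong[OF refl, of \<mu> _ "\<lambda>_. 0::real"] by auto
  then show ?case by (simp add: bounded_weight_def C1_manifold_const)
next
  case (Cons b bs)
  have b: "adapted_bump b" using Cons.prems(4) by simp
  then obtain c x0 s E D where ad: "adapted c x0 s E D" and beq: "b = bump c x0 s"
    unfolding adapted_bump_def by blast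
  have s: "s > 0" using ad by (simp add: adapted_def)
  have bC: "C1_manifold UNIV b" by (rule adapted_bump_C1[OF b])
  have b01: "0 \<le> b q" "b q \<le> 1" for q using bump_bounds by (simp_all add: beq)
  have "bounded_weight R (\<lambda>q. r q * b q)"
  proof (rule bounded_weight_piece[OF ad R _ _ _ S])
    show "C1_manifold UNIV (\<lambda>q. r q * b q)" by (intro C1_manifold_mult Cons.prems bC)
    show "0 \<le> r q * b q" for q using Cons.prems(2) b01 by simp
    show "q \<in> chart_dom c \<and> chart_map c q \<in> cball x0 (2 * s)" if "r q * b q \<noteq> 0" for q
      using bump_nonzero[OF s, of c x0 q] that by (simp add: beq)
    show "r q * b q = 0" if "q \<in> S" for q using Cons.prems(3)[OF that] by simp
  qed
  moreover have "bounded_weight R (\<lambda>q. r q * (1 - b q) - r q * (1 - b q) * prod_list (map (\<lambda>b. 1 - b q) bs))"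
  proof (rule Cons.IH)
    show "C1_manifold UNIV (\<lambda>q. r q * (1 - b q))"
      by (intro C1_manifold_mult C1_manifold_diff C1_manifold_const Cons.prems bC)
    show "0 \<le> r q * (1 - b q)" for q using Cons.prems(2) b01 by simp
    show "r q * (1 - b q) = 0" if "q \<in> S" for q using Cons.prems(3)[OF that] by simp
    show "adapted_bump b'" if "b' \<in> set bs" for b' using Cons.prems(4) that by simp
  qed
  ultimately have "bounded_weight R (\<lambda>q. r q * b q +
      (r q * (1 - b q) - r q * (1 - b q) * prod_list (map (\<lambda>b. 1 - b q) bs)))"
    by (rule bounded_weight_add[OF R])
  then show ?case by (simp add: algebra_simps)
qed

section \<open>The cutoff at the puncture\<close>

text \<open>In the chart this is 1 minus a bump of scale \<open>\<epsilon>\<close>. Written in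
  coordinates, it can be differentiated twice in Euclidean space.\<close>

definition cut :: "real^'n \<Rightarrow> real \<Rightarrow> real^'n \<Rightarrow> real" where
  "cut x0 \<epsilon> y = step ((y - x0) \<bullet> (y - x0) / \<epsilon>\<^sup>2)"

lemma gradient_radial:
  assumes "\<And>t. (k has_field_derivative h t) (at t)"
  shows "gradient (\<lambda>y. k ((y - x0) \<bullet> (y - x0) / \<epsilon>\<^sup>2)) (y::real^'n)
    = h ((y - x0) \<bullet> (y - x0) / \<epsilon>\<^sup>2) *\<^sub>R ((2 / \<epsilon>\<^sup>2) *\<^sub>R (y - x0))"
proof -
  have d: "((\<lambda>y. (y - x0) \<bullet> (y - x0) / \<epsilon>\<^sup>2) has_derivative (\<lambda>v. ((2 / \<epsilon>\<^sup>2) *\<^sub>R (y - x0)) \<bullet> v)) (at y)"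
    by (rule has_derivative_radial)
  then have "(\<lambda>y. (y - x0) \<bullet> (y - x0) / \<epsilon>\<^sup>2) differentiable (at y)" by (auto simp: differentiable_def)
  from gradient_compose[OF this assms] show ?thesis by (simp add: gradient_unique[OF d])
qed

lemma gradient_cut:
  "gradient (cut x0 \<epsilon>) y = step' ((y - x0) \<bullet> (y - x0) / \<epsilon>\<^sup>2) *\<^sub>R ((2 / \<epsilon>\<^sup>2) *\<^sub>R (y - x0))"
  unfolding cut_def[abs_def] by (rule gradient_radial[OF DERIV_step])

lemma cut_values:
  assumes "\<epsilon> > 0"
  shows "y \<in> cball x0 \<epsilon> \<Longrightarrow> cut x0 \<epsilon> y = 0 \<and> gradient (cut x0 \<epsilon>) y = 0"
    and "y \<notin> cball x0 (2 * \<epsilon>) \<Longrightarrow> cut x0 \<epsilon> y = 1 \<and> gradient (cut x0 \<epsilon>) y = 0"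
proof -
  show "cut x0 \<epsilon> y = 0 \<and> gradient (cut x0 \<epsilon>) y = 0" if "y \<in> cball x0 \<epsilon>"
    using step_eq_0[OF radial_bounds(1)[OF assms that]] step'_eq_0(1)[OF radial_bounds(1)[OF assms that]]
    by (simp only: gradient_cut cut_def scaleR_zero_left simp_thms)
  show "cut x0 \<epsilon> y = 1 \<and> gradient (cut x0 \<epsilon>) y = 0" if "y \<notin> cball x0 (2 * \<epsilon>)"
    using step_eq_1[OF radial_bounds(2)[OF assms that]] step'_eq_0(2)[OF radial_bounds(2)[OF assms that]]
    by (simp only: gradient_cut cut_def scaleR_zero_left simp_thms)
qed

definition cut_flux :: "('a, 'n) chart \<Rightarrow> real^'n \<Rightarrow> real \<Rightarrow> real^'n \<Rightarrow> real^'n" where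
  "cut_flux c x0 \<epsilon> y = sqrt (det (g c y)) *\<^sub>R (matrix_inv (g c y) *v gradient (cut x0 \<epsilon>) y)"

definition cut_div :: "('a, 'n) chart \<Rightarrow> real^'n \<Rightarrow> real \<Rightarrow> real^'n \<Rightarrow> real" where
  "cut_div c x0 \<epsilon> x = (\<Sum>i\<in>UNIV. partial i (\<lambda>y. cut_flux c x0 \<epsilon> y $ i) x)"

lemma C1_on_step'_radial: "C1_on S (\<lambda>y::real^'n. step' ((y - x0) \<bullet> (y - x0) / \<epsilon>\<^sup>2))"
proof -
  obtain h where h: "\<And>t. (step' has_field_derivative h t) (at t)" "continuous_on UNIV h"
    using step'_C1 by blast
  show ?thesis
    by (rule C1_on_real_compose[OF C1_on_radial_square h(1) continuous_on_subset[OF h(2)]]) simp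
qed

lemma C1_on_coordinate: "C1_on S (\<lambda>y::real^'n. y $ j - x0 $ j)"
  by (intro C1_on_diff C1_on_linear bounded_linear_vec_nth C1_on_const)

lemma gradient_cut_component:
  "gradient (cut x0 \<epsilon>) y $ j
    = (2 / \<epsilon>\<^sup>2) * (step' ((y - x0) \<bullet> (y - x0) / \<epsilon>\<^sup>2) * (y $ j - x0 $ j))"
  by (simp add: gradient_cut)

lemma C1_on_gradient_cut: "C1_on S (\<lambda>y. gradient (cut x0 \<epsilon>) y $ j)"
  unfolding gradient_cut_component
  by (intro C1_on_mult C1_on_const C1_on_step'_radial C1_on_coordinate)

lemma cut_flux_C1: "c \<in> A \<Longrightarrow> C1_on (chart_img c) (\<lambda>y. cut_flux c x0 \<epsilon> y $ i)"
  unfolding cut_flux_def by (rule C1_on_weighted_grad[OF _ subset_refl C1_on_gradient_cut])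

lemma cut_div_continuous: "c \<in> A \<Longrightarrow> continuous_on (chart_img c) (cut_div c x0 \<epsilon>)"
  unfolding cut_div_def partial_def
  by (intro continuous_on_sum C1_on_continuous_derivative cut_flux_C1)

lemma cut_div_zero:
  assumes "\<epsilon> > 0" "x \<in> ball x0 \<epsilon> \<or> x \<notin> cball x0 (2 * \<epsilon>)"
  shows "cut_div c x0 \<epsilon> x = 0"
proof -
  define W where "W = ball x0 \<epsilon> \<union> - cball x0 (2 * \<epsilon>)"
  have "open W" "x \<in> W" using assms(2) by (auto simp: W_def)
  moreover have "cut_flux c x0 \<epsilon> y $ i = 0" if "y \<in> W" for y i
  proof -
    have "gradient (cut x0 \<epsilon>) y = 0"
      using that cut_values[OF assms(1), of y x0] by (auto simp: W_def)
    then show ?thesis by (simp add: cut_flux_def)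
  qed
  ultimately have "partial i (\<lambda>y. cut_flux c x0 \<epsilon> y $ i) x = partial i (\<lambda>_. 0) x" for i
    unfolding partial_def by (subst frechet_derivative_transform[of W x _ "\<lambda>_. 0"]) auto
  then show ?thesis by (simp add: cut_div_def partial_def)
qed

text \<open>Second derivatives of a profile at scale \<open>\<epsilon>\<close> have size
  \<open>\<epsilon>\<^sup>-\<^sup>2\<close>. First derivatives are of order
  \<open>1 / \<epsilon>\<close> and fall under the same bound since
  \<open>\<epsilon> \<le> 1\<close>. \<open>M\<close> depends on the profile alone.\<close>

lemma partial_gradient_cut_bound:
  obtains M where "M > 0" "\<And>x0 \<epsilon> x i j. 0 < \<epsilon> \<Longrightarrow> \<epsilon> \<le> 1 \<Longrightarrow> x \<in> cball x0 (2 * \<epsilon>) \<Longrightarrow>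
    \<bar>gradient (cut x0 \<epsilon>) x $ j\<bar> \<le> M / \<epsilon>\<^sup>2 \<and> \<bar>partial i (\<lambda>y. gradient (cut x0 \<epsilon>) y $ j) x\<bar> \<le> M / \<epsilon>\<^sup>2"
proof -
  obtain h where h: "\<And>t. (step' has_field_derivative h t) (at t)" "continuous_on UNIV h"
    using step'_C1 by blast
  have "bounded (step' ` {0..4})" "bounded (h ` {0..4})"
    using step'_continuous continuous_on_subset[OF h(2)]
    by (auto intro!: compact_imp_bounded compact_continuous_image)
  then obtain M1 M2 where M: "M1 > 0" "\<And>t. t \<in> {0..4} \<Longrightarrow> \<bar>step' t\<bar> \<le> M1"
    "M2 > 0" "\<And>t. t \<in> {0..4} \<Longrightarrow> \<bar>h t\<bar> \<le> M2"
    by (auto simp: bounded_pos)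
  \<comment> \<open>\<open>M1\<close> and \<open>M2\<close> bound \<open>step'\<close> and its
    derivative on \<open>{0..4}\<close>, the range of the scaled squared radius on the ball of
    radius \<open>2 * \<epsilon>\<close>. The two summands dominate \<open>4 * M1\<close> for first
    derivatives and \<open>2 * M1 + 16 * M2\<close> for second ones.\<close>
  define M where "M = 4 * M1 + 16 * M2"
  show ?thesis
  proof (rule that[of M])
    show "M > 0" using M by (simp add: M_def)
    fix x0 x :: "real^'n" and \<epsilon> :: real and i j :: 'n
    assume \<epsilon>: "0 < \<epsilon>" "\<epsilon> \<le> 1" and x: "x \<in> cball x0 (2 * \<epsilon>)"
    define t where "t = (x - x0) \<bullet> (x - x0) / \<epsilon>\<^sup>2"
    have nx: "norm (x - x0) \<le> 2 * \<epsilon>" using x by (simp add: dist_norm norm_minus_commute)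
    then have "(norm (x - x0))\<^sup>2 \<le> (2 * \<epsilon>)\<^sup>2" by (rule power_mono) simp
    then have t: "t \<in> {0..4}" using \<epsilon>(1) by (simp add: t_def dot_square_norm field_simps power_mult_distrib)
    have xk: "\<bar>x $ k - x0 $ k\<bar> \<le> 2 * \<epsilon>" for k
      using component_le_norm_cart[of "x - x0" k] nx by simp
    have xk2: "\<bar>x $ k - x0 $ k\<bar> \<le> 2" for k using xk[of k] \<epsilon>(2) by linarith
    have e2: "2 / \<epsilon>\<^sup>2 > 0" using \<epsilon>(1) by simp
    have "\<bar>step' t\<bar> * \<bar>x $ j - x0 $ j\<bar> \<le> M1 * 2"
      using M(1,2) t xk2[of j] by (intro mult_mono) auto
    then have "(2 / \<epsilon>\<^sup>2) * (\<bar>step' t\<bar> * \<bar>x $ j - x0 $ j\<bar>) \<le> (2 / \<epsilon>\<^sup>2) * (M / 2)"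
      using e2 M(3) by (intro mult_left_mono) (auto simp: M_def)
    then have 1: "\<bar>gradient (cut x0 \<epsilon>) x $ j\<bar> \<le> M / \<epsilon>\<^sup>2"
      unfolding gradient_cut_component t_def[symmetric] by (simp add: abs_mult)
    have dj: "partial i (\<lambda>y. y $ j - x0 $ j) x = (if i = j then 1 else 0)"
    proof -
      have D: "((\<lambda>y. y $ j - x0 $ j) has_derivative (\<lambda>v. v $ j)) (at x)"
        by (auto intro!: derivative_eq_intros bounded_linear.has_derivative[OF bounded_linear_vec_nth])
      show ?thesis unfolding partial_def frechet_derivative_at[OF D, symmetric] by (simp add: axis_def)
    qed
    have dS: "(\<lambda>y::real^'n. step' ((y - x0) \<bullet> (y - x0) / \<epsilon>\<^sup>2)) differentiable (at x)"
      by (rule C1_on_differentiable[OF C1_on_step'_radial UNIV_I])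
    have dC: "(\<lambda>y::real^'n. y $ j - x0 $ j) differentiable (at x)"
      by (rule C1_on_differentiable[OF C1_on_coordinate UNIV_I])
    have dP: "(\<lambda>y::real^'n. step' ((y - x0) \<bullet> (y - x0) / \<epsilon>\<^sup>2) * (y $ j - x0 $ j)) differentiable (at x)"
      using dS dC by (rule differentiable_mult)
    have grad: "gradient (\<lambda>y. gradient (cut x0 \<epsilon>) y $ j) x = (2 / \<epsilon>\<^sup>2) *\<^sub>R
        (step' t *\<^sub>R gradient (\<lambda>y. y $ j - x0 $ j) x
        + (x $ j - x0 $ j) *\<^sub>R (h t *\<^sub>R ((2 / \<epsilon>\<^sup>2) *\<^sub>R (x - x0))))"
      unfolding gradient_cut_component
      using gradient_mult[OF _ dP, of "\<lambda>_. 2 / \<epsilon>\<^sup>2"] gradient_mult[OF dS dC] gradient_radial[OF h(1)]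
      by (simp add: gradient_const t_def)
    have "partial i (\<lambda>y. gradient (cut x0 \<epsilon>) y $ j) x = (2 / \<epsilon>\<^sup>2) *
        (step' t * (if i = j then 1 else 0) + (x $ j - x0 $ j) * (h t * ((2 / \<epsilon>\<^sup>2) * (x $ i - x0 $ i))))"
      using arg_cong[OF grad, of "\<lambda>w. w $ i"] dj by (simp add: gradient_def)
    also have "\<bar>\<dots>\<bar> \<le> (2 / \<epsilon>\<^sup>2) * (M1 + 8 * M2)"
    proof -
      have a: "\<bar>step' t * (if i = j then 1 else 0)\<bar> \<le> M1" using M(1,2) t by auto
      have "\<bar>x $ j - x0 $ j\<bar> * (\<bar>h t\<bar> * ((2 / \<epsilon>\<^sup>2) * \<bar>x $ i - x0 $ i\<bar>))
          \<le> (2 * \<epsilon>) * (M2 * ((2 / \<epsilon>\<^sup>2) * (2 * \<epsilon>)))"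
        using xk M(3,4) t e2 \<epsilon>(1) by (intro mult_mono mult_nonneg_nonneg) auto
      also have "\<dots> = 8 * M2" using \<epsilon>(1) by (simp add: power2_eq_square)
      finally have b: "\<bar>(x $ j - x0 $ j) * (h t * ((2 / \<epsilon>\<^sup>2) * (x $ i - x0 $ i)))\<bar> \<le> 8 * M2"
        unfolding abs_mult abs_of_pos[OF e2] .
      have "\<bar>step' t * (if i = j then 1 else 0) + (x $ j - x0 $ j) * (h t * ((2 / \<epsilon>\<^sup>2) * (x $ i - x0 $ i)))\<bar>
          \<le> M1 + 8 * M2" using abs_triangle_ineq a b by (meson add_mono order_trans)
      then show ?thesis using e2 unfolding abs_mult by (intro mult_mono) auto
    qed
    also have "\<dots> \<le> M / \<epsilon>\<^sup>2" using M \<epsilon>(1) by (simp add: M_def field_simps)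
    finally show "\<bar>gradient (cut x0 \<epsilon>) x $ j\<bar> \<le> M / \<epsilon>\<^sup>2 \<and> \<bar>partial i (\<lambda>y. gradient (cut x0 \<epsilon>) y $ j) x\<bar> \<le> M / \<epsilon>\<^sup>2"
      using 1 by blast
  qed
qed

lemma bounded_family_on_compact:
  fixes F :: "'n \<Rightarrow> 'n \<Rightarrow> 'n \<Rightarrow> real^'n \<Rightarrow> real"
  assumes "compact K" "\<And>i j k. continuous_on K (F i j k)"
  obtains B where "B > 0" "\<And>i j k x. x \<in> K \<Longrightarrow> \<bar>F i j k x\<bar> \<le> B"
proof -
  have "\<exists>b>0. \<forall>x\<in>K. \<bar>F i j k x\<bar> \<le> b" for i j k
  proof -
    have "bounded (F i j k ` K)" using assms by (intro compact_imp_bounded compact_continuous_image)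
    then show ?thesis by (auto simp: bounded_pos)
  qed
  then obtain b where b: "\<And>i j k. b i j k > 0" "\<And>i j k x. x \<in> K \<Longrightarrow> \<bar>F i j k x\<bar> \<le> b i j k" by metis
  have b0: "0 \<le> b i j k" for i j k using b(1)[of i j k] by simp
  have le: "b i j k \<le> (\<Sum>i\<in>UNIV. \<Sum>j\<in>UNIV. \<Sum>k\<in>UNIV. b i j k)" for i j k
  proof -
    have "b i j k \<le> (\<Sum>k\<in>UNIV. b i j k)" by (intro member_le_sum) (auto intro: b0)
    also have "\<dots> \<le> (\<Sum>j\<in>UNIV. \<Sum>k\<in>UNIV. b i j k)"
      by (intro member_le_sum[of j UNIV "\<lambda>j. \<Sum>k\<in>UNIV. b i j k"]) (auto intro!: sum_nonneg b0)
    also have "\<dots> \<le> (\<Sum>i\<in>UNIV. \<Sum>j\<in>UNIV. \<Sum>k\<in>UNIV. b i j k)"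
      by (intro member_le_sum[of i UNIV "\<lambda>i. \<Sum>j\<in>UNIV. \<Sum>k\<in>UNIV. b i j k"]) (auto intro!: sum_nonneg b0)
    finally show ?thesis .
  qed
  show ?thesis
    using that[of "\<Sum>i\<in>UNIV. \<Sum>j\<in>UNIV. \<Sum>k\<in>UNIV. b i j k"] b le by (meson less_le_trans order_trans)
qed

text \<open>By the product rule only the coefficients of the weighted inverse metric and their first
  derivatives meet the derivatives of the cutoff. They are bounded on a compact ball, so
  \<open>C\<close> does not depend on \<open>\<epsilon>\<close>.\<close>

lemma cut_div_bound:
  assumes c: "c \<in> A" and s: "s > 0" "cball x0 s \<subseteq> chart_img c"
  obtains C where "C > 0" "\<And>\<epsilon> x. 0 < \<epsilon> \<Longrightarrow> \<epsilon> \<le> 1 \<Longrightarrow> 2 * \<epsilon> \<le> s \<Longrightarrow> x \<in> cball x0 (2 * \<epsilon>) \<Longrightarrow>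
    \<bar>cut_div c x0 \<epsilon> x\<bar> \<le> C / \<epsilon>\<^sup>2"
proof -
  obtain M where M: "M > 0" "\<And>x0 \<epsilon> x i j. 0 < \<epsilon> \<Longrightarrow> \<epsilon> \<le> 1 \<Longrightarrow> x \<in> cball x0 (2 * \<epsilon>) \<Longrightarrow>
    \<bar>gradient (cut x0 \<epsilon>) x $ j\<bar> \<le> M / \<epsilon>\<^sup>2 \<and> \<bar>partial i (\<lambda>y. gradient (cut x0 \<epsilon>) y $ j) x\<bar> \<le> M / \<epsilon>\<^sup>2"
    using partial_gradient_cut_bound by blast
  define a where "a i j y = sqrt (det (g c y)) * matrix_inv (g c y) $ i $ j" for i j y
  have aC: "C1_on (chart_img c) (a i j)" for i j
    unfolding a_def by (intro C1_on_mult volume_density_C1 inverse_metric_C1 c)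
  have ca: "continuous_on (cball x0 s) (a i j)" for i j
    by (rule continuous_on_subset[OF C1_on_continuous[OF aC] s(2)])
  have cd: "continuous_on (cball x0 s) (\<lambda>x. partial k (a i j) x)" for i j k
    unfolding partial_def by (rule continuous_on_subset[OF C1_on_continuous_derivative[OF aC] s(2)])
  obtain B1 where B1: "B1 > 0" "\<And>i j x. x \<in> cball x0 s \<Longrightarrow> \<bar>a i j x\<bar> \<le> B1"
    using bounded_family_on_compact[of "cball x0 s" "\<lambda>i j k. a i j"] ca by auto
  obtain B2 where B2: "B2 > 0" "\<And>i j k x. x \<in> cball x0 s \<Longrightarrow> \<bar>partial k (a i j) x\<bar> \<le> B2"
    using bounded_family_on_compact[of "cball x0 s" "\<lambda>i j k. partial k (a i j)"] cd by auto
  define C where "C = real CARD('n) * (real CARD('n) * ((B1 + B2) * M))"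
  show ?thesis
  proof (rule that[of C])
    show "C > 0" using B1(1) B2(1) M(1) by (simp add: C_def)
    fix \<epsilon> x assume \<epsilon>: "0 < \<epsilon>" "\<epsilon> \<le> 1" "2 * \<epsilon> \<le> s" and x: "x \<in> cball x0 (2 * \<epsilon>)"
    have xs: "x \<in> cball x0 s" using x \<epsilon>(3) by auto
    then have xi: "x \<in> chart_img c" using s(2) by blast
    let ?G = "\<lambda>j y. gradient (cut x0 \<epsilon>) y $ j"
    have fl: "(\<lambda>y. cut_flux c x0 \<epsilon> y $ i) = (\<lambda>y. \<Sum>j\<in>UNIV. a i j y * ?G j y)" for i
      by (simp add: cut_flux_def a_def matrix_vector_mult_def sum_distrib_left mult.assoc fun_eq_iff)
    have da: "a i j differentiable (at x)" for i j by (rule C1_on_differentiable[OF aC xi])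
    have dG: "?G j differentiable (at x)" for j by (rule C1_on_differentiable[OF C1_on_gradient_cut UNIV_I])
    have "partial i (\<lambda>y. cut_flux c x0 \<epsilon> y $ i) x
        = (\<Sum>j\<in>UNIV. a i j x * partial i (?G j) x + ?G j x * partial i (a i j) x)" for i
    proof -
      have "gradient (\<lambda>y. \<Sum>j\<in>UNIV. a i j y * ?G j y) x
          = (\<Sum>j\<in>UNIV. a i j x *\<^sub>R gradient (?G j) x + ?G j x *\<^sub>R gradient (a i j) x)"
        using da dG by (subst gradient_sum) (auto intro!: differentiable_mult sum.cong gradient_mult)
      from arg_cong[OF this, of "\<lambda>w. w $ i"] show ?thesis unfolding fl by (simp add: gradient_def)
    qed
    then have "\<bar>cut_div c x0 \<epsilon> x\<bar>
        = \<bar>\<Sum>i\<in>UNIV. \<Sum>j\<in>UNIV. a i j x * partial i (?G j) x + ?G j x * partial i (a i j) x\<bar>"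
      by (simp add: cut_div_def)
    also have "\<dots> \<le> (\<Sum>i\<in>(UNIV::'n set). \<Sum>j\<in>(UNIV::'n set). (B1 + B2) * M / \<epsilon>\<^sup>2)"
    proof (intro order_trans[OF sum_abs] sum_mono)
      fix i j
      note m = M(2)[OF \<epsilon>(1,2) x, of j i]
      have "\<bar>a i j x * partial i (?G j) x\<bar> \<le> B1 * (M / \<epsilon>\<^sup>2)"
        unfolding abs_mult using B1 xs m by (intro mult_mono) auto
      moreover have "\<bar>?G j x * partial i (a i j) x\<bar> \<le> (M / \<epsilon>\<^sup>2) * B2"
        unfolding abs_mult using B2 xs m M(1) by (intro mult_mono) auto
      ultimately have "\<bar>a i j x * partial i (?G j) x + ?G j x * partial i (a i j) x\<bar>
          \<le> B1 * (M / \<epsilon>\<^sup>2) + (M / \<epsilon>\<^sup>2) * B2"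
        using abs_triangle_ineq by (meson add_mono order_trans)
      then show "\<bar>a i j x * partial i (?G j) x + ?G j x * partial i (a i j) x\<bar> \<le> (B1 + B2) * M / \<epsilon>\<^sup>2"
        by (simp add: algebra_simps add_divide_distrib)
    qed
    also have "\<dots> = C / \<epsilon>\<^sup>2" by (simp add: C_def)
    finally show "\<bar>cut_div c x0 \<epsilon> x\<bar> \<le> C / \<epsilon>\<^sup>2" .
  qed
qed

section \<open>The error term at the puncture\<close>

definition puncture_error :: "('a, 'n) chart \<Rightarrow> real^'n \<Rightarrow> real \<Rightarrow> real" where
  "puncture_error c x0 \<epsilon> =
     (\<integral>x. indicator (cball x0 (2 * \<epsilon>)) x * (v (chart_inv c x) * cut_div c x0 \<epsilon> x) \<partial>lborel)"

text \<open>Weighted Young splits the integrand into \<open>t * u\<^sup>2\<close> and a multiple of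
  \<open>1 / (t * \<epsilon> ^ 4)\<close>. The volume of the ball cancels
  \<open>\<epsilon> ^ 4\<close>, so a large fixed \<open>t\<close> controls the second part for
  every \<open>\<epsilon>\<close>, and then a small ball controls the first.\<close>

lemma puncture_error_small:
  assumes dim: "CARD('n) \<ge> 4" and sq: "integrable \<mu> (\<lambda>q. indicator N q * (u q)\<^sup>2)"
    and c: "c \<in> A" "p \<in> chart_dom c" "x0 = chart_map c p" and s: "s > 0" "cball x0 s \<subseteq> chart_img c"
    and \<delta>: "\<delta> > 0" and \<epsilon>1: "\<epsilon>1 > 0"
  shows "\<exists>\<epsilon>. 0 < \<epsilon> \<and> \<epsilon> < \<epsilon>1 \<and> \<bar>puncture_error c x0 \<epsilon>\<bar> \<le> \<delta>"
proof -
  obtain C where C: "C > 0" "\<And>\<epsilon> x. 0 < \<epsilon> \<Longrightarrow> \<epsilon> \<le> 1 \<Longrightarrow> 2 * \<epsilon> \<le> s \<Longrightarrow> x \<in> cball x0 (2 * \<epsilon>) \<Longrightarrow>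
    \<bar>cut_div c x0 \<epsilon> x\<bar> \<le> C / \<epsilon>\<^sup>2"
    using cut_div_bound[OF c(1) s] by blast
  let ?P = "cball x0 s - {x0}"
  have POm: "?P \<subseteq> Om c"
  proof
    fix x assume x: "x \<in> ?P"
    then have xi: "x \<in> chart_img c" using s(2) by blast
    moreover have "chart_inv c x \<noteq> p" using x c(3) chart_map_inv[OF c(1) xi] by auto
    ultimately show "x \<in> Om c" using Om_iff[OF c(1)] by blast
  qed
  define G where "G x = indicator ?P x * (u (chart_inv c x))\<^sup>2" for x
  have uc: "continuous_on ?P (\<lambda>x. (u (chart_inv c x))\<^sup>2)"
    using C1_on_continuous[OF Ck2_imp_C1[OF u_C2[OF c(1)]]] continuous_on_subset[OF _ POm]
    by (intro continuous_intros) (simp add: comp_def)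
  have Gm: "G \<in> borel_measurable borel"
    unfolding G_def using borel_measurable_continuous_on_indicator[OF _ uc] by simp
  have G0: "0 \<le> G x" for x by (simp add: G_def)
  have Gint: "integrable lborel G"
  proof -
    have "continuous_on (cball x0 s) (\<lambda>x. sqrt (det (g c x)))"
      by (rule continuous_on_subset[OF C1_on_continuous[OF volume_density_C1[OF c(1)]] s(2)])
    moreover have "x0 \<in> cball x0 s" using s(1) by simp
    ultimately obtain y where y: "y \<in> cball x0 s" "\<And>x. x \<in> cball x0 s \<Longrightarrow> sqrt (det (g c y)) \<le> sqrt (det (g c x))"
      using continuous_attains_inf[OF compact_cball, of x0 s "\<lambda>x. sqrt (det (g c x))"] by blast
    \<comment> \<open>The volume density is at least \<open>m\<close> on the ball, so square
      integrability passes from \<open>\<mu>\<close> to Lebesgue measure in the chart.\<close>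
    define m where "m = sqrt (det (g c y))"
    have m: "m > 0" using volume_density_pos[OF c(1)] y(1) s(2) by (auto simp: m_def)
    define f where "f q = indicator (chart_dom c) q * (indicator N q * (u q)\<^sup>2)" for q
    have D: "chart_dom c \<in> sets \<mu>"
      using chart_open(1)[OF c(1)] chart_dom_subset[OF c(1)] by (auto simp: in_sets_mu borel_open)
    have fi: "integrable \<mu> f"
      unfolding f_def using integrable_mult_indicator[OF D sq] by simp
    have "integrable lborel (\<lambda>x. density_chart c x * f (chart_inv c x))"
      using chart_integral(1)[OF c(1) borel_measurable_integrable[OF fi]] fi by (simp add: f_def)
    then have "integrable lborel (\<lambda>x. (1 / m) * (density_chart c x * f (chart_inv c x)))"
      by (rule integrable_mult_right)
    then show ?thesis
    proof (rule Bochner_Integration.integrable_bound)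
      show "G \<in> borel_measurable lborel" using Gm by simp
      show "AE x in lborel. norm (G x) \<le> norm ((1 / m) * (density_chart c x * f (chart_inv c x)))"
      proof (rule AE_I2)
        fix x
        show "norm (G x) \<le> norm ((1 / m) * (density_chart c x * f (chart_inv c x)))"
        proof (cases "x \<in> ?P")
          case True
          then have x: "x \<in> chart_img c" "chart_inv c x \<in> N" "chart_inv c x \<in> chart_dom c"
            using POm Om_iff[OF c(1)] chart_inv_carrier[OF c(1)] chart_inv_mem[OF c(1)] by blast+
          have "m \<le> sqrt (det (g c x))" using y(2) True by (simp add: m_def)
          then have "(u (chart_inv c x))\<^sup>2 * m \<le> (u (chart_inv c x))\<^sup>2 * sqrt (det (g c x))"
            by (rule mult_left_mono) simp
          then have "(u (chart_inv c x))\<^sup>2 \<le> (1 / m) * (sqrt (det (g c x)) * (u (chart_inv c x))\<^sup>2)"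
            using m by (simp add: field_simps)
          moreover have "norm ((1 / m) * (density_chart c x * f (chart_inv c x)))
              = (1 / m) * (sqrt (det (g c x)) * (u (chart_inv c x))\<^sup>2)"
            using x m volume_density_pos[OF c(1) x(1)] by (simp add: density_chart_def f_def abs_mult)
          moreover have "norm (G x) = (u (chart_inv c x))\<^sup>2" using True by (simp add: G_def)
          ultimately show ?thesis by simp
        next
          case False
          then have "G x = 0" by (simp add: G_def)
          then show ?thesis by simp
        qed
      qed
    qed
  qed
  define V where "V = unit_ball_vol (real CARD('n))"
  have V: "V \<ge> 0" by (simp add: V_def)
  \<comment> \<open>Chosen so that the second Young term is at most \<open>\<delta> / 2\<close>,
    uniformly in \<open>\<epsilon>\<close>; the summand 1 ensures \<open>t > 0\<close>.\<close>
  define t where "t = 2 * (C\<^sup>2 * (16 * V) + 1) / \<delta>"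
  have t: "t > 0" "C\<^sup>2 * (16 * V) / t \<le> \<delta> / 2"
  proof -
    have pos: "C\<^sup>2 * (16 * V) + 1 > 0" using V by (intro add_nonneg_pos) auto
    then show "t > 0" using \<delta> by (simp add: t_def)
    have "C\<^sup>2 * (16 * V) / t = (C\<^sup>2 * (16 * V) / (C\<^sup>2 * (16 * V) + 1)) * (\<delta> / 2)" by (simp add: t_def)
    also have "\<dots> \<le> 1 * (\<delta> / 2)" using pos \<delta> by (intro mult_right_mono) auto
    finally show "C\<^sup>2 * (16 * V) / t \<le> \<delta> / 2" by simp
  qed
  \<comment> \<open>The balls shrink to a point and \<open>G\<close> is integrable. In dimension 4
    this is the only source of smallness, as the powers of \<open>\<epsilon>\<close> cancel.\<close>
  have "(\<lambda>k. \<integral>x. indicator (cball x0 (2 / real (Suc k))) x * G x \<partial>lborel) \<longlonglongrightarrow> (\<integral>x. (0::real) \<partial>(lborel :: (real^'n) measure))"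
  proof (rule integral_dominated_convergence[where w = G])
    show "AE x in lborel. (\<lambda>k. indicator (cball x0 (2 / real (Suc k))) x * G x) \<longlonglongrightarrow> 0"
    proof (rule AE_I2)
      fix x
      show "(\<lambda>k. indicator (cball x0 (2 / real (Suc k))) x * G x) \<longlonglongrightarrow> 0"
      proof (cases "x = x0")
        case True then show ?thesis by (simp add: G_def)
      next
        case False
        have "(\<lambda>k. 2 * inverse (real (Suc k))) \<longlonglongrightarrow> 0"
          using tendsto_mult_left[OF LIMSEQ_inverse_real_of_nat, of 2] by simp
        from order_tendstoD(2)[OF this, of "dist x0 x"]
        have "\<forall>\<^sub>F k in sequentially. 2 * inverse (real (Suc k)) < dist x0 x"
          using False by simp
        then have "\<forall>\<^sub>F k in sequentially. indicator (cball x0 (2 / real (Suc k))) x * G x = 0"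
          by eventually_elim (simp add: divide_inverse)
        then show ?thesis by (rule tendsto_eventually)
      qed
    qed
    show "AE x in lborel. norm (indicator (cball x0 (2 / real (Suc k))) x * G x) \<le> G x" for k
      using G0 by (intro AE_I2) (simp split: split_indicator)
    show "(\<lambda>x. indicator (cball x0 (2 / real (Suc k))) x * G x) \<in> borel_measurable lborel" for k
      using Gm by (intro borel_measurable_times borel_measurable_indicator) auto
  qed (use Gint in auto)
  then have lim0: "(\<lambda>k. \<integral>x. indicator (cball x0 (2 / real (Suc k))) x * G x \<partial>lborel) \<longlonglongrightarrow> 0" by simp
  have "\<forall>\<^sub>F k in sequentially. (\<integral>x. indicator (cball x0 (2 / real (Suc k))) x * G x \<partial>lborel) < \<delta> / (2 * t)"
    by (rule order_tendstoD(2)[OF lim0]) (use \<delta> t(1) in simp)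
  moreover have "\<forall>\<^sub>F k in sequentially. inverse (real (Suc k)) < min \<epsilon>1 (min (1 / 2) (s / 2))"
    by (rule order_tendstoD(2)[OF LIMSEQ_inverse_real_of_nat]) (use \<epsilon>1 s(1) in simp)
  ultimately obtain k where k: "(\<integral>x. indicator (cball x0 (2 / real (Suc k))) x * G x \<partial>lborel) < \<delta> / (2 * t)"
    "inverse (real (Suc k)) < min \<epsilon>1 (min (1 / 2) (s / 2))"
    using eventually_happens'[OF sequentially_bot eventually_conj] by blast
  define \<epsilon> where "\<epsilon> = inverse (real (Suc k))"
  have \<epsilon>_less: "\<epsilon> < \<epsilon>1" "\<epsilon> < 1 / 2" "\<epsilon> < s / 2"
    using k(2) unfolding \<epsilon>_def[symmetric] min_less_iff_conj by blast+
  have \<epsilon>_pos: "\<epsilon> > 0" unfolding \<epsilon>_def by (simp only: inverse_positive_iff_positive of_nat_0_less_iff zero_less_Suc)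
  have \<epsilon>_eq: "2 / real (Suc k) = 2 * \<epsilon>" unfolding \<epsilon>_def by (rule divide_inverse)
  have half: "2 * \<epsilon> \<le> 1" using \<epsilon>_less(2) by linarith
  have \<epsilon>: "\<epsilon> > 0" "\<epsilon> < \<epsilon>1" "\<epsilon> \<le> 1" "2 * \<epsilon> \<le> s" "2 / real (Suc k) = 2 * \<epsilon>"
    using \<epsilon>_less \<epsilon>_pos \<epsilon>_eq by linarith+
  let ?K = "cball x0 (2 * \<epsilon>)"
  have Gk: "(\<integral>x. indicator ?K x * G x \<partial>lborel) \<le> \<delta> / (2 * t)" using k(1) unfolding \<epsilon>(5) by simp
  define B where "B x = t * (indicator ?K x * G x) + C\<^sup>2 / (t * \<epsilon> ^ 4) * indicator ?K x" for x
  have Kint: "integrable lborel (\<lambda>x. indicator ?K x :: real)"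
    by (intro integrable_real_indicator emeasure_lborel_cball_finite) auto
  have KGint: "integrable lborel (\<lambda>x. indicator ?K x * G x)"
    using integrable_mult_indicator[OF _ Gint, of ?K] by simp
  have Bint: "integrable lborel B" unfolding B_def using Kint KGint by simp
  have bound: "\<bar>indicator ?K x * (v (chart_inv c x) * cut_div c x0 \<epsilon> x)\<bar> \<le> B x" for x
  proof (cases "x \<in> ?K \<and> x \<noteq> x0")
    case False
    \<comment> \<open>The centre is split off because \<open>u\<close> has no prescribed value at
      \<open>p\<close>; near it \<open>cut_div\<close> is 0.\<close>
    then have "indicator ?K x * (v (chart_inv c x) * cut_div c x0 \<epsilon> x) = 0"
      using cut_div_zero[OF \<epsilon>(1), of x x0 c] \<epsilon>(1) by auto
    moreover have "0 \<le> B x" using t(1) \<epsilon>(1) G0 by (simp add: B_def)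
    ultimately show ?thesis by (simp only: abs_zero)
  next
    case True
    let ?U = "\<bar>u (chart_inv c x)\<bar>"
    have Gx: "G x = ?U\<^sup>2" using True \<epsilon>(4) by (simp add: G_def)
    have "\<bar>v (chart_inv c x) * cut_div c x0 \<epsilon> x\<bar> \<le> (2 * ?U) * (C / \<epsilon>\<^sup>2)"
      unfolding abs_mult using abs_Psi_le C(2)[OF \<epsilon>(1,3,4), of x] True
      by (intro mult_mono) (auto simp: v_def)
    also have "\<dots> \<le> t * ?U\<^sup>2 + C\<^sup>2 / (t * \<epsilon> ^ 4)"
    proof -
      \<comment> \<open>Completing the square with weight \<open>sqrt t\<close> gives Young's
        inequality in the required form.\<close>
      define r where "r = sqrt t"
      have r: "r > 0" "r\<^sup>2 = t" using t(1) by (auto simp: r_def)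
      have "0 \<le> (r * ?U - C / (r * \<epsilon>\<^sup>2))\<^sup>2" by simp
      also have "\<dots> = r\<^sup>2 * ?U\<^sup>2 - 2 * ?U * (C / \<epsilon>\<^sup>2) + C\<^sup>2 / (r\<^sup>2 * \<epsilon> ^ 4)"
        using r(1) \<epsilon>(1) by (simp add: power2_diff power_mult_distrib power_divide flip: power_mult)
      finally show ?thesis unfolding r(2) by simp
    qed
    finally show ?thesis using True Gx by (simp add: B_def)
  qed
  have "\<bar>puncture_error c x0 \<epsilon>\<bar> \<le> integral\<^sup>L lborel B"
  proof (cases "integrable lborel (\<lambda>x. indicator ?K x * (v (chart_inv c x) * cut_div c x0 \<epsilon> x))")
    case True
    then show ?thesis unfolding puncture_error_def using Bint bound
      by (intro integral_abs_bound_integral) auto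
  next
    \<comment> \<open>A function that is not integrable has Bochner integral 0, so the bound holds
      by this default value.\<close>
    case False
    have "0 \<le> B x" for x using bound[of x] by linarith
    then show ?thesis unfolding puncture_error_def using not_integrable_integral_eq[OF False] by simp
  qed
  also have "\<dots> = t * (\<integral>x. indicator ?K x * G x \<partial>lborel) + C\<^sup>2 / (t * \<epsilon> ^ 4) * measure lborel ?K"
    unfolding B_def using Kint KGint by simp
  also have "\<dots> \<le> t * (\<delta> / (2 * t)) + C\<^sup>2 / (t * \<epsilon> ^ 4) * (16 * V * \<epsilon> ^ 4)"
  proof (intro add_mono mult_left_mono Gk)
    have "measure lborel ?K = V * (2 * \<epsilon>) ^ CARD('n)"
      using content_cball[of "2 * \<epsilon>" x0] \<epsilon>(1) by (simp add: V_def)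
    also have "\<dots> \<le> V * (16 * \<epsilon> ^ 4)"
    proof (rule mult_left_mono[OF _ V])
      \<comment> \<open>Here the dimension enters: the base is at most 1, so the exponent can be
        lowered to 4, and 16 is \<open>2 ^ 4\<close>.\<close>
      have "(2 * \<epsilon>) ^ CARD('n) \<le> (2 * \<epsilon>) ^ 4" using dim \<epsilon>(1) half by (intro power_decreasing) auto
      then show "(2 * \<epsilon>) ^ CARD('n) \<le> 16 * \<epsilon> ^ 4" by (simp add: power_mult_distrib)
    qed
    finally show "measure lborel ?K \<le> 16 * V * \<epsilon> ^ 4" by simp
  qed (use t(1) \<epsilon>(1) in auto)
  also have "\<dots> = \<delta> / 2 + C\<^sup>2 * (16 * V) / t" using t(1) \<epsilon>(1) by simp
  also have "\<dots> \<le> \<delta>" using t(2) by simp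
  finally show ?thesis using \<epsilon>(1,2) by blast
qed

end

section \<open>The Liouville property\<close>

locale liouville_L2 = liouville A g \<mu> p u
  for A :: "('a::t2_space, 'n::finite) chart set" and g and \<mu> and p and u +
  assumes complete: "complete_riemannian A g"
    and square_integrable: "square_integrable_on \<mu> (carrier A - {p}) u"
    and dim: "CARD('n) \<ge> 4"
begin

lemma mcomplete: "dist.mcomplete"
  using complete by (simp add: complete_riemannian_def)

lemma u_square_integrable: "integrable \<mu> (\<lambda>q. indicator N q * (u q)\<^sup>2)"
  using square_integrable by (simp add: square_integrable_on_def set_integrable_def)

text \<open>Compactness of the closed ball, hence completeness of the manifold, gives a finite
  cover. The bumps are 1 on whole neighbourhoods so that the assembled weight is locally constant
  and its gradient drops out.\<close>

lemma ex_bump_cover: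
  obtains bs where "\<And>b. b \<in> set bs \<Longrightarrow> adapted_bump b"
    "\<And>q. q \<in> dist.mcball p R \<Longrightarrow> \<exists>b\<in>set bs. \<exists>W. open W \<and> q \<in> W \<and> (\<forall>r\<in>W. b r = 1)"
proof -
  have "\<exists>b W. adapted_bump b \<and> open W \<and> q \<in> W \<and> (\<forall>r\<in>W. b r = 1)" if q: "q \<in> carrier A" for q
  proof -
    obtain c s E D where c: "q \<in> chart_dom c" "adapted c (chart_map c q) s E D"
      using ex_adapted[OF q open_UNIV UNIV_I] by metis
    then have cA: "c \<in> A" and s: "s > 0" and img: "cball (chart_map c q) (3 * s) \<subseteq> chart_img c"
      by (auto simp: adapted_def)
    let ?B = "ball (chart_map c q) s"
    have "?B \<subseteq> cball (chart_map c q) (3 * s)" using s by auto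
    then have B: "?B \<subseteq> chart_img c" using img by blast
    have "open (chart_inv c ` ?B)" by (rule open_chart_inv_image[OF cA open_ball B])
    moreover have "q \<in> chart_inv c ` ?B"
      using chart_inv_map[OF cA c(1)] s by (metis centre_in_ball image_eqI)
    moreover have "bump c (chart_map c q) s r = 1" if r: "r \<in> chart_inv c ` ?B" for r
    proof -
      obtain y where y: "y \<in> ?B" "r = chart_inv c y" using r by blast
      then have "y \<in> chart_img c" using B by blast
      then show ?thesis
        using y bump_eq_1[OF s, of r c "chart_map c q"] chart_inv_mem[OF cA] chart_map_inv[OF cA] by simp
    qed
    moreover have "adapted_bump (bump c (chart_map c q) s)"
      using c(2) unfolding adapted_bump_def by blast
    ultimately show ?thesis
      by (intro exI[of _ "bump c (chart_map c q) s"] exI[of _ "chart_inv c ` ?B"] conjI ballI)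
  qed
  then obtain b W where bW: "\<And>q. q \<in> carrier A \<Longrightarrow> adapted_bump (b q) \<and> open (W q) \<and> q \<in> W q \<and> (\<forall>r\<in>W q. b q r = 1)"
    by metis
  have K: "compact (dist.mcball p R)" "dist.mcball p R \<subseteq> carrier A"
    using compact_mcball[OF mcomplete p] by auto
  have "dist.mcball p R \<subseteq> (\<Union>q\<in>dist.mcball p R. W q)" "\<And>q. q \<in> dist.mcball p R \<Longrightarrow> open (W q)"
    using bW K(2) by blast+
  then obtain Q where Q: "Q \<subseteq> dist.mcball p R" "finite Q" "dist.mcball p R \<subseteq> (\<Union>q\<in>Q. W q)"
    using compactE_image[OF K(1), of "dist.mcball p R" W] by metis
  obtain qs where qs: "set qs = Q" using finite_list[OF Q(2)] by blast
  show ?thesis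
  proof (rule that[of "map b qs"])
    show "adapted_bump b'" if "b' \<in> set (map b qs)" for b'
      using that qs Q(1) K(2) bW by auto
    show "\<exists>b\<in>set (map b qs). \<exists>W. open W \<and> q \<in> W \<and> (\<forall>r\<in>W. b r = 1)" if "q \<in> dist.mcball p R" for q
    proof -
      obtain r where "r \<in> Q" "q \<in> W r" using Q(3) \<open>q \<in> dist.mcball p R\<close> by blast
      moreover from this have "r \<in> carrier A" using Q(1) K(2) by blast
      ultimately show ?thesis using bW[of r] qs by (intro bexI[of _ "b r"] exI[of _ "W r"]) auto
    qed
  qed
qed

text \<open>The weight around \<open>p\<close> carries the puncture cutoff, and a second one covers
  the rest of the ball of radius \<open>2 * R\<close>. They add up to 1 wherever
  \<open>zeta R\<close> is nonzero, so their gradients cancel. The condition on \<open>R\<close>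
  keeps the two cutoffs apart.\<close>

lemma cutoff_estimate:
  assumes ad: "adapted c x0 s E D" and pc: "p \<in> chart_dom c" "x0 = chart_map c p"
    and R: "R > 0" "\<And>x. x \<in> cball x0 s \<Longrightarrow> rdist p (chart_inv c x) \<le> R / 2"
    and \<epsilon>: "0 < \<epsilon>" "2 * \<epsilon> < s"
  shows "integrable \<mu> (\<lambda>q. (zeta R q)\<^sup>2 * ((1 - bump c x0 \<epsilon> q) * w q))"
    and "(\<integral>q. (zeta R q)\<^sup>2 * ((1 - bump c x0 \<epsilon> q) * w q) \<partial>\<mu>)
      \<le> 2 * puncture_error c x0 \<epsilon> + 5 * (8 * real CARD('n) / R)\<^sup>2 * (\<integral>q. indicator N q * (u q)\<^sup>2 \<partial>\<mu>)"
proof -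
  have c: "c \<in> A" and s: "s > 0" and img3: "cball x0 (3 * s) \<subseteq> chart_img c"
    using ad by (auto simp: adapted_def)
  have sub: "cball x0 s \<subseteq> cball x0 (2 * s)" "cball x0 (2 * s) \<subseteq> cball x0 (3 * s)"
    "cball x0 (2 * \<epsilon>) \<subseteq> cball x0 s" "ball x0 \<epsilon> \<subseteq> cball x0 s" using s \<epsilon> by auto
  have K2: "cball x0 (2 * s) \<subseteq> chart_img c" and K1: "cball x0 s \<subseteq> chart_img c" using sub img3 by blast+
  have K\<epsilon>: "cball x0 (2 * \<epsilon>) \<subseteq> chart_img c" using K1 sub by blast
  have x0: "x0 \<in> chart_img c" using K1 s by auto
  have ip: "chart_inv c x0 = p" using chart_inv_map[OF c pc(1)] pc(2) by simp
  let ?\<theta> = "bump c x0 s" and ?\<eta> = "\<lambda>q. 1 - bump c x0 \<epsilon> q"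
  let ?e = "cut x0 \<epsilon>" and ?H = "cut_flux c x0 \<epsilon>" and ?d = "\<lambda>x. sqrt (det (g c x))"
  have \<theta>C: "C1_manifold UNIV ?\<theta>" by (rule bump_C1[OF c s K2])
  have \<eta>e: "?\<eta> (chart_inv c x) = ?e x" if "x \<in> chart_img c" for x
    by (simp add: bump_inv[OF c that] cut_def)
  \<comment> \<open>The product of \<open>v\<close> with the divergence of grad e, as a function on
    the manifold; its integral is the puncture error.\<close>
  define err where "err q = (if q \<in> chart_dom c
    then v q * (cut_div c x0 \<epsilon> (chart_map c q) / ?d (chart_map c q)) else 0)" for q
  define h where "h q = ?\<theta> q * ?\<eta> q * w q + pairing ?\<theta> v q - err q" for q
  define S where "S = chart_inv c ` ball x0 s"
  have balls: "ball x0 s \<subseteq> chart_img c" "ball x0 \<epsilon> \<subseteq> chart_img c" using K1 sub ball_subset_cball by blast+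
  have S: "open S" "p \<in> S" unfolding S_def
    using open_chart_inv_image[OF c open_ball balls(1)] ip s by (auto intro!: image_eqI[of _ _ x0])
  have \<theta>S: "?\<theta> q = 1" if q: "q \<in> S" for q
  proof -
    obtain y where y: "y \<in> ball x0 s" "q = chart_inv c y" using q unfolding S_def by blast
    then have "y \<in> chart_img c" using balls by blast
    then show ?thesis
      using y bump_eq_1[OF s, of q c x0] chart_inv_mem[OF c] chart_map_inv[OF c] by simp
  qed
  define S\<epsilon> where "S\<epsilon> = chart_inv c ` ball x0 \<epsilon>"
  have S\<epsilon>: "open S\<epsilon>" "p \<in> S\<epsilon>" unfolding S\<epsilon>_def
    using open_chart_inv_image[OF c open_ball balls(2)] ip \<epsilon>(1) by (auto intro!: image_eqI[of _ _ x0])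
  have inj: "x \<in> V" if x: "x \<in> chart_img c" and V: "chart_inv c x \<in> chart_inv c ` V" "V \<subseteq> chart_img c" for x V
  proof -
    obtain y where y: "y \<in> V" "chart_inv c x = chart_inv c y" using V(1) by blast
    then have "y \<in> chart_img c" using V(2) by blast
    then show ?thesis using y chart_map_inv[OF c, of y] chart_map_inv[OF c x] by simp
  qed
  have div0: "cut_div c x0 \<epsilon> x = 0" if "x \<notin> cball x0 (2 * \<epsilon>)" for x
    by (rule cut_div_zero[OF \<epsilon>(1)]) (use that in blast)
  have divp: "cut_div c x0 \<epsilon> x0 = 0" by (rule cut_div_zero[OF \<epsilon>(1)]) (use \<epsilon>(1) in simp)
  have \<theta>1: "?\<theta> (chart_inv c x) = 1" if "x \<in> ball x0 s" for x
    by (rule \<theta>S) (use that in \<open>auto simp: S_def\<close>)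
  have \<epsilon>s: "cball x0 (2 * \<epsilon>) \<subseteq> ball x0 s" using \<epsilon> by auto
  have pair_S: "pairing ?\<theta> v q = 0" if "q \<in> S" for q
  proof (rule pairing_locally_const[OF _ S(1) that \<theta>S])
    show "q \<in> carrier A" using that balls(1) chart_inv_carrier[OF c] by (auto simp: S_def)
  qed
  have \<theta>supp: "q \<in> chart_dom c \<and> chart_map c q \<in> cball x0 (2 * s)" if "?\<theta> q \<noteq> 0" for q
    by (rule bump_nonzero[OF s that])
  have h_in: "h (chart_inv c x) = ?\<theta> (chart_inv c x) * ?e x * w (chart_inv c x)
        + pairing ?\<theta> v (chart_inv c x)
        - ?\<theta> (chart_inv c x) * v (chart_inv c x) * ((\<Sum>i\<in>UNIV. partial i (\<lambda>y. ?H y $ i) x) / ?d x)"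
    if Om: "x \<in> Om c" for x
  proof -
    have x: "x \<in> chart_img c" using Om Om_iff[OF c] by blast
    have "err (chart_inv c x) = v (chart_inv c x) * (cut_div c x0 \<epsilon> x / ?d x)"
      using chart_inv_mem[OF c x] chart_map_inv[OF c x] by (simp add: err_def)
    also have "\<dots> = ?\<theta> (chart_inv c x) * v (chart_inv c x) * (cut_div c x0 \<epsilon> x / ?d x)"
    proof (cases "x \<in> cball x0 (2 * \<epsilon>)")
      case True
      then have "?\<theta> (chart_inv c x) = 1" using \<theta>1 \<epsilon>s by blast
      then show ?thesis by simp
    next
      case False
      then show ?thesis using div0 by simp
    qed
    finally show ?thesis by (simp add: h_def \<eta>e[OF x] cut_div_def)
  qed
  have err0: "err q = 0" if "q \<in> carrier A" "q \<notin> chart_inv c ` cball x0 (2 * \<epsilon>)" for q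
  proof (cases "q \<in> chart_dom c")
    case True
    then have "chart_map c q \<notin> cball x0 (2 * \<epsilon>)"
      using that(2) chart_inv_map[OF c True] by (metis image_eqI)
    then show ?thesis using div0 by (simp add: err_def)
  qed (simp add: err_def)
  have h_off: "h q = 0" if q: "q \<in> carrier A" "q \<notin> chart_inv c ` cball x0 (2 * s)" for q
  proof -
    have "q \<notin> chart_inv c ` cball x0 (2 * \<epsilon>)" using q(2) sub by blast
    then have "err q = 0" using err0 q(1) by blast
    then show ?thesis
      using pairing_zero_off_support[OF c compact_cball K2 q \<theta>supp] by (simp add: h_def)
  qed
  have h_p: "h p = 0"
  proof -
    have "?\<eta> p = 0" using \<eta>e[OF x0] ip cut_values(1)[OF \<epsilon>(1), of x0 x0] \<epsilon>(1) by simp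
    moreover have "err p = 0" using divp pc by (simp add: err_def)
    ultimately show ?thesis using pair_S[OF S(2)] by (simp add: h_def)
  qed
  have S3: "?\<theta> (chart_inv c x) * ?e x = 0 \<and> ?\<theta> (chart_inv c x) *\<^sub>R ?H x = 0"
    if "x \<in> chart_img c" "chart_inv c x \<in> S\<epsilon>" for x
  proof -
    have "x \<in> ball x0 \<epsilon>" using inj[OF that(1) _ balls(2)] that(2) by (simp add: S\<epsilon>_def)
    then have "x \<in> cball x0 \<epsilon>" by auto
    then show ?thesis using cut_values(1)[OF \<epsilon>(1)] by (simp add: cut_flux_def)
  qed
  have sep: "gradient (?\<theta> \<circ> chart_inv c) x = 0 \<or> (?e x = 1 \<and> gradient ?e x = 0)"
    if x: "x \<in> chart_img c" for x
  proof (cases "x \<in> ball x0 s")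
    case True
    then have "chart_inv c x \<in> S" by (auto simp: S_def)
    from gradient_locally_const[OF c chart_inv_mem[OF c x] S(1) this \<theta>S] show ?thesis
      by (simp add: chart_map_inv[OF c x])
  next
    case False
    then have "x \<notin> cball x0 (2 * \<epsilon>)" using \<epsilon>s by blast
    then show ?thesis using cut_values(2)[OF \<epsilon>(1)] by blast
  qed
  have far1: "?e x = 1 \<and> ?H x = 0" if "chart_inv c x \<in> far R" for x
  proof -
    have "x \<notin> cball x0 s" using that R(2)[of x] by (auto simp: far_def)
    then have "x \<notin> cball x0 (2 * \<epsilon>)" using sub by blast
    then show ?thesis using cut_values(2)[OF \<epsilon>(1)] by (simp add: cut_flux_def)
  qed
  have eC: "C1_on (chart_img c) ?e" unfolding cut_def[abs_def] by (rule C1_on_radial_step)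
  note P = piece_estimate[OF ad R(1) \<theta>C bump_bounds(1) \<theta>supp eC cut_flux_C1[OF c]
      cut_flux_def S\<epsilon> S3 sep far1 h_in h_off h_p]
  obtain bs where bs: "\<And>b. b \<in> set bs \<Longrightarrow> adapted_bump b"
    "\<And>q. q \<in> dist.mcball p (2 * R) \<Longrightarrow> \<exists>b\<in>set bs. \<exists>W. open W \<and> q \<in> W \<and> (\<forall>r\<in>W. b r = 1)"
    using ex_bump_cover by metis
  \<comment> \<open>The factor \<open>1 - ?\<theta>\<close> vanishes on the neighbourhood
    \<open>S\<close> of the puncture, as \<open>bounded_weight_bumps\<close> requires. The bumps
    cover the ball of radius \<open>2 * R\<close>, outside which \<open>zeta R\<close> is 0.\<close>
  define \<theta>2 where "\<theta>2 q = (1 - ?\<theta> q) - (1 - ?\<theta> q) * prod_list (map (\<lambda>b. 1 - b q) bs)" for q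
  have bw: "bounded_weight R \<theta>2"
    unfolding \<theta>2_def
  proof (rule bounded_weight_bumps[OF R(1) S])
    show "C1_manifold UNIV (\<lambda>q. 1 - ?\<theta> q)" by (intro C1_manifold_diff C1_manifold_const \<theta>C)
  qed (use bump_bounds(2) \<theta>S bs(1) in auto)
  have \<theta>2C: "C1_manifold UNIV \<theta>2" using bw by (simp add: bounded_weight_def)
  have total: "?\<theta> q + \<theta>2 q = 1 \<and> pairing ?\<theta> v q + pairing \<theta>2 v q = 0"
    if q: "q \<in> carrier A" "zeta R q \<noteq> 0" for q
  proof -
    have "q \<in> dist.mcball p (2 * R)" using zeta_nonzero[OF R(1) q(2)] q(1) p by simp
    then obtain b W where W: "b \<in> set bs" "open W" "q \<in> W" "\<forall>r\<in>W. b r = 1" using bs(2) by blast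
    have one: "?\<theta> r + \<theta>2 r = 1" if "r \<in> W" for r
    proof -
      have "0 \<in> set (map (\<lambda>b. 1 - b r) bs)" using W(1,4) that by force
      then have "prod_list (map (\<lambda>b. 1 - b r) bs) = 0" by (simp add: prod_list_zero_iff)
      then show ?thesis by (simp add: \<theta>2_def)
    qed
    have "pairing (\<lambda>q. ?\<theta> q + \<theta>2 q) v q = 0"
      by (rule pairing_locally_const[OF q(1) W(2,3) one])
    then show ?thesis using pairing_add[OF \<theta>C \<theta>2C q(1)] one[OF W(3)] by simp
  qed
  \<comment> \<open>The puncture cutoff differs from 1 only where the first weight is 1. So it can
    be attached to that weight alone and still acts on the whole sum.\<close>
  have \<theta>\<eta>: "(1 - ?\<theta> q) * (1 - ?\<eta> q) = 0" for q
  proof (cases "bump c x0 \<epsilon> q = 0")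
    case False
    then have "q \<in> chart_dom c" "chart_map c q \<in> cball x0 (2 * \<epsilon>)" using bump_nonzero[OF \<epsilon>(1)] by auto
    then have "?\<theta> q = 1" using bump_eq_1[OF s] sub by blast
    then show ?thesis by simp
  qed simp
  define k where "k q = (zeta R q)\<^sup>2 * (?\<eta> q * w q)" for q
  define ke where "ke q = (zeta R q)\<^sup>2 * err q" for q
  define k1 where "k1 q = (zeta R q)\<^sup>2 * h q" for q
  define k2 where "k2 q = (zeta R q)\<^sup>2 * (\<theta>2 q * w q + pairing \<theta>2 v q)" for q
  define l where "l q = indicator (far R) q * zeta R q * nv q" for q
  define l1 where "l1 q = indicator (far R) q * zeta R q * (?\<theta> q * nv q)" for q
  define l2 where "l2 q = indicator (far R) q * zeta R q * (\<theta>2 q * nv q)" for q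
  \<comment> \<open>The pairings of the two weights with \<open>v\<close> cancel, and
    \<open>ke\<close> restores the error subtracted in \<open>h\<close>.\<close>
  have ksum: "k q = k1 q + k2 q + ke q" if "q \<in> space \<mu>" for q
  proof (cases "zeta R q = 0")
    case False
    have t: "?\<theta> q + \<theta>2 q = 1" "pairing ?\<theta> v q + pairing \<theta>2 v q = 0"
      using total[OF _ False] that by (auto simp: space_mu)
    have "?\<theta> q * ?\<eta> q + \<theta>2 q = ?\<eta> q" using \<theta>\<eta>[of q] t(1) by (simp add: algebra_simps)
    then have "?\<theta> q * ?\<eta> q * w q + \<theta>2 q * w q = ?\<eta> q * w q" by (metis distrib_right)
    then have "h q + (\<theta>2 q * w q + pairing \<theta>2 v q) + err q = ?\<eta> q * w q"
      using t(2) by (simp add: h_def)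
    then show ?thesis unfolding k_def k1_def k2_def ke_def by (metis distrib_left)
  qed (simp add: k_def k1_def k2_def ke_def)
  have lsum: "l q = l1 q + l2 q" if "q \<in> space \<mu>" for q
  proof (cases "zeta R q = 0")
    case False
    have t: "?\<theta> q + \<theta>2 q = 1" using total[OF _ False] that by (auto simp: space_mu)
    have "?\<theta> q * nv q + \<theta>2 q * nv q = nv q" using t by (metis distrib_right mult_1)
    then show ?thesis unfolding l_def l1_def l2_def by (metis distrib_left)
  qed (simp add: l_def l1_def l2_def)
  have i1: "integrable \<mu> k1" "integrable \<mu> l1"
    "\<bar>integral\<^sup>L \<mu> k1\<bar> \<le> 8 * real CARD('n) / R * integral\<^sup>L \<mu> l1"
    using P unfolding k1_def[abs_def] l1_def[abs_def] by blast+
  have i2: "integrable \<mu> k2" "integrable \<mu> l2"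
    "\<bar>integral\<^sup>L \<mu> k2\<bar> \<le> 8 * real CARD('n) / R * integral\<^sup>L \<mu> l2"
    using bw unfolding bounded_weight_def k2_def[abs_def] l2_def[abs_def] by blast+
  have err_cont: "continuous_on (carrier A) err"
  proof (rule continuous_lift[OF c _ compact_cball K\<epsilon> _ err0])
    let ?f = "\<lambda>x. v (chart_inv c x) * (cut_div c x0 \<epsilon> x / ?d x)"
    show "err (chart_inv c x) = ?f x" if "x \<in> chart_img c" for x
      using chart_inv_mem[OF c that] chart_map_inv[OF c that] by (simp add: err_def)
    have dc: "continuous_on (chart_img c) (\<lambda>x. cut_div c x0 \<epsilon> x / ?d x)"
      using volume_density_pos[OF c]
      by (intro continuous_on_divide cut_div_continuous[OF c] C1_on_continuous volume_density_C1 c)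
        (auto simp: less_imp_neq[THEN not_sym])
    have "C1_on (Om c) (v \<circ> chart_inv c)" using v_C1 c by (simp add: C1_manifold_def)
    then have "continuous_on (Om c) (\<lambda>x. v (chart_inv c x))"
      using C1_on_continuous by (fastforce simp: comp_def)
    then have 1: "continuous_on (Om c) ?f"
      by (intro continuous_on_mult continuous_on_subset[OF dc Om_subset[OF c]])
    \<comment> \<open>\<open>cut_div\<close> vanishes on this ball, so the product is continuous
      across the puncture whatever the value of \<open>v\<close> there.\<close>
    have "?f x = 0" if "x \<in> ball x0 \<epsilon>" for x
      using cut_div_zero[OF \<epsilon>(1), of x x0 c] that by simp
    then have 2: "continuous_on (ball x0 \<epsilon>) ?f"
      using continuous_on_cong[OF refl, of "ball x0 \<epsilon>" ?f "\<lambda>_. 0"] by simp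
    have "chart_img c \<subseteq> Om c \<union> ball x0 \<epsilon>"
    proof
      fix x assume x: "x \<in> chart_img c"
      show "x \<in> Om c \<union> ball x0 \<epsilon>"
      proof (cases "chart_inv c x = p")
        case True
        then have "x = x0" using chart_map_inv[OF c x] pc(2) by simp
        then show ?thesis using \<epsilon>(1) by simp
      qed (use x Om_iff[OF c] in blast)
    qed
    then show "continuous_on (chart_img c) ?f"
      using continuous_on_open_Un[OF open_Om[OF c] open_ball 1 2] continuous_on_subset by blast
  qed
  have kem: "ke \<in> borel_measurable \<mu>"
    unfolding ke_def using zeta_measurable continuous_measurable_mu[OF err_cont] by measurable
  have ke0: "ke q = 0" if "q \<in> carrier A" "q \<notin> chart_dom c" for q using that by (simp add: ke_def err_def)
  have ke_chart: "density_chart c x * ke (chart_inv c x)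
      = indicator (cball x0 (2 * \<epsilon>)) x * (v (chart_inv c x) * cut_div c x0 \<epsilon> x)" for x
  proof (cases "x \<in> cball x0 (2 * \<epsilon>)")
    case True
    then have x: "x \<in> chart_img c" using K\<epsilon> by blast
    \<comment> \<open>The support of the error lies where \<open>zeta R\<close> is 1, which makes
      its integral independent of \<open>R\<close>.\<close>
    have "rdist p (chart_inv c x) \<le> R / 2" using R(2)[of x] True sub by blast
    then have "zeta R (chart_inv c x) = 1" using R(1) by (intro zeta_eq_1) auto
    then show ?thesis
      using True x chart_inv_mem[OF c x] chart_map_inv[OF c x] volume_density_pos[OF c x]
      by (simp add: ke_def err_def density_chart_def)
  next
    case False
    have "density_chart c x * err (chart_inv c x) = 0"
    proof (cases "x \<in> chart_img c")
      case True
      then show ?thesis using div0[OF False] chart_map_inv[OF c True] by (simp add: err_def)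
    qed (simp add: density_chart_def)
    then have "density_chart c x * ke (chart_inv c x) = 0" unfolding ke_def by auto
    then show ?thesis using False by simp
  qed
  have keint: "integrable \<mu> ke"
  proof -
    define F where "F x = density_chart c x * ke (chart_inv c x)" for x
    have Fb: "F x = indicator (cball x0 (2 * \<epsilon>)) x * (?d x * err (chart_inv c x))" for x
    proof (cases "x \<in> cball x0 (2 * \<epsilon>)")
      case True
      then have x: "x \<in> chart_img c" using K\<epsilon> by blast
      then show ?thesis using True ke_chart[of x] chart_inv_mem[OF c x] chart_map_inv[OF c x] volume_density_pos[OF c x]
        by (simp add: F_def err_def)
    qed (simp add: F_def ke_chart)
    have "continuous_on (cball x0 (2 * \<epsilon>)) (\<lambda>x. ?d x * err (chart_inv c x))"
    proof (intro continuous_on_mult)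
      show "continuous_on (cball x0 (2 * \<epsilon>)) ?d"
        by (rule continuous_on_subset[OF C1_on_continuous[OF volume_density_C1[OF c]] K\<epsilon>])
      have "continuous_on (chart_img c) (\<lambda>x. err (chart_inv c x))"
        by (intro continuous_on_compose2[OF err_cont chart_inv_continuous[OF c]])
          (auto simp: chart_inv_carrier[OF c])
      then show "continuous_on (cball x0 (2 * \<epsilon>)) (\<lambda>x. err (chart_inv c x))"
        using K\<epsilon> by (rule continuous_on_subset)
    qed
    from borel_integrable_compact[OF compact_cball this] have "integrable lborel F"
      unfolding Fb[THEN ext] real_scaleR_def .
    then show ?thesis using chart_integral(1)[OF c kem ke0] by (simp add: F_def[abs_def])
  qed
  have Ike: "integral\<^sup>L \<mu> ke = puncture_error c x0 \<epsilon>"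
    using chart_integral(2)[OF c kem ke0] by (simp add: ke_chart puncture_error_def)
  have ik: "integrable \<mu> k" "integral\<^sup>L \<mu> k = integral\<^sup>L \<mu> k1 + integral\<^sup>L \<mu> k2 + integral\<^sup>L \<mu> ke"
    using Bochner_Integration.integrable_cong[OF refl, of \<mu> k "\<lambda>q. k1 q + k2 q + ke q"]
      Bochner_Integration.integral_cong[OF refl, of \<mu> k "\<lambda>q. k1 q + k2 q + ke q"]
      ksum i1(1) i2(1) keint by auto
  have il: "integrable \<mu> l" "integral\<^sup>L \<mu> l = integral\<^sup>L \<mu> l1 + integral\<^sup>L \<mu> l2"
    using Bochner_Integration.integrable_cong[OF refl, of \<mu> l "\<lambda>q. l1 q + l2 q"]
      Bochner_Integration.integral_cong[OF refl, of \<mu> l "\<lambda>q. l1 q + l2 q"]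
      lsum i1(2) i2(2) by auto
  show "integrable \<mu> (\<lambda>q. (zeta R q)\<^sup>2 * ((1 - bump c x0 \<epsilon> q) * w q))"
    using ik(1) by (simp add: k_def[abs_def])
  define M where "M = 8 * real CARD('n) / R"
  have M: "M \<ge> 0" using R(1) by (simp add: M_def)
  have young: "M * l q \<le> k q / 2 + 5 / 2 * M\<^sup>2 * (indicator N q * (u q)\<^sup>2)" if q: "q \<in> space \<mu>" for q
  proof (cases "q \<in> far R")
    case False
    have "0 \<le> k q" using w_nonneg bump_bounds(2)[of c x0 \<epsilon> q] by (simp add: k_def)
    then show ?thesis using False by (simp add: l_def)
  next
    case True
    have qN: "q \<in> N" using True R(1) dist.zero[OF p p] by (auto simp: far_def)
    have "bump c x0 \<epsilon> q = 0"
    proof (rule ccontr)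
      assume "bump c x0 \<epsilon> q \<noteq> 0"
      then have "q \<in> chart_dom c" "chart_map c q \<in> cball x0 (2 * \<epsilon>)" using bump_nonzero[OF \<epsilon>(1)] by auto
      then have "rdist p q \<le> R / 2" using R(2)[of "chart_map c q"] sub chart_inv_map[OF c] by (metis subsetD)
      then show False using True by (simp add: far_def)
    qed
    define \<Gamma> where "\<Gamma> = pairing u u q"
    define a where "a = 1 + (u q)\<^sup>2"
    define t where "t = \<bar>arctan (u q)\<bar>"
    have \<Gamma>: "\<Gamma> \<ge> 0" using pairing_u_u_nonneg[OF qN] by (simp add: \<Gamma>_def)
    have a: "a > 0" unfolding a_def by (intro add_pos_nonneg) auto
    have kq: "k q = (zeta R q)\<^sup>2 * (\<Gamma> / a)" using \<open>bump c x0 \<epsilon> q = 0\<close> qN by (simp add: k_def w_def \<Gamma>_def a_def)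
    have lq: "l q = zeta R q * (t * sqrt \<Gamma>)" using True qN by (simp add: l_def nv_def \<Gamma>_def t_def)
    \<comment> \<open>The weight \<open>sqrt a\<close> is shifted between the factors: the square of
      \<open>X\<close> is the integrand \<open>k\<close>, and in the square of \<open>Y\<close> the
      product \<open>t\<^sup>2 * a\<close> is at most 5 times the square of
      \<open>u\<close>.\<close>
    define X where "X = zeta R q * sqrt (\<Gamma> / a)"
    define Y where "Y = M * t * sqrt a"
    have "0 \<le> (X - Y)\<^sup>2" by simp
    then have "2 * (X * Y) \<le> X\<^sup>2 + Y\<^sup>2" by (simp add: power2_diff)
    moreover have "X * Y = M * l q" using a unfolding X_def Y_def lq by (simp add: real_sqrt_divide)
    moreover have "X\<^sup>2 = k q" using \<Gamma> a unfolding X_def kq by (simp add: power_mult_distrib)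
    moreover have "Y\<^sup>2 = M\<^sup>2 * (t\<^sup>2 * a)" using a unfolding Y_def by (simp add: power_mult_distrib)
    moreover have "M\<^sup>2 * (t\<^sup>2 * a) \<le> M\<^sup>2 * (5 * (u q)\<^sup>2)"
      using arctan_square_bound[of "u q"] by (intro mult_left_mono) (auto simp: t_def a_def)
    ultimately show ?thesis using qN by simp
  qed
  have "M * integral\<^sup>L \<mu> l = (\<integral>q. M * l q \<partial>\<mu>)" using il(1) by simp
  also have "\<dots> \<le> (\<integral>q. k q / 2 + 5 / 2 * M\<^sup>2 * (indicator N q * (u q)\<^sup>2) \<partial>\<mu>)"
    using il(1) ik(1) u_square_integrable young by (intro integral_mono) auto
  also have "\<dots> = integral\<^sup>L \<mu> k / 2 + 5 / 2 * M\<^sup>2 * (\<integral>q. indicator N q * (u q)\<^sup>2 \<partial>\<mu>)"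
    using ik(1) u_square_integrable by simp
  finally have Ml: "M * integral\<^sup>L \<mu> l \<le> integral\<^sup>L \<mu> k / 2 + 5 / 2 * M\<^sup>2 * (\<integral>q. indicator N q * (u q)\<^sup>2 \<partial>\<mu>)" .
  have "integral\<^sup>L \<mu> k1 + integral\<^sup>L \<mu> k2 \<le> M * integral\<^sup>L \<mu> l"
    using i1(3) i2(3) unfolding il(2) M_def[symmetric] distrib_left by linarith
  \<comment> \<open>Half of the integral of \<open>k\<close> is absorbed on the left, which is
    legitimate because \<open>k\<close> is integrable; hence the factors 2 and 5.\<close>
  then have "integral\<^sup>L \<mu> k \<le> 2 * puncture_error c x0 \<epsilon> + 5 * M\<^sup>2 * (\<integral>q. indicator N q * (u q)\<^sup>2 \<partial>\<mu>)"
    using Ml ik(2) Ike by linarith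
  then show "(\<integral>q. (zeta R q)\<^sup>2 * ((1 - bump c x0 \<epsilon> q) * w q) \<partial>\<mu>)
      \<le> 2 * puncture_error c x0 \<epsilon> + 5 * (8 * real CARD('n) / R)\<^sup>2 * (\<integral>q. indicator N q * (u q)\<^sup>2 \<partial>\<mu>)"
    by (simp add: k_def[abs_def] M_def)
qed

text \<open>A positive value would give, by continuity, an amount \<open>\<kappa>\<close> of mass of
  \<open>w\<close> on a compact set \<open>T\<close> away from the puncture. Both cutoffs are 1 on
  \<open>T\<close> for large \<open>R\<close> and small \<open>\<epsilon>\<close>, so
  \<open>cutoff_estimate\<close> bounds \<open>\<kappa>\<close> by errors that can be made smaller
  than \<open>\<kappa>\<close>.\<close>

lemma w_eq_0:
  assumes q: "q \<in> N" shows "w q = 0"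
proof (rule ccontr)
  assume "w q \<noteq> 0"
  then have wq: "w q > 0" using w_nonneg[of q] by linarith
  obtain c s E D where pc: "p \<in> chart_dom c" and ad: "adapted c (chart_map c p) s E D"
    using ex_adapted[OF p open_UNIV UNIV_I] by metis
  define x0 where "x0 = chart_map c p"
  have ad: "adapted c x0 s E D" using ad by (simp add: x0_def)
  then have c: "c \<in> A" and s: "s > 0" and img3: "cball x0 (3 * s) \<subseteq> chart_img c"
    by (auto simp: adapted_def)
  have "cball x0 s \<subseteq> cball x0 (3 * s)" using s by auto
  then have img: "cball x0 s \<subseteq> chart_img c" using img3 by blast
  have ip: "chart_inv c x0 = p" using chart_inv_map[OF c pc] by (simp add: x0_def)
  obtain U1 U2 where U: "open U1" "open U2" "p \<in> U1" "q \<in> U2" "U1 \<inter> U2 = {}"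
    using hausdorff[of p q] q by blast
  have "x0 \<in> chart_map c ` (chart_dom c \<inter> U1)" using pc U(3) by (auto simp: x0_def)
  then obtain r1 where r1: "r1 > 0" "cball x0 r1 \<subseteq> chart_map c ` (chart_dom c \<inter> U1)"
    using open_chart_map_image[OF c U(1)] open_contains_cball by metis
  \<comment> \<open>Small bumps around \<open>p\<close> are supported in \<open>U1\<close>, so they
    do not touch the part of \<open>U2\<close> where \<open>w\<close> is to be measured.\<close>
  have far_bump: "bump c x0 \<epsilon> r = 0" if \<epsilon>: "0 < \<epsilon>" "2 * \<epsilon> \<le> r1" and r: "r \<in> U2" for \<epsilon> r
  proof (rule ccontr)
    assume "bump c x0 \<epsilon> r \<noteq> 0"
    then have rr: "r \<in> chart_dom c" "chart_map c r \<in> cball x0 (2 * \<epsilon>)" using bump_nonzero[OF \<epsilon>(1)] by auto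
    then have "chart_map c r \<in> cball x0 r1" using \<epsilon>(2) by auto
    then have "chart_map c r \<in> chart_map c ` (chart_dom c \<inter> U1)" using r1(2) by blast
    then have "chart_inv c (chart_map c r) \<in> U1" unfolding chart_map_image[OF c] by blast
    then show False using r U(5) chart_inv_map[OF c rr(1)] by auto
  qed
  have cw: "continuous_on N w"
    using continuous_w continuous_on_cong[OF refl, of N w "\<lambda>q. pairing u u q / (1 + (u q)\<^sup>2)"]
    by (simp add: w_def)
  define Q where "Q = (N \<inter> w -` {w q / 2<..}) \<inter> U2"
  have Q: "open Q" "q \<in> Q"
    using continuous_open_preimage[OF cw open_N open_greaterThan] U(2,4) q wq by (auto simp: Q_def)
  obtain c' s' E' D' where q': "q \<in> chart_dom c'" "adapted c' (chart_map c' q) s' E' D'"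
    "cball (chart_map c' q) (3 * s') \<subseteq> chart_map c' ` (chart_dom c' \<inter> Q)"
    using ex_adapted[of q Q] q Q by blast
  have c': "c' \<in> A" "s' > 0" using q'(2) by (auto simp: adapted_def)
  let ?B = "cball (chart_map c' q) s'"
  have "?B \<subseteq> cball (chart_map c' q) (3 * s')" using c'(2) by auto
  then have BQ: "?B \<subseteq> chart_map c' ` (chart_dom c' \<inter> Q)" using q'(3) by blast
  then have Bimg: "?B \<subseteq> chart_img c'" by (auto simp: chart_img_def)
  define T where "T = chart_inv c' ` ?B"
  have T: "compact T" unfolding T_def by (rule compact_chart_inv_image[OF c'(1) compact_cball Bimg])
  have TQ: "T \<subseteq> Q" using BQ unfolding T_def chart_map_image[OF c'(1)] by blast
  have TA: "T \<subseteq> carrier A" using TQ by (auto simp: Q_def)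
  have Tm: "T \<in> sets \<mu>" using TA borel_compact[OF T] by (simp add: in_sets_mu)
  have indm: "(\<lambda>r. indicator T r :: real) \<in> borel_measurable \<mu>" using Tm by simp
  have ind0: "indicator T r = (0::real)" if "r \<in> carrier A" "r \<notin> chart_dom c'" for r
  proof -
    have "r \<notin> T" using that(2) Bimg chart_inv_mem[OF c'(1)] unfolding T_def by blast
    then show ?thesis by simp
  qed
  have ind_chart: "density_chart c' x * indicator T (chart_inv c' x) = indicator ?B x *\<^sub>R sqrt (det (g c' x))" for x
  proof (cases "x \<in> chart_img c'")
    case True
    have "chart_inv c' x \<in> T \<longleftrightarrow> x \<in> ?B"
    proof
      assume "chart_inv c' x \<in> T"
      then obtain y where y: "y \<in> ?B" "chart_inv c' x = chart_inv c' y" unfolding T_def by blast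
      have yi: "y \<in> chart_img c'" using Bimg y(1) by blast
      have "x = y"
        using arg_cong[OF y(2), of "chart_map c'"]
        unfolding chart_map_inv[OF c'(1) True] chart_map_inv[OF c'(1) yi] .
      then show "x \<in> ?B" using y(1) by (simp only:)
    next
      assume "x \<in> ?B"
      then show "chart_inv c' x \<in> T" unfolding T_def by (rule imageI)
    qed
    then show ?thesis using True by (simp add: density_chart_def indicator_def)
  next
    case False
    then have "x \<notin> ?B" using Bimg by blast
    then show ?thesis using False by (simp add: density_chart_def)
  qed
  have dc: "continuous_on ?B (\<lambda>x. sqrt (det (g c' x)))"
    by (rule continuous_on_subset[OF C1_on_continuous[OF volume_density_C1[OF c'(1)]] Bimg])
  have dint: "integrable lborel (\<lambda>x. indicator ?B x *\<^sub>R sqrt (det (g c' x)))"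
    by (rule borel_integrable_compact[OF compact_cball dc])
  have Tint: "integrable \<mu> (\<lambda>r. indicator T r :: real)"
    using chart_integral(1)[OF c'(1) indm ind0] dint unfolding ind_chart by simp
  define I :: real where "I = (\<integral>r. indicator T r \<partial>\<mu>)"
  \<comment> \<open>In the chart, \<open>T\<close> is a ball of positive volume on which the
    continuous volume density has a positive minimum.\<close>
  have I: "I > 0"
  proof -
    have "?B \<noteq> {}" using c'(2) by simp
    then obtain y where y: "y \<in> ?B" "\<And>x. x \<in> ?B \<Longrightarrow> sqrt (det (g c' y)) \<le> sqrt (det (g c' x))"
      using continuous_attains_inf[OF compact_cball _ dc] by blast
    define m where "m = sqrt (det (g c' y))"
    have m: "m > 0" using volume_density_pos[OF c'(1)] y(1) Bimg by (auto simp: m_def)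
    have "0 < m * measure lborel ?B" using m c'(2) by simp
    also have "\<dots> = (\<integral>x. indicator ?B x *\<^sub>R m \<partial>lborel)" by simp
    also have "\<dots> \<le> (\<integral>x. indicator ?B x *\<^sub>R sqrt (det (g c' x)) \<partial>lborel)"
    proof (rule integral_mono[OF _ dint])
      show "integrable lborel (\<lambda>x. indicator ?B x *\<^sub>R m)"
        by (rule borel_integrable_compact[OF compact_cball]) simp
      show "indicator ?B x *\<^sub>R m \<le> indicator ?B x *\<^sub>R sqrt (det (g c' x))" for x
        using y(2) by (simp add: m_def split: split_indicator)
    qed
    also have "\<dots> = I" unfolding I_def using chart_integral(2)[OF c'(1) indm ind0] unfolding ind_chart by simp
    finally show ?thesis .
  qed
  define \<kappa> where "\<kappa> = w q / 2 * I"
  have \<kappa>: "\<kappa> > 0" using wq I by (simp add: \<kappa>_def)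
  have contr: "continuous_on (chart_inv c ` cball x0 s \<union> T) (rdist p)"
    using continuous_on_rdist[OF p] by (rule continuous_on_subset) (use TA img chart_inv_carrier[OF c] in auto)
  have "compact (chart_inv c ` cball x0 s \<union> T)"
    using T compact_chart_inv_image[OF c compact_cball img] by (rule compact_Un[rotated])
  then have "bounded (rdist p ` (chart_inv c ` cball x0 s \<union> T))"
    using contr by (intro compact_imp_bounded compact_continuous_image)
  then obtain R0 where R0: "R0 > 0" "\<And>r. r \<in> chart_inv c ` cball x0 s \<union> T \<Longrightarrow> rdist p r \<le> R0"
    unfolding bounded_pos using abs_ge_self by (metis image_eqI order_trans real_norm_def)
  define U0 where "U0 = (\<integral>r. indicator N r * (u r)\<^sup>2 \<partial>\<mu>)"
  have U0: "U0 \<ge> 0" unfolding U0_def by (intro Bochner_Integration.integral_nonneg) simp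
  define K where "K = 5 * (8 * real CARD('n))\<^sup>2 * U0"
  have K: "K \<ge> 0" using U0 by (simp add: K_def)
  \<comment> \<open>\<open>2 * R0\<close> puts the coordinate ball around \<open>p\<close> within
    distance \<open>R / 2\<close> and \<open>T\<close> within distance \<open>R\<close>. The 1 gives
    \<open>R \<le> R\<^sup>2\<close>, and the last summand makes \<open>K / R\<^sup>2\<close> at
    most \<open>\<kappa> / 2\<close>.\<close>
  define R where "R = 2 * R0 + 1 + 2 * K / \<kappa>"
  have "2 * K / \<kappa> \<ge> 0" using K \<kappa> by simp
  then have R: "R \<ge> 2 * R0" "R \<ge> 1" "R \<ge> 2 * K / \<kappa>" "R > 0"
    using R0(1) unfolding R_def by linarith+
  have KR: "K / R\<^sup>2 \<le> \<kappa> / 2"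
  proof -
    have "2 * K / \<kappa> \<le> R\<^sup>2" using R(2,3) power_increasing[of 1 2 R] by simp
    then show ?thesis using \<kappa> R(4) by (simp add: field_simps)
  qed
  \<comment> \<open>The error counts twice, so \<open>\<kappa> / 8\<close> leaves
    \<open>\<kappa> / 4 + \<kappa> / 2\<close>, which is below \<open>\<kappa>\<close>.\<close>
  obtain \<epsilon> where \<epsilon>: "0 < \<epsilon>" "\<epsilon> < min (s / 2) (r1 / 2)" "\<bar>puncture_error c x0 \<epsilon>\<bar> \<le> \<kappa> / 8"
    using puncture_error_small[OF dim u_square_integrable c pc x0_def s img, of "\<kappa> / 8" "min (s / 2) (r1 / 2)"] \<kappa> s r1(1)
    by auto
  have near: "rdist p (chart_inv c x) \<le> R / 2" if "x \<in> cball x0 s" for x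
  proof -
    have "rdist p (chart_inv c x) \<le> R0" using R0(2) that by blast
    then show ?thesis using R(1) by linarith
  qed
  have \<epsilon>s: "2 * \<epsilon> < s" "2 * \<epsilon> \<le> r1" using \<epsilon>(2) by auto
  note est = cutoff_estimate[OF ad pc x0_def R(4) near \<epsilon>(1) \<epsilon>s(1)]
  have "\<kappa> = (\<integral>r. indicator T r * (w q / 2) \<partial>\<mu>)" using Tint by (simp add: \<kappa>_def I_def)
  also have "\<dots> \<le> (\<integral>r. (zeta R r)\<^sup>2 * ((1 - bump c x0 \<epsilon> r) * w r) \<partial>\<mu>)"
  proof (rule integral_mono[OF _ est(1)])
    show "integrable \<mu> (\<lambda>r. indicator T r * (w q / 2))" using Tint by simp
    fix r
    show "indicator T r * (w q / 2) \<le> (zeta R r)\<^sup>2 * ((1 - bump c x0 \<epsilon> r) * w r)"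
    proof (cases "r \<in> T")
      case True
      have "rdist p r \<le> R" using R0(2)[of r] True R(1) R0(1) by auto
      then have "zeta R r = 1" using R(4) by (intro zeta_eq_1)
      moreover have "bump c x0 \<epsilon> r = 0" using far_bump[OF \<epsilon>(1) \<epsilon>s(2)] True TQ by (auto simp: Q_def)
      moreover have "w q / 2 < w r" using True TQ by (auto simp: Q_def)
      ultimately show ?thesis using True by simp
    next
      case False
      then show ?thesis using w_nonneg[of r] bump_bounds(2)[of c x0 \<epsilon> r] by simp
    qed
  qed
  also have "\<dots> \<le> 2 * puncture_error c x0 \<epsilon> + 5 * (8 * real CARD('n) / R)\<^sup>2 * U0"
    using est(2) by (simp add: U0_def)
  also have "5 * (8 * real CARD('n) / R)\<^sup>2 * U0 = K / R\<^sup>2" by (simp add: K_def power_divide)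
  also have "2 * puncture_error c x0 \<epsilon> + K / R\<^sup>2 \<le> \<kappa> / 4 + \<kappa> / 2"
    using \<epsilon>(3) KR by linarith
  finally show False using \<kappa> by simp
qed

section \<open>From a vanishing gradient to a constant function\<close>

lemma gradient_u_eq_0:
  assumes c: "c \<in> A" and x: "x \<in> Om c" shows "gradient (u \<circ> chart_inv c) x = 0"
proof -
  have xi: "x \<in> chart_img c" "chart_inv c x \<in> N" using x Om_iff[OF c] chart_inv_carrier[OF c] by auto
  have "1 + (u (chart_inv c x))\<^sup>2 > 0" by (intro add_pos_nonneg) auto
  then have "pairing u u (chart_inv c x) = 0" using w_eq_0[OF xi(2)] xi(2) by (simp add: w_def)
  then show ?thesis
    using pairing_u_u_chart[OF c x] posdef_inv_eq_0_iff[OF metric_posdef[OF c xi(1)]] by simp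
qed

lemma u_constant_on_chart:
  assumes c: "c \<in> A" and S: "open S" "connected S" "S \<subseteq> Om c" and xy: "x \<in> S" "y \<in> S"
  shows "u (chart_inv c x) = u (chart_inv c y)"
proof -
  have "((u \<circ> chart_inv c) has_derivative (\<lambda>v. 0)) (at z)" if "z \<in> S" for z
  proof -
    have z: "z \<in> Om c" using that S(3) by blast
    have "(u \<circ> chart_inv c) differentiable (at z)"
      by (rule C1_on_differentiable[OF Ck2_imp_C1[OF u_C2[OF c]] z])
    from has_derivative_gradient[OF this] show ?thesis by (simp add: gradient_u_eq_0[OF c z])
  qed
  from has_derivative_zero_unique_connected[OF S(1,2) this xy] show ?thesis by simp
qed

text \<open>The value \<open>u p\<close> is arbitrary, so \<open>p\<close> is excluded. At
  \<open>p\<close> itself the constant comes from a punctured coordinate ball, which must be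
  connected.\<close>

lemma u_locally_constant:
  assumes q: "q \<in> carrier A"
  shows "\<exists>W k. open W \<and> q \<in> W \<and> (\<forall>r\<in>W - {p}. u r = k)"
proof (cases "q = p")
  case False
  then have qN: "q \<in> N" using q by simp
  obtain c s E D where c: "q \<in> chart_dom c" "adapted c (chart_map c q) s E D"
    "cball (chart_map c q) (3 * s) \<subseteq> chart_map c ` (chart_dom c \<inter> N)"
    using ex_adapted[OF q open_N qN] by metis
  then have cA: "c \<in> A" and s: "s > 0" by (auto simp: adapted_def)
  let ?B = "ball (chart_map c q) s"
  have "?B \<subseteq> cball (chart_map c q) (3 * s)" using s by auto
  then have B: "?B \<subseteq> Om c" using c(3) by blast
  have x: "chart_map c q \<in> ?B" using s by simp
  have "open (chart_inv c ` ?B)"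
    by (rule open_chart_inv_image[OF cA open_ball subset_trans[OF B Om_subset[OF cA]]])
  moreover have "q \<in> chart_inv c ` ?B" using chart_inv_map[OF cA c(1)] x by (metis image_eqI)
  moreover have "u r = u (chart_inv c (chart_map c q))" if "r \<in> chart_inv c ` ?B" for r
    using u_constant_on_chart[OF cA open_ball connected_ball B _ x] that by blast
  ultimately show ?thesis by blast
next
  case True
  obtain c s E D where c: "p \<in> chart_dom c" "adapted c (chart_map c p) s E D"
    using ex_adapted[OF p open_UNIV UNIV_I] by metis
  then have cA: "c \<in> A" and s: "s > 0" and img: "cball (chart_map c p) (3 * s) \<subseteq> chart_img c"
    by (auto simp: adapted_def)
  let ?x = "chart_map c p"
  let ?B = "ball ?x s" and ?S = "ball ?x s - {?x}"
  have "?B \<subseteq> cball ?x (3 * s)" using s by auto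
  then have B: "?B \<subseteq> chart_img c" using img by blast
  have S: "?S \<subseteq> Om c"
  proof
    fix y assume y: "y \<in> ?S"
    then have yi: "y \<in> chart_img c" using B by blast
    moreover have "chart_inv c y \<noteq> p" using y chart_map_inv[OF cA yi] by auto
    ultimately show "y \<in> Om c" using Om_iff[OF cA] by blast
  qed
  \<comment> \<open>Removing a point disconnects a ball only in dimension 1.\<close>
  have "aff_dim ?B = int CARD('n)" using aff_dim_open[OF open_ball, of ?x s] s by simp
  then have conn: "connected ?S" using dim by (intro connected_punctured_convex convex_ball) simp
  have opS: "open ?S" by auto
  have "\<exists>k. \<forall>y\<in>?S. u (chart_inv c y) = k"
    using u_constant_on_chart[OF cA opS conn S] by blast
  then obtain k where k: "\<And>y. y \<in> ?S \<Longrightarrow> u (chart_inv c y) = k" by blast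
  have "u r = k" if r: "r \<in> chart_inv c ` ?B - {p}" for r
  proof -
    obtain y where y: "y \<in> ?B" "r = chart_inv c y" using r by blast
    then have "y \<noteq> ?x" using r chart_inv_map[OF cA c(1)] by auto
    then show ?thesis using k y by blast
  qed
  moreover have "open (chart_inv c ` ?B)" by (rule open_chart_inv_image[OF cA open_ball B])
  moreover have "q \<in> chart_inv c ` ?B"
    using chart_inv_map[OF cA c(1)] s True by (metis centre_in_ball image_eqI)
  ultimately show ?thesis
    by (intro exI[of _ "chart_inv c ` ?B"] exI[of _ k] conjI ballI)
qed

text \<open>Connectedness is assumed for the manifold and not for the punctured one. Redefining
  \<open>u\<close> at \<open>p\<close> by its constant value nearby gives a function that is locally
  constant on the whole carrier.\<close>

lemma u_constant: "u constant_on N"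
proof -
  obtain W0 k0 where W0: "open W0" "p \<in> W0" "\<And>r. r \<in> W0 - {p} \<Longrightarrow> u r = k0"
    using u_locally_constant[OF p] by metis
  define f where "f q = (if q = p then k0 else u q)" for q
  have loc: "\<forall>\<^sub>F r in at q within carrier A. f q = f r" if q: "q \<in> carrier A" for q
  proof (cases "q = p")
    case True
    have "f q = f r" if "r \<in> W0" for r using True W0(3) that by (auto simp: f_def)
    then show ?thesis unfolding eventually_at_topological using W0(1,2) True by blast
  next
    case False
    obtain W k where W: "open W" "q \<in> W" "\<And>r. r \<in> W - {p} \<Longrightarrow> u r = k"
      using u_locally_constant[OF q] by metis
    have "f q = f r" if "r \<in> W - {p}" for r using W(2,3) that False by (simp add: f_def)
    moreover have "open (W - {p})" "q \<in> W - {p}" using W False by auto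
    ultimately show ?thesis unfolding eventually_at_topological by blast
  qed
  have const: "f x = f y" if "x \<in> carrier A" "y \<in> carrier A" for x y
    using connected_local_const[OF connected that] loc by blast
  show ?thesis
  proof (cases "N = {}")
    case False
    then obtain y where y: "y \<in> N" by blast
    have "u x = u y" if "x \<in> N" for x using const[of x y] that y by (simp add: f_def)
    then show ?thesis unfolding constant_on_def by blast
  next
    case True
    show ?thesis unfolding True constant_on_def by simp
  qed
qed

end

theorem theorem8:
  fixes A :: "('a::{t2_space, second_countable_topology}, 'n::finite) chart set"
    and g :: "('a, 'n) metric_coeffs"
    and \<mu> :: "'a measure"
    and p :: 'a
  assumes "riemannian_manifold A g"
    and "connected (carrier A)"
    and "complete_riemannian A g"
    and "riemannian_measure A g \<mu>"
    and "CARD('n) \<ge> 4"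
    and "p \<in> carrier A"
  shows "L2_Liouville A g \<mu> (carrier A - {p})"
  unfolding L2_Liouville_def
proof (intro allI impI, elim conjE)
  fix u :: "'a \<Rightarrow> real"
  assume u: "harmonic_on_manifold A g (carrier A - {p}) u" "square_integrable_on \<mu> (carrier A - {p}) u"
  interpret liouville_L2 A g \<mu> p u
    by unfold_locales (use assms u in auto)
  show "u constant_on carrier A - {p}" by (rule u_constant)
qed

end
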